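(* Assume that there exists $R>0$ with $\mathbb E\big[\|x_n\|^2\, x_n\otimes x_n\big]\preccurlyeq R^2\Sigma$ and that there exists $\sigma>0$ with $\mathbb E[\varepsilon_n^2\, x_n\otimes x_n]\preccurlyeq\sigma^2\Sigma$, where $\varepsilon_n=y_n-\langle\theta_*,x_n\rangle$. Let $\theta_0\in\mathcal H$ and, for $n\ge1$, $$\theta_n=\big[I-\gamma\, x_n\otimes x_n-\gamma\lambda I\big]\theta_{n-1}+\gamma\, y_nx_n+\lambda\gamma\,\theta_0,\qquad \bar\theta_n=\frac1{n+1}\sum_{i=0}^n\theta_i .$$ Then for any regularization parameter $0\le \lambda\le R^2/2$, any constant step-size $0<\gamma\le \frac1{2R^2}$ and every $n\ge1$, $$\mathbb E f(\bar\theta_n)-f(\theta_* )\le 3\Big(2\lambda+\frac1{\gamma n}\Big)^2\big\|\Sigma^{1/2}(\Sigma+\lambda I)^{-1}(\theta_0-\theta_* )\big\|^2+\frac{6\sigma^2}{n+1}\operatorname{tr}\big[\Sigma^2(\Sigma+\lambda I)^{-2}\big]+3\,\frac{\big\|(\Sigma+\lambda I)^{-1/2}(\theta_0-\theta_* )\big\|^2\operatorname{tr}\big(\Sigma(\Sigma+\lambda I)^{-1}\big)}{\gamma^2(n+1)^2}.$$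
   Context: $\mathcal H$ is a Euclidean space of dimension $d\ge1$. The observations $(x_n,y_n)\in\mathcal H\times\mathbb R$, $n\ge1$, are i.i.d. with $\mathbb E\|x_n\|^2$ and $\mathbb E y_n^2$ finite. The objective is $f(\theta)=\frac12\mathbb E(\langle x_n,\theta\rangle-y_n)^2$. $\Sigma=\mathbb E[x_n\otimes x_n]$ is the covariance matrix, assumed invertible, and $\theta_*=\Sigma^{-1}\mathbb E[y_nx_n]$ is the global minimizer of $f$. Here $(x\otimes x)z=\langle x,z\rangle x$, and $A\preccurlyeq B$ means that $B-A$ is positive semi-definite. $\theta_0$ is deterministic. *)

theory Defs
  imports "HOL-Probability.Probability"
begin

text \<open>
  Operators on the Euclidean space \<open>'a\<close> are bounded linear maps \<open>'a \<Rightarrow>\<^sub>L 'a\<close>. Bochner integrals of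
  such operators require the operator space to be second countable, which the library does not
  provide.
\<close>

instance blinfun :: (euclidean_space, euclidean_space) second_countable_topology
proof
  have net: "\<exists>k. finite k \<and> (cball 0 (real m) :: ('a \<Rightarrow>\<^sub>L 'b) set) \<subseteq> (\<Union>z\<in>k. ball z (1 / real (Suc n)))"
    for m n :: nat
  proof -
    have "compact (cball 0 (real m) :: ('a \<Rightarrow>\<^sub>L 'b) set)"
      by (simp add: compact_eq_bounded_closed)
    then have "\<forall>e>0. \<exists>k. finite k \<and> (cball 0 (real m) :: ('a \<Rightarrow>\<^sub>L 'b) set) \<subseteq> (\<Union>z\<in>k. ball z e)"
      by (simp add: compact_eq_totally_bounded)
    from this[rule_format, of "1 / real (Suc n)"] show ?thesis
      by simp
  qed
  define K :: "nat \<Rightarrow> nat \<Rightarrow> ('a \<Rightarrow>\<^sub>L 'b) set" where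
    "K m n = (SOME k. finite k \<and> cball 0 (real m) \<subseteq> (\<Union>z\<in>k. ball z (1 / real (Suc n))))" for m n
  have K: "finite (K m n)" "cball 0 (real m) \<subseteq> (\<Union>z\<in>K m n. ball z (1 / real (Suc n)))" for m n
    using someI_ex[OF net[of m n]] by (simp_all only: K_def)
  define B where "B = (\<Union>m n. (\<lambda>z. ball z (1 / real (Suc n))) ` K m n)"
  have "countable B"
    unfolding B_def using K(1) by (intro countable_UN countable_image) (auto intro: countable_finite)
  moreover have "topological_basis B"
  proof (rule topological_basisI)
    show "open b" if "b \<in> B" for b
      using that by (auto simp: B_def)
    fix U :: "('a \<Rightarrow>\<^sub>L 'b) set" and w assume U: "open U" "w \<in> U"
    obtain e where e: "e > 0" "ball w e \<subseteq> U"
      using U by (meson open_contains_ball)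
    obtain n where n: "1 / real (Suc n) < e / 2"
      using e(1) by (metis half_gt_zero_iff nat_approx_posE)
    obtain m where "norm w \<le> real m"
      using real_arch_simple by blast
    then have "w \<in> cball 0 (real m)"
      by simp
    then obtain z where z: "z \<in> K m n" "w \<in> ball z (1 / real (Suc n))"
      using K(2) by blast
    have "ball z (1 / real (Suc n)) \<subseteq> ball w e"
    proof
      fix v assume v: "v \<in> ball z (1 / real (Suc n))"
      have "dist w v \<le> dist z w + dist z v"
        by (metis dist_commute dist_triangle)
      with z(2) v n show "v \<in> ball w e"
        by simp
    qed
    with e z show "\<exists>b\<in>B. w \<in> b \<and> b \<subseteq> U"
      unfolding B_def by blast
  qed
  ultimately show "\<exists>B::('a \<Rightarrow>\<^sub>L 'b) set set. countable B \<and> open = generate_topology B"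
    using topological_basis_imp_subbasis by blast
qed

definition tensor_sq :: "'a::euclidean_space \<Rightarrow> 'a \<Rightarrow>\<^sub>L 'a" where
  "tensor_sq x = blinfun_scaleR_left x o\<^sub>L blinfun_inner_left x"

lemma tensor_sq_apply: "blinfun_apply (tensor_sq x) z = (x \<bullet> z) *\<^sub>R x"
  by (simp add: tensor_sq_def inner_commute)

definition pos_semidef :: "('a::euclidean_space \<Rightarrow>\<^sub>L 'a) \<Rightarrow> bool" where
  "pos_semidef A \<longleftrightarrow>
     (\<forall>u v. blinfun_apply A u \<bullet> v = u \<bullet> blinfun_apply A v) \<and> (\<forall>u. 0 \<le> blinfun_apply A u \<bullet> u)"

definition loewner_le :: "('a::euclidean_space \<Rightarrow>\<^sub>L 'a) \<Rightarrow> ('a \<Rightarrow>\<^sub>L 'a) \<Rightarrow> bool"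
    (infix "\<preceq>\<^sub>L" 50) where
  "A \<preceq>\<^sub>L B \<longleftrightarrow> pos_semidef (B - A)"

definition op_invertible :: "('a::euclidean_space \<Rightarrow>\<^sub>L 'a) \<Rightarrow> bool" where
  "op_invertible A \<longleftrightarrow> (\<exists>B. A o\<^sub>L B = id_blinfun \<and> B o\<^sub>L A = id_blinfun)"

definition op_inv :: "('a::euclidean_space \<Rightarrow>\<^sub>L 'a) \<Rightarrow> ('a \<Rightarrow>\<^sub>L 'a)" where
  "op_inv A = (THE B. A o\<^sub>L B = id_blinfun \<and> B o\<^sub>L A = id_blinfun)"

text \<open>The positive semi-definite square root; meaningful for positive semi-definite arguments.\<close>

definition op_sqrt :: "('a::euclidean_space \<Rightarrow>\<^sub>L 'a) \<Rightarrow> ('a \<Rightarrow>\<^sub>L 'a)" where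
  "op_sqrt A = (THE B. pos_semidef B \<and> B o\<^sub>L B = A)"

definition op_trace :: "('a::euclidean_space \<Rightarrow>\<^sub>L 'a) \<Rightarrow> real" where
  "op_trace A = (\<Sum>b\<in>Basis. blinfun_apply A b \<bullet> b)"

definition ls_risk :: "'w measure \<Rightarrow> ('w \<Rightarrow> 'a::euclidean_space) \<Rightarrow> ('w \<Rightarrow> real) \<Rightarrow> 'a \<Rightarrow> real" where
  "ls_risk M X Y \<theta> = (1/2) * (\<integral>\<omega>. (X \<omega> \<bullet> \<theta> - Y \<omega>)\<^sup>2 \<partial>M)"

text \<open>
  \<open>reg_sgd \<gamma> lam \<theta>\<^sub>0 a b n\<close> is the \<open>n\<close>-th iterate on a fixed sample path of inputs \<open>a\<close> and outputs
  \<open>b\<close>. Observations are numbered from 1; \<open>a 0\<close> and \<open>b 0\<close> are never used.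
\<close>

primrec reg_sgd ::
  "real \<Rightarrow> real \<Rightarrow> 'a::euclidean_space \<Rightarrow> (nat \<Rightarrow> 'a) \<Rightarrow> (nat \<Rightarrow> real) \<Rightarrow> nat \<Rightarrow> 'a" where
  "reg_sgd \<gamma> lam \<theta>\<^sub>0 a b 0 = \<theta>\<^sub>0"
| "reg_sgd \<gamma> lam \<theta>\<^sub>0 a b (Suc n) =
     blinfun_apply (id_blinfun - \<gamma> *\<^sub>R tensor_sq (a (Suc n)) - (\<gamma> * lam) *\<^sub>R id_blinfun)
       (reg_sgd \<gamma> lam \<theta>\<^sub>0 a b n)
     + (\<gamma> * b (Suc n)) *\<^sub>R a (Suc n) + (lam * \<gamma>) *\<^sub>R \<theta>\<^sub>0"

definition avg_reg_sgd ::
  "real \<Rightarrow> real \<Rightarrow> 'a::euclidean_space \<Rightarrow> (nat \<Rightarrow> 'a) \<Rightarrow> (nat \<Rightarrow> real) \<Rightarrow> nat \<Rightarrow> 'a" where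
  "avg_reg_sgd \<gamma> lam \<theta>\<^sub>0 a b n = (1 / (real n + 1)) *\<^sub>R (\<Sum>i=0..n. reg_sgd \<gamma> lam \<theta>\<^sub>0 a b i)"

end

theory Submission
  imports Defs
begin

text \<open>
  Write \<open>\<eta>\<^sub>k = \<theta>\<^sub>k - \<theta>\<^sub>s\<close>, \<open>h = \<theta>\<^sub>0 - \<theta>\<^sub>s\<close> and \<open>\<kappa>\<^sub>e = \<mu>\<^sub>e + lam\<close> for an eigenvalue \<open>\<mu>\<^sub>e\<close> of \<open>\<Sigma>\<close> with unit
  eigenvector \<open>e\<close>. In the direction \<open>e\<close> the recursion reads
  \<open>\<eta>\<^sub>k = (1 - \<gamma> \<kappa>\<^sub>e) \<eta>\<^sub>k\<^sub>-\<^sub>1 + \<gamma> lam h + \<gamma> w\<^sub>k\<close> with the martingale increments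
  \<open>w\<^sub>k = (\<Sigma> - x\<^sub>k x\<^sub>k\<^sup>T) \<eta>\<^sub>k\<^sub>-\<^sub>1 + \<epsilon>\<^sub>k x\<^sub>k\<close>, so that the sum of the iterates is a deterministic part plus
  a weighted sum of orthogonal increments, with weights at most \<open>1 / \<kappa>\<^sub>e\<close>. It remains to bound
  \<open>\<Sum>\<^sub>k E[(x\<^sub>k \<bullet> \<eta>\<^sub>k\<^sub>-\<^sub>1)\<^sup>2 Q(x\<^sub>k)]\<close> for \<open>Q = \<Sigma> (\<Sigma> + lam I)\<^sup>-\<^sup>2\<close>. With \<open>m = (\<Sigma> + lam I)\<^sup>-\<^sup>1 h\<close>, split \<open>\<eta>\<close> into
  \<open>lam m\<close>, a noiseless process started at \<open>h - lam m\<close>, a process driven by \<open>\<epsilon>\<^sub>k x\<^sub>k\<close>, and \<open>lam\<close> times a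
  process driven by \<open>(\<Sigma> - x\<^sub>k x\<^sub>k\<^sup>T) m\<close>. Everything rests on the contraction
  \<open>E \<parallel>(I - \<gamma> x x\<^sup>T - \<gamma> lam I) v\<parallel>\<^sup>2 \<le> \<parallel>v\<parallel>\<^sup>2 - \<gamma> (v \<bullet> (\<Sigma> + lam I) v)\<close>: it bounds the second moments of the
  second and third part as operators, by multiples of the identity, and yields an energy estimate
  for the fourth, where \<open>lam Q \<le> I\<close> absorbs the factor \<open>lam\<close>.
\<close>

section \<open>Orthonormal eigenbases and functions of a self-adjoint operator\<close>

text \<open>The increments contain the error itself: their second moment involves
  \<open>E[(x \<bullet> \<eta>)^2 x x^T]\<close>, while the hypotheses control only
  \<open>E[|x|^2 x x^T]\<close>, by \<open>R^2 \<Sigma>\<close>. This decides the form of the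
  intermediate bounds. If a part \<open>p\<close> of the error satisfies
  \<open>E[p p^T] \<le> c I\<close>, independence gives \<open>E[(x \<bullet> p)^2 Q(x)] \<le> c
  E[|x|^2 Q(x)] \<le> c R^2 tr(\<Sigma> Q)\<close>, so multiples of the identity are the right
  target, although the contraction itself loses in the \<open>\<Sigma> + lam I\<close> form. The
  part driven by \<open>(\<Sigma> - x x^T) m\<close> is treated differently because of its size:
  bounding the covariance of that noise by a multiple of \<Sigma> would cost \<open>|m|^2\<close>,
  whereas its trace costs only \<open>R^2 (m \<bullet> \<Sigma> m)\<close>, and
  \<open>m \<bullet> \<Sigma> m\<close> is the squared norm in the first term of the claim. An
  energy balance uses just the trace, but it controls only \<open>E[p \<bullet> \<Sigma> p]\<close>
  summed over time; hence \<open>Q(x)\<close> has to be traded for \<open>|x|^2 / lam\<close> there,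
  and the fixed factor \<open>lam^2\<close> of this part pays for it. The same trade handles the
  constant part \<open>lam m\<close>.\<close>

lemma selfadjoint_eigenvector_in_subspace:
  fixes A :: "'a::euclidean_space \<Rightarrow>\<^sub>L 'a"
  assumes sa: "\<And>u v. A u \<bullet> v = u \<bullet> A v"
    and S: "subspace S" "S \<noteq> {0}" "\<And>u. u \<in> S \<Longrightarrow> A u \<in> S"
  obtains e where "e \<in> S" "norm e = 1" "A e = (A e \<bullet> e) *\<^sub>R e"
proof -
  define T where "T = sphere 0 1 \<inter> S"
  obtain u where u: "u \<in> S" "u \<noteq> 0"
    using S subspace_0 by blast
  then have "(1 / norm u) *\<^sub>R u \<in> T"
    using S(1) by (simp add: T_def subspace_scale)
  then have "T \<noteq> {}"
    by blast
  moreover have "compact T"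
    unfolding T_def using S(1) by (intro compact_Int_closed closed_subspace) auto
  moreover have "continuous_on T (\<lambda>u. A u \<bullet> u)"
    by (intro continuous_on_inner blinfun.continuous_on continuous_on_const continuous_on_id)
  ultimately obtain e where e: "e \<in> T" and e_max: "\<And>v. v \<in> T \<Longrightarrow> A v \<bullet> v \<le> A e \<bullet> e"
    using continuous_attains_sup[of T "\<lambda>u. A u \<bullet> u"] by blast
  define \<mu> where "\<mu> = A e \<bullet> e"
  have eS: "e \<in> S" and e1: "e \<bullet> e = 1" "norm e = 1"
    using e by (auto simp: T_def norm_eq_1)
  have form: "A v \<bullet> v \<le> \<mu> * (v \<bullet> v)" if "v \<in> S" for v
  proof (cases "v = 0")
    case False
    with that S(1) have "(1 / norm v) *\<^sub>R v \<in> T"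
      by (simp add: T_def subspace_scale)
    from e_max[OF this] show ?thesis
      using False by (simp add: \<mu>_def blinfun.scaleR_right divide_simps power2_norm_eq_inner
          flip: power2_eq_square)
  qed (simp add: blinfun.zero_right)
  \<comment> \<open>The form of \<open>\<mu> I - A\<close> is non-negative on \<open>S\<close> and
    vanishes at \<open>e\<close>, so it has no first-order decrease at \<open>e\<close>. Along the
    residual \<open>r\<close> its first-order coefficient is \<open>2 * (r \<bullet> r)\<close>,
    which forces \<open>r = 0\<close>; invariance of \<open>S\<close> is what makes this direction
    admissible.\<close>
  define r where "r = \<mu> *\<^sub>R e - A e"
  have rS: "r \<in> S"
    using S eS by (simp add: r_def subspace_diff subspace_scale)
  define q where "q = \<mu> * (r \<bullet> r) - A r \<bullet> r"
  have "0 \<le> 2 * t * (r \<bullet> r) + t\<^sup>2 * q" for t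
  proof -
    have "e + t *\<^sub>R r \<in> S"
      using S(1) eS rS by (simp add: subspace_add subspace_scale)
    from form[OF this] have "0 \<le> \<mu> * ((e + t *\<^sub>R r) \<bullet> (e + t *\<^sub>R r)) - A (e + t *\<^sub>R r) \<bullet> (e + t *\<^sub>R r)"
      by simp
    also have "\<dots> = 2 * t * (\<mu> * (e \<bullet> r) - A e \<bullet> r) + t\<^sup>2 * q + (\<mu> * (e \<bullet> e) - A e \<bullet> e)"
      using sa[of r e] by (simp add: q_def blinfun.add_right blinfun.scaleR_right inner_add_left inner_add_right
          inner_commute algebra_simps power2_eq_square)
    also have "\<mu> * (e \<bullet> r) - A e \<bullet> r = r \<bullet> r"
      by (simp add: r_def inner_diff_left)
    finally show ?thesis
      by (simp add: e1 \<mu>_def)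
  qed
  note q = this
  have "r \<bullet> r \<le> 0"
  proof (rule ccontr)
    assume "\<not> r \<bullet> r \<le> 0"
    then have rr: "r \<bullet> r > 0"
      by (simp only: not_le)
    \<comment> \<open>Negative, and so small that \<open>t\<^sup>2 * q\<close> can undo at most half
      of the linear term \<open>2 * t * (r \<bullet> r)\<close>; the added 1 keeps the denominator
      positive.\<close>
    define t where "t = - (r \<bullet> r) / (\<bar>q\<bar> + 1)"
    have "t\<^sup>2 * q \<le> t\<^sup>2 * (\<bar>q\<bar> + 1)"
      by (intro mult_left_mono) auto
    also have "\<dots> = - t * (r \<bullet> r)"
      by (simp add: t_def power2_eq_square divide_simps)
    finally have "0 \<le> t * (r \<bullet> r)"
      using q[of t] by simp
    moreover have "t < 0"
      using rr by (simp add: t_def divide_neg_pos)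
    ultimately show False
      using rr by (simp add: zero_le_mult_iff)
  qed
  then have "r = 0"
    by (metis inner_ge_zero inner_eq_zero_iff order_antisym)
  then show ?thesis
    using that[OF eS e1(2)] by (simp add: r_def \<mu>_def)
qed

locale orthonormal_basis =
  fixes E :: "'a::euclidean_space set"
  assumes fin: "finite E"
    and orthonormal: "\<And>e f. e \<in> E \<Longrightarrow> f \<in> E \<Longrightarrow> e \<bullet> f = (if e = f then 1 else 0)"
    and expansion: "\<And>u. (\<Sum>e\<in>E. (u \<bullet> e) *\<^sub>R e) = u"

text \<open>Orthonormal sets of eigenvectors have at most \<open>DIM('a)\<close> elements, so one of
  maximal cardinality exists. Its orthogonal complement is invariant by self-adjointness and would
  contain a further eigenvector if it were not zero.\<close>

lemma selfadjoint_eigenbasis: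
  fixes A :: "'a::euclidean_space \<Rightarrow>\<^sub>L 'a"
  assumes sa: "\<And>u v. A u \<bullet> v = u \<bullet> A v"
  obtains E where "orthonormal_basis E" "\<And>e. e \<in> E \<Longrightarrow> A e = (A e \<bullet> e) *\<^sub>R e"
proof -
  define P where "P E \<longleftrightarrow> finite E \<and> pairwise orthogonal E \<and>
    (\<forall>e\<in>E. norm e = 1 \<and> A e = (A e \<bullet> e) *\<^sub>R e)" for E
  have card: "card E \<le> DIM('a)" if "P E" for E
  proof -
    have "0 \<notin> E"
      using that by (auto simp: P_def)
    then have "independent E"
      using that pairwise_orthogonal_independent by (auto simp: P_def)
    then show ?thesis
      using independent_bound by blast
  qed
  have "P {}"
    by (simp add: P_def)
  then obtain E where E: "P E" and E_max: "\<And>F. P F \<Longrightarrow> card F \<le> card E"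
    using ex_has_greatest_nat[of P "{}" card "Suc DIM('a)"] card by (metis le_imp_less_Suc)
  have fin: "finite E" and n1: "\<And>e. e \<in> E \<Longrightarrow> norm e = 1"
    and eig: "\<And>e. e \<in> E \<Longrightarrow> A e = (A e \<bullet> e) *\<^sub>R e"
    using E by (auto simp: P_def)
  have on: "e \<bullet> f = (if e = f then 1 else 0)" if "e \<in> E" "f \<in> E" for e f
    using that E n1 by (auto simp: P_def pairwise_def orthogonal_def norm_eq_1)
  define S where "S = {u. \<forall>e\<in>E. u \<bullet> e = 0}"
  have S: "subspace S"
    by (auto simp: S_def subspace_def inner_add_left)
  have inv: "A u \<in> S" if "u \<in> S" for u
    unfolding S_def
  proof (intro CollectI ballI)
    fix e assume e: "e \<in> E"
    have "A u \<bullet> e = u \<bullet> ((A e \<bullet> e) *\<^sub>R e)"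
      using sa eig[OF e] by simp
    also have "\<dots> = 0"
      using that e by (simp add: S_def)
    finally show "A u \<bullet> e = 0" .
  qed
  have "S = {0}"
  proof (rule ccontr)
    assume "S \<noteq> {0}"
    then obtain f where f: "f \<in> S" "norm f = 1" "A f = (A f \<bullet> f) *\<^sub>R f"
      using selfadjoint_eigenvector_in_subspace[OF sa S _ inv] by blast
    have "f \<notin> E"
      using f(1,2) by (auto simp: S_def norm_eq_1)
    moreover have "P (insert f E)"
      using E f by (auto simp: P_def S_def pairwise_insert orthogonal_def inner_commute)
    ultimately show False
      using E_max[of "insert f E"] fin by simp
  qed
  have "(\<Sum>e\<in>E. (u \<bullet> e) *\<^sub>R e) = u" for u
  proof -
    have "(\<Sum>e\<in>E. (u \<bullet> e) *\<^sub>R e) \<bullet> f = u \<bullet> f" if "f \<in> E" for f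
    proof -
      have "(\<Sum>e\<in>E. (u \<bullet> e) *\<^sub>R e) \<bullet> f = (\<Sum>e\<in>E. if e = f then u \<bullet> e else 0)"
        unfolding inner_sum_left using on that by (intro sum.cong) auto
      then show ?thesis
        using that fin by simp
    qed
    then have "u - (\<Sum>e\<in>E. (u \<bullet> e) *\<^sub>R e) \<in> S"
      by (simp add: S_def inner_diff_left)
    then show ?thesis
      using \<open>S = {0}\<close> by simp
  qed
  then have "orthonormal_basis E"
    using fin on by unfold_locales
  then show ?thesis
    using that eig by blast
qed

text \<open>This serves as functional calculus: every operator in the theorem becomes
  \<open>diag_op E a\<close> for one eigenbasis \<open>E\<close> of \<Sigma>, so that products,
  inverses, roots and traces turn into operations on the function \<open>a\<close>.\<close>

definition diag_op :: "'a::euclidean_space set \<Rightarrow> ('a \<Rightarrow> real) \<Rightarrow> 'a \<Rightarrow>\<^sub>L 'a" where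
  "diag_op E a = (\<Sum>e\<in>E. a e *\<^sub>R tensor_sq e)"

lemma op_inv_unique:
  assumes "A o\<^sub>L B = id_blinfun" "B o\<^sub>L A = id_blinfun"
  shows "op_inv A = B"
  unfolding op_inv_def
proof (rule the_equality)
  fix C assume C: "A o\<^sub>L C = id_blinfun \<and> C o\<^sub>L A = id_blinfun"
  have "C u = B u" for u
  proof -
    have "C (A (B u)) = B u"
      using C by (metis blinfun_apply_blinfun_compose id_blinfun.rep_eq)
    then show ?thesis
      using assms(1) by (metis blinfun_apply_blinfun_compose id_blinfun.rep_eq)
  qed
  then show "C = B"
    by (simp add: blinfun_eqI)
qed (use assms in auto)

section \<open>Operators that are diagonal in a fixed orthonormal basis\<close>

context orthonormal_basis
begin

lemma inner_expansion: "u \<bullet> v = (\<Sum>e\<in>E. (u \<bullet> e) * (v \<bullet> e))"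
proof -
  have "u \<bullet> v = (\<Sum>e\<in>E. (u \<bullet> e) *\<^sub>R e) \<bullet> v"
    by (simp add: expansion)
  then show ?thesis
    by (simp add: inner_sum_left inner_commute[of v])
qed

lemma norm_sq_expansion: "(norm u)\<^sup>2 = (\<Sum>e\<in>E. (u \<bullet> e)\<^sup>2)"
  unfolding power2_norm_eq_inner inner_expansion[of u u] by (simp add: power2_eq_square)

lemma diag_op_apply: "diag_op E a u = (\<Sum>e\<in>E. (a e * (u \<bullet> e)) *\<^sub>R e)"
  by (simp add: diag_op_def blinfun.sum_left blinfun.scaleR_left tensor_sq_apply inner_commute)

lemma diag_op_inner: "e \<in> E \<Longrightarrow> diag_op E a u \<bullet> e = a e * (u \<bullet> e)"
proof -
  assume e: "e \<in> E"
  have "diag_op E a u \<bullet> e = (\<Sum>f\<in>E. if f = e then a e * (u \<bullet> e) else 0)"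
    unfolding diag_op_apply inner_sum_left using e orthonormal by (intro sum.cong) auto
  then show ?thesis
    using e fin by simp
qed

lemma eq_by_coordinates: "(\<And>e. e \<in> E \<Longrightarrow> u \<bullet> e = v \<bullet> e) \<Longrightarrow> u = v"
  by (metis (no_types, lifting) expansion sum.cong)

lemma blinfun_eq_diag_op:
  assumes "\<And>e. e \<in> E \<Longrightarrow> blinfun_apply A e = a e *\<^sub>R e"
  shows "A = diag_op E a"
proof (rule blinfun_eqI)
  fix u
  have "A u = (\<Sum>e\<in>E. A ((u \<bullet> e) *\<^sub>R e))"
    by (subst expansion[of u, symmetric]) (simp add: blinfun.sum_right)
  also have "\<dots> = diag_op E a u"
    unfolding diag_op_apply using assms
    by (intro sum.cong) (auto simp: blinfun.scaleR_right mult.commute)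
  finally show "A u = diag_op E a u" .
qed

lemma diag_op_basis: "e \<in> E \<Longrightarrow> diag_op E a e = a e *\<^sub>R e"
  by (rule eq_by_coordinates) (auto simp: diag_op_inner orthonormal)

lemma diag_op_compose: "diag_op E a o\<^sub>L diag_op E b = diag_op E (\<lambda>e. a e * b e)"
  by (rule blinfun_eq_diag_op) (simp add: diag_op_basis blinfun.scaleR_right mult.commute)

lemma diag_op_add_scaleR_id: "diag_op E a + c *\<^sub>R id_blinfun = diag_op E (\<lambda>e. a e + c)"
  by (rule blinfun_eq_diag_op)
     (simp add: diag_op_basis blinfun.add_left blinfun.scaleR_left scaleR_add_left)

lemma diag_op_cong: "(\<And>e. e \<in> E \<Longrightarrow> a e = b e) \<Longrightarrow> diag_op E a = diag_op E b"
  by (simp add: diag_op_def)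

lemma diag_op_one: "(\<And>e. e \<in> E \<Longrightarrow> a e = 1) \<Longrightarrow> diag_op E a = id_blinfun"
  by (rule blinfun_eq_diag_op[symmetric]) simp

lemma op_inv_diag_op:
  assumes "\<And>e. e \<in> E \<Longrightarrow> a e \<noteq> 0"
  shows "op_inv (diag_op E a) = diag_op E (\<lambda>e. 1 / a e)"
  using assms by (intro op_inv_unique) (auto simp: diag_op_compose intro!: diag_op_one)

lemma quadratic_form_diag_op: "diag_op E a u \<bullet> u = (\<Sum>e\<in>E. a e * (u \<bullet> e)\<^sup>2)"
  by (subst inner_expansion) (auto simp: diag_op_inner power2_eq_square intro!: sum.cong)

lemma pos_semidef_diag_op:
  assumes "\<And>e. e \<in> E \<Longrightarrow> a e \<ge> 0"
  shows "pos_semidef (diag_op E a)"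
  unfolding pos_semidef_def
proof (intro conjI allI)
  fix u v
  have "diag_op E a u \<bullet> v = (\<Sum>e\<in>E. a e * (u \<bullet> e) * (v \<bullet> e))"
    by (subst inner_expansion) (auto simp: diag_op_inner intro!: sum.cong)
  moreover have "u \<bullet> diag_op E a v = (\<Sum>e\<in>E. a e * (u \<bullet> e) * (v \<bullet> e))"
    by (subst inner_expansion) (auto simp: diag_op_inner intro!: sum.cong)
  ultimately show "diag_op E a u \<bullet> v = u \<bullet> diag_op E a v"
    by simp
  show "0 \<le> diag_op E a u \<bullet> u"
    unfolding quadratic_form_diag_op using assms by (intro sum_nonneg) auto
qed

text \<open>Uniqueness of the root: with \<open>s = sqrt (a e)\<close> one has
  \<open>(B + s I) (B - s I) e = 0\<close>, and \<open>B + s I\<close> is injective because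
  \<open>B\<close> is positive semi-definite and \<open>s > 0\<close>. So \<open>B e = s e\<close>,
  without knowing beforehand that \<open>B\<close> is diagonal in \<open>E\<close>.\<close>

lemma op_sqrt_diag_op:
  assumes a: "\<And>e. e \<in> E \<Longrightarrow> a e > 0"
  shows "op_sqrt (diag_op E a) = diag_op E (\<lambda>e. sqrt (a e))"
  unfolding op_sqrt_def
proof (rule the_equality)
  have "diag_op E (\<lambda>e. sqrt (a e)) o\<^sub>L diag_op E (\<lambda>e. sqrt (a e)) = diag_op E a"
    unfolding diag_op_compose using a by (intro diag_op_cong) (auto simp: less_imp_le)
  then show "pos_semidef (diag_op E (\<lambda>e. sqrt (a e))) \<and>
      diag_op E (\<lambda>e. sqrt (a e)) o\<^sub>L diag_op E (\<lambda>e. sqrt (a e)) = diag_op E a"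
    using a by (auto intro!: pos_semidef_diag_op simp: less_imp_le)
  fix B assume B: "pos_semidef B \<and> B o\<^sub>L B = diag_op E a"
  show "B = diag_op E (\<lambda>e. sqrt (a e))"
  proof (rule blinfun_eq_diag_op)
    fix e assume e: "e \<in> E"
    define s where "s = sqrt (a e)"
    have s: "s > 0" "s * s = a e"
      using a[OF e] by (auto simp: s_def)
    define f where "f = B e - s *\<^sub>R e"
    have "B (B e) = (s * s) *\<^sub>R e"
      using B s diag_op_basis[OF e] by (metis blinfun_apply_blinfun_compose)
    then have "B f = - s *\<^sub>R f"
      by (simp add: f_def blinfun.diff_right blinfun.scaleR_right scaleR_diff_right)
    moreover have "0 \<le> B f \<bullet> f"
      using B by (auto simp: pos_semidef_def)
    ultimately have "s * (f \<bullet> f) \<le> 0"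
      by simp
    then have "f = 0"
      using s(1) by (metis inner_eq_zero_iff inner_ge_zero mult_le_0_iff not_less order_antisym)
    then show "B e = sqrt (a e) *\<^sub>R e"
      by (simp add: f_def s_def)
  qed
qed

text \<open>\<open>op_trace\<close> sums over \<open>Basis\<close> and not over \<open>E\<close>;
  after exchanging the two sums, the inner one is the squared norm of a unit vector.\<close>

lemma op_trace_diag_op: "op_trace (diag_op E a) = sum a E"
proof -
  have "op_trace (diag_op E a) = (\<Sum>b\<in>Basis. \<Sum>e\<in>E. a e * (b \<bullet> e)\<^sup>2)"
    by (simp add: op_trace_def quadratic_form_diag_op)
  also have "\<dots> = (\<Sum>e\<in>E. a e * (\<Sum>b\<in>Basis. (e \<bullet> b) * (e \<bullet> b)))"
    by (subst sum.swap) (simp add: sum_distrib_left power2_eq_square inner_commute)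
  also have "\<dots> = sum a E"
    by (auto simp: euclidean_inner[symmetric] orthonormal intro!: sum.cong)
  finally show ?thesis .
qed

end

section \<open>Independent sequences and their past\<close>

text \<open>\<open>Z\<close> carries the common law of the \<open>D k\<close>; integrals over \<open>Z\<close> play the role of conditional
  expectations given the past.\<close>

locale iid_sequence = prob_space M for M :: "'w measure" +
  fixes D :: "nat \<Rightarrow> 'w \<Rightarrow> 'd::second_countable_topology" and Z :: "'w \<Rightarrow> 'd"
  assumes measurable_Z [measurable]: "Z \<in> borel_measurable M"
    and indep: "indep_vars (\<lambda>_. borel) D {1..}"
    and ident: "\<And>k. k \<ge> 1 \<Longrightarrow> distr M borel (D k) = distr M borel Z"
begin

text \<open>The sigma-algebra generated by the first \<open>k\<close> observations. It is pulled
  back along the whole tuple, so that independence of disjoint index blocks applies to it directly;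
  for \<open>k = 0\<close> it is trivial.\<close>

definition past :: "nat \<Rightarrow> 'w measure" where
  "past k = vimage_algebra (space M) (\<lambda>\<omega>. restrict (\<lambda>i. D i \<omega>) {1..k}) (PiM {1..k} (\<lambda>_. borel))"

lemma measurable_D: "k \<ge> 1 \<Longrightarrow> D k \<in> borel_measurable M"
  using indep by (auto simp: indep_vars_def)

lemma space_past [simp]: "space (past k) = space M"
  by (simp add: past_def)

lemma restrict_D_past: "(\<lambda>\<omega>. restrict (\<lambda>i. D i \<omega>) {1..k}) \<in> measurable (past k) (PiM {1..k} (\<lambda>_. borel))"
  unfolding past_def by (rule measurable_vimage_algebra1) (auto simp: space_PiM)

lemma measurable_D_past: "1 \<le> i \<Longrightarrow> i \<le> k \<Longrightarrow> D i \<in> borel_measurable (past k)"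
proof -
  assume i: "1 \<le> i" "i \<le> k"
  then have "(\<lambda>f. f i) \<in> measurable (PiM {1..k} (\<lambda>_. borel)) borel"
    by (intro measurable_component_singleton) auto
  from measurable_compose[OF restrict_D_past this] show ?thesis
    using i by simp
qed

lemma measurable_past_mono:
  assumes "f \<in> measurable (past j) N" "j \<le> k"
  shows "f \<in> measurable (past k) N"
proof -
  have "(\<lambda>\<omega>. \<omega>) \<in> measurable (past k) (past j)"
    unfolding past_def[of j]
    using assms(2) by (intro measurable_vimage_algebra2 measurable_restrict measurable_D_past) auto
  from measurable_compose[OF this assms(1)] show ?thesis .
qed

lemma measurable_past_imp:
  assumes "f \<in> measurable (past k) N"
  shows "f \<in> measurable M N"
proof -
  have "(\<lambda>\<omega>. \<omega>) \<in> measurable M (past k)"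
    unfolding past_def
    by (intro measurable_vimage_algebra2 measurable_restrict measurable_D) auto
  from measurable_compose[OF this assms] show ?thesis .
qed

lemma indep_set_mono:
  "A \<subseteq> A' \<Longrightarrow> B \<subseteq> B' \<Longrightarrow> indep_set A' B' \<Longrightarrow> indep_set A B"
  unfolding indep_sets2_eq by (meson subsetD subset_trans)

text \<open>The index blocks \<open>{1..k}\<close> and \<open>{Suc k}\<close> are disjoint, hence
  independent; the first one generates exactly \<open>past k\<close>, and events of
  \<open>D (Suc k)\<close> are cylinders over the second.\<close>

lemma indep_set_past:
  assumes f: "f \<in> measurable (past k) N"
  shows "indep_set {f -` A \<inter> space M | A. A \<in> sets N} {D (Suc k) -` A \<inter> space M | A. A \<in> sets borel}"
proof -
  let ?r = "\<lambda>A \<omega>. restrict (\<lambda>i. D i \<omega>) A"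
  have "indep_var (PiM {1..k} (\<lambda>_. borel)) (?r {1..k}) (PiM {Suc k} (\<lambda>_. borel)) (?r {Suc k})"
    by (rule indep_var_restrict[OF indep]) auto
  then have "indep_set (sigma_sets (space M) {?r {1..k} -` A \<inter> space M | A. A \<in> sets (PiM {1..k} (\<lambda>_. borel))})
     (sigma_sets (space M) {?r {Suc k} -` A \<inter> space M | A. A \<in> sets (PiM {Suc k} (\<lambda>_. borel))})"
    (is "indep_set ?P ?Q")
    unfolding indep_var_eq by blast
  moreover have "{f -` A \<inter> space M | A. A \<in> sets N} \<subseteq> ?P"
  proof -
    have "?P = sets (past k)"
      unfolding past_def sets_vimage_algebra ..
    then show ?thesis
      using measurable_sets[OF f] by (auto simp del: One_nat_def)
  qed
  moreover have "{D (Suc k) -` A \<inter> space M | A. A \<in> sets borel} \<subseteq> ?Q"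
  proof safe
    fix A :: "'d set" assume A: "A \<in> sets borel"
    let ?A = "(\<lambda>g. g (Suc k)) -` A \<inter> space (PiM {Suc k} (\<lambda>_. borel))"
    have "?A \<in> sets (PiM {Suc k} (\<lambda>_. borel))"
      using A by (intro measurable_sets[where A = borel] measurable_component_singleton) auto
    moreover have "D (Suc k) -` A \<inter> space M = ?r {Suc k} -` ?A \<inter> space M"
      by (auto simp: space_PiM)
    ultimately show "D (Suc k) -` A \<inter> space M \<in> ?Q"
      by (intro sigma_sets.Basic) blast
  qed
  ultimately show ?thesis
    using indep_set_mono by blast
qed

text \<open>Independence makes the joint law a product and \<open>ident\<close> turns its second
  factor into the law of \<open>Z\<close>. Nothing but that law enters, so \<open>Z\<close> may
  itself depend on the sequence.\<close>

lemma distr_past_pair: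
  assumes f: "f \<in> measurable (past k) N"
  shows "distr M N f \<Otimes>\<^sub>M distr M borel Z = distr M (N \<Otimes>\<^sub>M borel) (\<lambda>\<omega>. (f \<omega>, D (Suc k) \<omega>))"
proof -
  have fm [measurable]: "f \<in> measurable M N" "D (Suc k) \<in> borel_measurable M"
    using measurable_past_imp[OF f] by (auto intro: measurable_D)
  let ?F = "distr M N f" and ?G = "distr M borel (D (Suc k))"
  interpret F: prob_space ?F by (rule prob_space_distr) simp
  interpret G: prob_space ?G by (rule prob_space_distr) simp
  have "?F \<Otimes>\<^sub>M ?G = distr M (N \<Otimes>\<^sub>M borel) (\<lambda>\<omega>. (f \<omega>, D (Suc k) \<omega>))"
  proof (rule pair_measure_eqI)
    show "sigma_finite_measure ?F" "sigma_finite_measure ?G" ..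
    show "sets (?F \<Otimes>\<^sub>M ?G) = sets (distr M (N \<Otimes>\<^sub>M borel) (\<lambda>\<omega>. (f \<omega>, D (Suc k) \<omega>)))"
      by simp
    fix A B assume "A \<in> sets ?F" "B \<in> sets ?G"
    then have AB [measurable]: "A \<in> sets N" "B \<in> sets borel"
      by simp_all
    have "prob ((f -` A \<inter> space M) \<inter> (D (Suc k) -` B \<inter> space M))
        = prob (f -` A \<inter> space M) * prob (D (Suc k) -` B \<inter> space M)"
      using indep_set_past[OF f] AB unfolding indep_sets2_eq by blast
    moreover have "(f -` A \<inter> space M) \<inter> (D (Suc k) -` B \<inter> space M)
        = (\<lambda>\<omega>. (f \<omega>, D (Suc k) \<omega>)) -` (A \<times> B) \<inter> space M"
      by auto
    ultimately show "emeasure ?F A * emeasure ?G B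
        = emeasure (distr M (N \<Otimes>\<^sub>M borel) (\<lambda>\<omega>. (f \<omega>, D (Suc k) \<omega>))) (A \<times> B)"
      by (simp add: emeasure_distr emeasure_eq_measure ennreal_mult')
  qed
  then show ?thesis
    using ident[of "Suc k"] by simp
qed

lemma integrable_D:
  fixes g :: "'d \<Rightarrow> 'b::{banach, second_countable_topology}"
  assumes "k \<ge> 1" "g \<in> borel_measurable borel"
  shows "integrable M (\<lambda>\<omega>. g (D k \<omega>)) \<longleftrightarrow> integrable M (\<lambda>\<omega>. g (Z \<omega>))"
  using integrable_distr_eq[OF measurable_D[OF assms(1)] assms(2)]
    integrable_distr_eq[OF measurable_Z assms(2)] ident[OF assms(1)] by simp

lemma integral_D:
  fixes g :: "'d \<Rightarrow> 'b::{banach, second_countable_topology}"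
  assumes "k \<ge> 1" "g \<in> borel_measurable borel"
  shows "(\<integral>\<omega>. g (D k \<omega>) \<partial>M) = (\<integral>\<omega>. g (Z \<omega>) \<partial>M)"
  using integral_distr[OF measurable_D[OF assms(1)] assms(2)]
    integral_distr[OF measurable_Z assms(2)] ident[OF assms(1)] by simp

text \<open>The Fubini statements below take joint integrability as a hypothesis; this is where it
  comes from. A product of independent integrable functions is integrable, without any higher
  moments.\<close>

lemma integrable_past_mult:
  fixes f :: "'w \<Rightarrow> real" and g :: "'d \<Rightarrow> real"
  assumes f: "f \<in> borel_measurable (past k)" "integrable M f"
    and g: "g \<in> borel_measurable borel" "integrable M (\<lambda>\<omega>. g (Z \<omega>))"
  shows "integrable M (\<lambda>\<omega>. f \<omega> * g (D (Suc k) \<omega>))"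
proof -
  \<comment> \<open>\<open>indep_var\<close> speaks about generated sigma-algebras, and independence
    passes from the preimage families to these only if the families are closed under
    intersection.\<close>
  have stable: "Int_stable {h -` A \<inter> space M | A. A \<in> sets borel}" for h :: "'w \<Rightarrow> real"
  proof (safe intro!: Int_stableI)
    fix A B :: "real set" assume "A \<in> sets borel" "B \<in> sets borel"
    then show "\<exists>C. h -` A \<inter> space M \<inter> (h -` B \<inter> space M) = h -` C \<inter> space M \<and> C \<in> sets borel"
      by (intro exI[of _ "A \<inter> B"]) auto
  qed
  have sub: "{(\<lambda>\<omega>. g (D (Suc k) \<omega>)) -` A \<inter> space M | A. A \<in> sets borel}
      \<subseteq> {D (Suc k) -` A \<inter> space M | A. A \<in> sets borel}"
  proof safe
    fix A :: "real set" assume "A \<in> sets borel"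
    then have "g -` A \<in> sets borel"
      using measurable_sets[OF g(1)] by simp
    then show "\<exists>B. (\<lambda>\<omega>. g (D (Suc k) \<omega>)) -` A \<inter> space M = D (Suc k) -` B \<inter> space M \<and> B \<in> sets borel"
      by (intro exI[of _ "g -` A"]) auto
  qed
  have "indep_set {f -` A \<inter> space M | A. A \<in> sets borel}
      {(\<lambda>\<omega>. g (D (Suc k) \<omega>)) -` A \<inter> space M | A. A \<in> sets borel}"
    using indep_set_mono[OF order_refl sub indep_set_past[OF f(1)]] .
  then have "indep_var borel f borel (\<lambda>\<omega>. g (D (Suc k) \<omega>))"
    unfolding indep_var_eq
    using measurable_past_imp[OF f(1)] measurable_compose[OF measurable_D g(1), of "Suc k"]
    by (intro conjI indep_set_sigma_sets stable) simp_all
  then show ?thesis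
    using f(2) g(2) integrable_D[OF _ g(1), of "Suc k"] by (intro indep_var_integrable) auto
qed

text \<open>Fubini in both orders. The \<open>fst\<close> versions average the new observation for a
  given past, that is, they condition on the past. The \<open>snd\<close> versions freeze the new
  observation and average the past, so that a second-moment bound valid for all test vectors can be
  used with a test vector depending on that observation.\<close>

lemma
  fixes f :: "'w \<Rightarrow> 'b" and h :: "'b \<Rightarrow> 'd \<Rightarrow> real"
  assumes f: "f \<in> measurable (past k) N"
    and h: "(\<lambda>(u, d). h u d) \<in> borel_measurable (N \<Otimes>\<^sub>M borel)"
    and int: "integrable M (\<lambda>\<omega>. h (f \<omega>) (D (Suc k) \<omega>))"
  shows integral_past_fst: "(\<integral>\<omega>. h (f \<omega>) (D (Suc k) \<omega>) \<partial>M) = (\<integral>\<omega>. (\<integral>\<omega>'. h (f \<omega>) (Z \<omega>') \<partial>M) \<partial>M)"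
    and integrable_past_fst: "integrable M (\<lambda>\<omega>. \<integral>\<omega>'. h (f \<omega>) (Z \<omega>') \<partial>M)"
    and integral_past_snd: "(\<integral>\<omega>. h (f \<omega>) (D (Suc k) \<omega>) \<partial>M) = (\<integral>\<omega>'. (\<integral>\<omega>. h (f \<omega>) (Z \<omega>') \<partial>M) \<partial>M)"
    and integrable_past_snd: "integrable M (\<lambda>\<omega>'. \<integral>\<omega>. h (f \<omega>) (Z \<omega>') \<partial>M)"
proof -
  have fm [measurable]: "f \<in> measurable M N" "D (Suc k) \<in> borel_measurable M"
    by (rule measurable_past_imp[OF f], rule measurable_D, simp)
  note h [measurable]
  let ?F = "distr M N f" and ?G = "distr M borel Z"
  interpret F: prob_space ?F by (rule prob_space_distr) simp
  interpret G: prob_space ?G by (rule prob_space_distr) simp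
  interpret FG: pair_prob_space ?F ?G ..
  have eq: "?F \<Otimes>\<^sub>M ?G = distr M (N \<Otimes>\<^sub>M borel) (\<lambda>\<omega>. (f \<omega>, D (Suc k) \<omega>))"
    by (rule distr_past_pair[OF f])
  have I: "integrable (?F \<Otimes>\<^sub>M ?G) (\<lambda>(u, d). h u d)"
    unfolding eq using int by (subst integrable_distr_eq) auto
  have E: "(\<integral>\<omega>. h (f \<omega>) (D (Suc k) \<omega>) \<partial>M) = integral\<^sup>L (?F \<Otimes>\<^sub>M ?G) (\<lambda>(u, d). h u d)"
    unfolding eq by (subst integral_distr) auto
  have i1: "(\<integral>d. h u d \<partial>?G) = (\<integral>\<omega>'. h u (Z \<omega>') \<partial>M)"
    if "u \<in> space N" for u
    using that by (intro integral_distr) simp_all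
  have i2: "(\<integral>u. h u d \<partial>?F) = (\<integral>\<omega>. h (f \<omega>) d \<partial>M)" for d
    by (rule integral_distr) simp_all
  have c1: "(\<integral>u. (\<integral>d. h u d \<partial>?G) \<partial>?F) = (\<integral>u. (\<integral>\<omega>'. h u (Z \<omega>') \<partial>M) \<partial>?F)"
    by (rule Bochner_Integration.integral_cong) (simp_all add: i1)
  have c2: "integrable ?F (\<lambda>u. \<integral>d. h u d \<partial>?G) \<longleftrightarrow> integrable ?F (\<lambda>u. \<integral>\<omega>'. h u (Z \<omega>') \<partial>M)"
    by (rule Bochner_Integration.integrable_cong) (simp_all add: i1)
  have m1: "(\<lambda>u. \<integral>\<omega>'. h u (Z \<omega>') \<partial>M) \<in> borel_measurable N"
    by measurable
  have m2: "(\<lambda>d. \<integral>\<omega>. h (f \<omega>) d \<partial>M) \<in> borel_measurable borel"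
    by measurable
  show "(\<integral>\<omega>. h (f \<omega>) (D (Suc k) \<omega>) \<partial>M) = (\<integral>\<omega>. (\<integral>\<omega>'. h (f \<omega>) (Z \<omega>') \<partial>M) \<partial>M)"
    unfolding E using FG.integral_fst'[OF I] c1 integral_distr[OF fm(1) m1] by simp
  show "integrable M (\<lambda>\<omega>. \<integral>\<omega>'. h (f \<omega>) (Z \<omega>') \<partial>M)"
    using FG.integrable_fst'[OF I] c2 integrable_distr_eq[OF fm(1) m1] by simp
  show "(\<integral>\<omega>. h (f \<omega>) (D (Suc k) \<omega>) \<partial>M) = (\<integral>\<omega>'. (\<integral>\<omega>. h (f \<omega>) (Z \<omega>') \<partial>M) \<partial>M)"
    unfolding E using FG.integral_snd[of "\<lambda>u d. h u d"] I i2 integral_distr[OF measurable_Z m2] by simp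
  show "integrable M (\<lambda>\<omega>'. \<integral>\<omega>. h (f \<omega>) (Z \<omega>') \<partial>M)"
    using FG.integrable_snd[of "\<lambda>u d. h u d"] I i2 integrable_distr_eq[OF measurable_Z m2] by simp
qed

end

section \<open>Linear recursions with multiplicative noise\<close>

lemma (in prob_space) square_integrable_imp_integrable_norm:
  fixes f :: "'a \<Rightarrow> 'b::{banach, second_countable_topology}"
  assumes "f \<in> borel_measurable M" "integrable M (\<lambda>\<omega>. (norm (f \<omega>))\<^sup>2)"
  shows "integrable M (\<lambda>\<omega>. norm (f \<omega>))"
proof (rule Bochner_Integration.integrable_bound[where f = "\<lambda>\<omega>. 1 + (norm (f \<omega>))\<^sup>2"])
  have "norm (f \<omega>) \<le> 1 + (norm (f \<omega>))\<^sup>2" for \<omega>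
  proof -
    have "2 * norm (f \<omega>) \<le> 1 + (norm (f \<omega>))\<^sup>2"
      using zero_le_power2[of "norm (f \<omega>) - 1"] by (simp add: power2_diff)
    then show ?thesis
      using norm_ge_zero[of "f \<omega>"] by linarith
  qed
  then show "AE \<omega> in M. norm (norm (f \<omega>)) \<le> norm (1 + (norm (f \<omega>))\<^sup>2)"
    by (auto simp: add_nonneg_nonneg)
qed (use assms in auto)

text \<open>The regression problem in eigencoordinates. Outputs occur only through the residual
  \<epsilon>, and the Loewner inequalities only through their quadratic forms.
  \<open>gamma_R\<close> restates the step-size condition; \<open>gamma_lam\<close> follows from it
  and \<open>lam \<le> R\<^sup>2 / 2\<close>.\<close>

locale least_squares_sgd = iid_sequence M D Z + orthonormal_basis E
  for M :: "'w measure" and D :: "nat \<Rightarrow> 'w \<Rightarrow> 'd::second_countable_topology" and Z :: "'w \<Rightarrow> 'd"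
    and E :: "'a::euclidean_space set" +
  fixes X :: "'d \<Rightarrow> 'a" and \<epsilon> :: "'d \<Rightarrow> real" and \<mu> :: "'a \<Rightarrow> real" and \<Sigma> :: "'a \<Rightarrow>\<^sub>L 'a"
    and R \<sigma> lam \<gamma> :: real
  assumes measurable_X [measurable]: "X \<in> borel_measurable borel"
    and measurable_eps [measurable]: "\<epsilon> \<in> borel_measurable borel"
    and Sigma_diag: "\<Sigma> = diag_op E \<mu>"
    and mu_pos: "\<And>e. e \<in> E \<Longrightarrow> \<mu> e > 0"
    and int_norm_X4: "integrable M (\<lambda>\<omega>. (norm (X (Z \<omega>)))^4)"
    and int_eps_X_sq: "integrable M (\<lambda>\<omega>. (\<epsilon> (Z \<omega>))\<^sup>2 * (norm (X (Z \<omega>)))\<^sup>2)"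
    and covariance: "\<And>u v. (\<integral>\<omega>. (X (Z \<omega>) \<bullet> u) * (X (Z \<omega>) \<bullet> v) \<partial>M) = \<Sigma> u \<bullet> v"
    and eps_uncorrelated: "\<And>v. (\<integral>\<omega>. \<epsilon> (Z \<omega>) * (X (Z \<omega>) \<bullet> v) \<partial>M) = 0"
    and fourth_moment: "\<And>v. (\<integral>\<omega>. (norm (X (Z \<omega>)))\<^sup>2 * (X (Z \<omega>) \<bullet> v)\<^sup>2 \<partial>M) \<le> R\<^sup>2 * (\<Sigma> v \<bullet> v)"
    and eps_moment: "\<And>v. (\<integral>\<omega>. (\<epsilon> (Z \<omega>))\<^sup>2 * (X (Z \<omega>) \<bullet> v)\<^sup>2 \<partial>M) \<le> \<sigma>\<^sup>2 * (\<Sigma> v \<bullet> v)"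
    and lam_nonneg: "lam \<ge> 0"
    and gamma_pos: "\<gamma> > 0"
    and gamma_R: "\<gamma> * R\<^sup>2 \<le> 1 / 2"
    and gamma_lam: "\<gamma> * lam \<le> 1 / 4"
begin

lemma Sigma_nonneg: "0 \<le> \<Sigma> v \<bullet> v"
  unfolding Sigma_diag quadratic_form_diag_op
  using mu_pos by (intro sum_nonneg) (auto simp: less_imp_le)

section \<open>Moments of one observation and the mean-square contraction\<close>

lemma integrable_dominated:
  fixes f :: "'w \<Rightarrow> real"
  assumes "integrable M g" "f \<in> borel_measurable M" "\<And>\<omega>. \<bar>f \<omega>\<bar> \<le> g \<omega>"
  shows "integrable M f"
  using assms(1,2)
proof (rule Bochner_Integration.integrable_bound)
  show "AE \<omega> in M. norm (f \<omega>) \<le> norm (g \<omega>)"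
    using assms(3) by (intro AE_I2) (metis abs_ge_self order_trans real_norm_def)
qed

lemma int_norm_X2: "integrable M (\<lambda>\<omega>. (norm (X (Z \<omega>)))\<^sup>2)"
  using square_integrable_imp_integrable_norm[of "\<lambda>\<omega>. (norm (X (Z \<omega>)))\<^sup>2"] int_norm_X4
  by (simp flip: power_mult)

lemma int_X_X: "integrable M (\<lambda>\<omega>. (X (Z \<omega>) \<bullet> u) * (X (Z \<omega>) \<bullet> v))"
proof (rule integrable_dominated)
  show "integrable M (\<lambda>\<omega>. (norm (X (Z \<omega>)))\<^sup>2 * (norm u * norm v))"
    using int_norm_X2 by (rule integrable_mult_left)
  show "\<bar>(X (Z \<omega>) \<bullet> u) * (X (Z \<omega>) \<bullet> v)\<bar> \<le> (norm (X (Z \<omega>)))\<^sup>2 * (norm u * norm v)" for \<omega>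
    using mult_mono[OF Cauchy_Schwarz_ineq2[of "X (Z \<omega>)" u] Cauchy_Schwarz_ineq2[of "X (Z \<omega>)" v]]
    by (simp add: abs_mult power2_eq_square mult_ac)
qed measurable

lemma int_X2_X2: "integrable M (\<lambda>\<omega>. (norm (X (Z \<omega>)))\<^sup>2 * (X (Z \<omega>) \<bullet> v)\<^sup>2)"
proof (rule integrable_dominated)
  show "integrable M (\<lambda>\<omega>. (norm (X (Z \<omega>)))^4 * (norm v)\<^sup>2)"
    using int_norm_X4 by (rule integrable_mult_left)
  show "\<bar>(norm (X (Z \<omega>)))\<^sup>2 * (X (Z \<omega>) \<bullet> v)\<^sup>2\<bar> \<le> (norm (X (Z \<omega>)))^4 * (norm v)\<^sup>2" for \<omega>
  proof -
    have "(X (Z \<omega>) \<bullet> v)\<^sup>2 \<le> (norm (X (Z \<omega>)))\<^sup>2 * (norm v)\<^sup>2"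
      using Cauchy_Schwarz_ineq[of "X (Z \<omega>)" v] by (simp add: power2_norm_eq_inner)
    from mult_left_mono[OF this, of "(norm (X (Z \<omega>)))\<^sup>2"] show ?thesis
      by (simp add: mult_ac power2_eq_square power4_eq_xxxx abs_mult)
  qed
qed measurable

lemma int_eps_X: "integrable M (\<lambda>\<omega>. \<epsilon> (Z \<omega>) * (X (Z \<omega>) \<bullet> v))"
proof (rule integrable_dominated)
  have "integrable M (\<lambda>\<omega>. norm (\<epsilon> (Z \<omega>) *\<^sub>R X (Z \<omega>)))"
    using int_eps_X_sq by (intro square_integrable_imp_integrable_norm) (auto simp: power_mult_distrib)
  then show "integrable M (\<lambda>\<omega>. norm (\<epsilon> (Z \<omega>) *\<^sub>R X (Z \<omega>)) * norm v)"
    by (rule integrable_mult_left)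
  show "\<bar>\<epsilon> (Z \<omega>) * (X (Z \<omega>) \<bullet> v)\<bar> \<le> norm (\<epsilon> (Z \<omega>) *\<^sub>R X (Z \<omega>)) * norm v" for \<omega>
    using Cauchy_Schwarz_ineq2[of "\<epsilon> (Z \<omega>) *\<^sub>R X (Z \<omega>)" v] by simp
qed measurable

lemma int_eps2_X2: "integrable M (\<lambda>\<omega>. (\<epsilon> (Z \<omega>))\<^sup>2 * (X (Z \<omega>) \<bullet> v)\<^sup>2)"
proof (rule integrable_dominated)
  show "integrable M (\<lambda>\<omega>. (\<epsilon> (Z \<omega>))\<^sup>2 * (norm (X (Z \<omega>)))\<^sup>2 * (norm v)\<^sup>2)"
    using int_eps_X_sq by (rule integrable_mult_left)
  show "\<bar>(\<epsilon> (Z \<omega>))\<^sup>2 * (X (Z \<omega>) \<bullet> v)\<^sup>2\<bar> \<le> (\<epsilon> (Z \<omega>))\<^sup>2 * (norm (X (Z \<omega>)))\<^sup>2 * (norm v)\<^sup>2" for \<omega>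
  proof -
    have "(X (Z \<omega>) \<bullet> v)\<^sup>2 \<le> (norm (X (Z \<omega>)))\<^sup>2 * (norm v)\<^sup>2"
      using Cauchy_Schwarz_ineq[of "X (Z \<omega>)" v] by (simp add: power2_norm_eq_inner)
    from mult_left_mono[OF this, of "(\<epsilon> (Z \<omega>))\<^sup>2"] show ?thesis
      by (simp add: mult_ac abs_mult)
  qed
qed measurable

text \<open>The random matrix of one step, kept as a function of observation and vector together
  because joint measurability is needed. It contracts only in mean square; for a fixed observation
  with large \<open>X d\<close> it may expand.\<close>

definition contraction :: "'d \<Rightarrow> 'a \<Rightarrow> 'a" where
  "contraction d v = v - (\<gamma> * (X d \<bullet> v)) *\<^sub>R X d - (\<gamma> * lam) *\<^sub>R v"

lemma measurable_contraction [measurable]: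
  assumes "f \<in> borel_measurable N" "g \<in> borel_measurable N"
  shows "(\<lambda>z. contraction (f z) (g z)) \<in> borel_measurable N"
  unfolding contraction_def using assms by measurable

text \<open>This moves the random matrix from the process to the test vector, which turns statements
  about the covariance of the process into inductions over arbitrary test vectors.\<close>

lemma contraction_selfadjoint: "contraction d u \<bullet> v = u \<bullet> contraction d v"
  by (simp add: contraction_def inner_diff_left inner_diff_right inner_commute)

text \<open>A crude pathwise growth bound that serves integrability alone.\<close>

lemma norm_contraction_le: "norm (contraction d v) \<le> (1 + \<gamma> * lam + \<gamma> * (norm (X d))\<^sup>2) * norm v"
proof -
  have "norm (contraction d v) \<le> norm v + norm ((\<gamma> * (X d \<bullet> v)) *\<^sub>R X d) + norm ((\<gamma> * lam) *\<^sub>R v)"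
    unfolding contraction_def by (intro order_trans[OF norm_triangle_ineq4] add_mono order_refl)
  also have "norm ((\<gamma> * (X d \<bullet> v)) *\<^sub>R X d) \<le> \<gamma> * (norm (X d))\<^sup>2 * norm v"
    using mult_right_mono[OF Cauchy_Schwarz_ineq2[of "X d" v], of "\<gamma> * norm (X d)"] gamma_pos
    by (simp add: abs_mult power2_eq_square mult_ac)
  finally show ?thesis
    using gamma_pos lam_nonneg by (simp add: algebra_simps)
qed

lemma norm_contraction_sq:
  "(norm (contraction d v))\<^sup>2 = (1 - \<gamma> * lam)\<^sup>2 * (norm v)\<^sup>2
     - 2 * (1 - \<gamma> * lam) * \<gamma> * ((X d \<bullet> v) * (X d \<bullet> v)) + \<gamma>\<^sup>2 * ((norm (X d))\<^sup>2 * (X d \<bullet> v)\<^sup>2)"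
proof -
  have *: "contraction d v = (1 - \<gamma> * lam) *\<^sub>R v - (\<gamma> * (X d \<bullet> v)) *\<^sub>R X d"
    by (simp add: contraction_def algebra_simps)
  show ?thesis
    unfolding * power2_norm_eq_inner inner_diff_left inner_diff_right
    by (simp add: inner_commute power2_eq_square algebra_simps)
qed

text \<open>Both step-size conditions meet here. Write \<open>s = \<Sigma> v \<bullet> v\<close>. By
  \<open>gamma_lam\<close> the cross term removes at least \<open>(3/2) \<gamma> s\<close>; by
  \<open>fourth_moment\<close> and \<open>gamma_R\<close> the quadratic term returns at most
  \<open>(1/2) \<gamma> s\<close>. What is left is a decrease by \<open>\<gamma> s\<close>.\<close>

lemma
  shows int_norm_contraction: "integrable M (\<lambda>\<omega>. (norm (contraction (Z \<omega>) v))\<^sup>2)"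
    and norm_contraction: "(\<integral>\<omega>. (norm (contraction (Z \<omega>) v))\<^sup>2 \<partial>M)
      \<le> (norm v)\<^sup>2 - \<gamma> * (\<Sigma> v \<bullet> v + lam * (norm v)\<^sup>2)"
proof -
  note [simp] = int_X_X int_X2_X2
  show "integrable M (\<lambda>\<omega>. (norm (contraction (Z \<omega>) v))\<^sup>2)"
    unfolding norm_contraction_sq by simp
  let ?s = "\<Sigma> v \<bullet> v"
  have "(\<integral>\<omega>. (norm (contraction (Z \<omega>) v))\<^sup>2 \<partial>M) = (1 - \<gamma> * lam)\<^sup>2 * (norm v)\<^sup>2
     - 2 * (1 - \<gamma> * lam) * \<gamma> * ?s + \<gamma>\<^sup>2 * (\<integral>\<omega>. (norm (X (Z \<omega>)))\<^sup>2 * (X (Z \<omega>) \<bullet> v)\<^sup>2 \<partial>M)"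
    unfolding norm_contraction_sq by (simp add: covariance prob_space)
  also have "\<dots> \<le> (1 - \<gamma> * lam)\<^sup>2 * (norm v)\<^sup>2 - 2 * (1 - \<gamma> * lam) * \<gamma> * ?s + \<gamma>\<^sup>2 * (R\<^sup>2 * ?s)"
    using fourth_moment by (intro add_left_mono mult_left_mono) auto
  also have "\<dots> \<le> (1 - \<gamma> * lam) * (norm v)\<^sup>2 - 2 * (3 / 4) * (\<gamma> * ?s) + (1 / 2) * (\<gamma> * ?s)"
  proof -
    have s: "0 \<le> \<gamma> * ?s"
      using gamma_pos Sigma_nonneg by simp
    have gl: "0 \<le> \<gamma> * lam"
      using gamma_pos lam_nonneg by simp
    have "(1 - \<gamma> * lam)\<^sup>2 \<le> 1 - \<gamma> * lam"
      unfolding power2_eq_square using gl gamma_lam mult_left_mono[of "1 - \<gamma> * lam" 1 "1 - \<gamma> * lam"] by simp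
    then have "(1 - \<gamma> * lam)\<^sup>2 * (norm v)\<^sup>2 \<le> (1 - \<gamma> * lam) * (norm v)\<^sup>2"
      by (rule mult_right_mono) simp
    moreover have "(3 / 4) * (\<gamma> * ?s) \<le> (1 - \<gamma> * lam) * (\<gamma> * ?s)"
      using s gamma_lam by (intro mult_right_mono) auto
    moreover have "\<gamma> * R\<^sup>2 * (\<gamma> * ?s) \<le> (1 / 2) * (\<gamma> * ?s)"
      using s gamma_R by (intro mult_right_mono) auto
    moreover have "2 * (1 - \<gamma> * lam) * \<gamma> * ?s = 2 * ((1 - \<gamma> * lam) * (\<gamma> * ?s))"
      and "\<gamma>\<^sup>2 * (R\<^sup>2 * ?s) = \<gamma> * R\<^sup>2 * (\<gamma> * ?s)"
      by (simp_all add: power2_eq_square)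
    ultimately show ?thesis
      by linarith
  qed
  also have "\<dots> = (norm v)\<^sup>2 - \<gamma> * (?s + lam * (norm v)\<^sup>2)"
    by (simp add: algebra_simps)
  finally show "(\<integral>\<omega>. (norm (contraction (Z \<omega>) v))\<^sup>2 \<partial>M) \<le> (norm v)\<^sup>2 - \<gamma> * (?s + lam * (norm v)\<^sup>2)" .
qed

section \<open>Square-integrability of the affine recursion\<close>

definition square_integrable_past :: "nat \<Rightarrow> ('w \<Rightarrow> 'a) \<Rightarrow> bool" where
  "square_integrable_past k p \<longleftrightarrow> p \<in> borel_measurable (past k) \<and> integrable M (\<lambda>\<omega>. (norm (p \<omega>))\<^sup>2)"

lemma
  assumes "square_integrable_past k p"
  shows square_integrable_past_adapted: "p \<in> borel_measurable (past k)"
    and square_integrable_past_measurable: "p \<in> borel_measurable M"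
    and square_integrable_past_norm_sq: "integrable M (\<lambda>\<omega>. (norm (p \<omega>))\<^sup>2)"
    and square_integrable_past_inner: "integrable M (\<lambda>\<omega>. p \<omega> \<bullet> v)"
    and square_integrable_past_inner_sq: "integrable M (\<lambda>\<omega>. (p \<omega> \<bullet> v)\<^sup>2)"
proof -
  show 1: "p \<in> borel_measurable (past k)" and 2: "integrable M (\<lambda>\<omega>. (norm (p \<omega>))\<^sup>2)"
    using assms by (auto simp: square_integrable_past_def)
  show 3 [measurable]: "p \<in> borel_measurable M"
    using measurable_past_imp[OF 1] .
  show "integrable M (\<lambda>\<omega>. p \<omega> \<bullet> v)"
  proof (rule integrable_dominated)
    show "integrable M (\<lambda>\<omega>. norm (p \<omega>) * norm v)"
      using square_integrable_imp_integrable_norm[OF 3 2] by (rule integrable_mult_left)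
  qed (auto simp: Cauchy_Schwarz_ineq2)
  show "integrable M (\<lambda>\<omega>. (p \<omega> \<bullet> v)\<^sup>2)"
  proof (rule integrable_dominated)
    show "integrable M (\<lambda>\<omega>. (norm (p \<omega>))\<^sup>2 * (norm v)\<^sup>2)"
      using 2 by (rule integrable_mult_left)
    show "\<bar>(p \<omega> \<bullet> v)\<^sup>2\<bar> \<le> (norm (p \<omega>))\<^sup>2 * (norm v)\<^sup>2" for \<omega>
      using Cauchy_Schwarz_ineq[of "p \<omega>" v] by (simp add: power2_norm_eq_inner)
  qed measurable
qed

text \<open>The dominating function is a product of a factor known from the past and a factor of the
  new observation, so independence reduces integrability to the two factors. The summand 1 covers
  terms that do not grow with \<open>u\<close>.\<close>

lemma integrable_past_next:
  assumes p: "square_integrable_past k p"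
    and h: "(\<lambda>(u, d). h u d) \<in> borel_measurable (borel \<Otimes>\<^sub>M borel)"
    and G: "G \<in> borel_measurable borel" "integrable M (\<lambda>\<omega>. G (Z \<omega>))"
    and bound: "\<And>u d. \<bar>h u d\<bar> \<le> (1 + (norm u)\<^sup>2) * G d"
  shows "integrable M (\<lambda>\<omega>. h (p \<omega>) (D (Suc k) \<omega>))"
proof (rule integrable_dominated)
  have [measurable]: "p \<in> borel_measurable (past k)" "p \<in> borel_measurable M" "D (Suc k) \<in> borel_measurable M"
    using square_integrable_past_adapted[OF p] square_integrable_past_measurable[OF p] measurable_D[of "Suc k"] by simp_all
  note h [measurable]
  show "(\<lambda>\<omega>. h (p \<omega>) (D (Suc k) \<omega>)) \<in> borel_measurable M"
    by measurable
  show "integrable M (\<lambda>\<omega>. (1 + (norm (p \<omega>))\<^sup>2) * G (D (Suc k) \<omega>))"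
    using square_integrable_past_norm_sq[OF p] G by (intro integrable_past_mult) auto
qed (rule bound)

text \<open>A single recursion for the error and for all the parts it is split into: only the
  starting point \<open>p\<close> and the driving term \<open>g\<close> change.\<close>

primrec process :: "'a \<Rightarrow> ('d \<Rightarrow> 'a) \<Rightarrow> nat \<Rightarrow> 'w \<Rightarrow> 'a" where
  "process p g 0 \<omega> = p"
| "process p g (Suc k) \<omega> = contraction (D (Suc k) \<omega>) (process p g k \<omega>) + \<gamma> *\<^sub>R g (D (Suc k) \<omega>)"

text \<open>The mean is left free, because the constant drift of the regularized recursion is also
  treated as a driving term.\<close>

definition noise :: "('d \<Rightarrow> 'a) \<Rightarrow> bool" where
  "noise g \<longleftrightarrow> g \<in> borel_measurable borel \<and> integrable M (\<lambda>\<omega>. (norm (g (Z \<omega>)))\<^sup>2)"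

definition centred_noise :: "('d \<Rightarrow> 'a) \<Rightarrow> bool" where
  "centred_noise g \<longleftrightarrow> noise g \<and> (\<forall>v. (\<integral>\<omega>. g (Z \<omega>) \<bullet> v \<partial>M) = 0)"

lemma noise_inner:
  assumes "noise g"
  shows "integrable M (\<lambda>\<omega>. g (Z \<omega>) \<bullet> v)" "integrable M (\<lambda>\<omega>. (g (Z \<omega>) \<bullet> v)\<^sup>2)"
proof -
  have [measurable]: "g \<in> borel_measurable borel" and 2: "integrable M (\<lambda>\<omega>. (norm (g (Z \<omega>)))\<^sup>2)"
    using assms by (auto simp: noise_def)
  have 3: "(\<lambda>\<omega>. g (Z \<omega>)) \<in> borel_measurable M"
    by measurable
  show "integrable M (\<lambda>\<omega>. g (Z \<omega>) \<bullet> v)"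
  proof (rule integrable_dominated)
    show "integrable M (\<lambda>\<omega>. norm (g (Z \<omega>)) * norm v)"
      using square_integrable_imp_integrable_norm[OF 3 2] by (rule integrable_mult_left)
  qed (auto simp: Cauchy_Schwarz_ineq2)
  show "integrable M (\<lambda>\<omega>. (g (Z \<omega>) \<bullet> v)\<^sup>2)"
  proof (rule integrable_dominated)
    show "integrable M (\<lambda>\<omega>. (norm (g (Z \<omega>)))\<^sup>2 * (norm v)\<^sup>2)"
      using 2 by (rule integrable_mult_left)
    show "\<bar>(g (Z \<omega>) \<bullet> v)\<^sup>2\<bar> \<le> (norm (g (Z \<omega>)))\<^sup>2 * (norm v)\<^sup>2" for \<omega>
      using Cauchy_Schwarz_ineq[of "g (Z \<omega>)" v] by (simp add: power2_norm_eq_inner)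
  qed measurable
qed

text \<open>The factor for \<open>integrable_past_next\<close> that dominates one step. The 2 and
  the 4 come from \<open>(a + b)^2 \<le> 2 a^2 + 2 b^2\<close>, used once to split off
  \<open>g\<close> and once more inside the matrix; the matrix is quadratic in \<open>X d\<close>,
  hence the fourth power.\<close>

definition step_bound :: "('d \<Rightarrow> 'a) \<Rightarrow> 'd \<Rightarrow> real" where
  "step_bound g d = 4 * (1 + \<gamma> * lam)\<^sup>2 + 4 * \<gamma>\<^sup>2 * (norm (X d))^4 + 2 * \<gamma>\<^sup>2 * (norm (g d))\<^sup>2"

lemma step_bound:
  assumes "noise g"
  shows "step_bound g \<in> borel_measurable borel" "integrable M (\<lambda>\<omega>. step_bound g (Z \<omega>))"
proof -
  have [measurable]: "g \<in> borel_measurable borel" and "integrable M (\<lambda>\<omega>. (norm (g (Z \<omega>)))\<^sup>2)"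
    using assms by (auto simp: noise_def)
  then show "integrable M (\<lambda>\<omega>. step_bound g (Z \<omega>))"
    unfolding step_bound_def using int_norm_X4 by simp
  show "step_bound g \<in> borel_measurable borel"
    unfolding step_bound_def[abs_def] by measurable
qed

lemma norm_contraction_sq_le:
  "(norm (contraction d u))\<^sup>2 \<le> (norm u)\<^sup>2 * (2 * (1 + \<gamma> * lam)\<^sup>2 + 2 * \<gamma>\<^sup>2 * (norm (X d))^4)"
proof -
  have "(norm (contraction d u))\<^sup>2 \<le> ((1 + \<gamma> * lam + \<gamma> * (norm (X d))\<^sup>2) * norm u)\<^sup>2"
    using norm_contraction_le by (intro power_mono) auto
  also have "\<dots> = (1 + \<gamma> * lam + \<gamma> * (norm (X d))\<^sup>2)\<^sup>2 * (norm u)\<^sup>2"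
    by (simp add: power_mult_distrib)
  also have "(1 + \<gamma> * lam + \<gamma> * (norm (X d))\<^sup>2)\<^sup>2 \<le> 2 * (1 + \<gamma> * lam)\<^sup>2 + 2 * \<gamma>\<^sup>2 * (norm (X d))^4"
  proof -
    have "(a + b)\<^sup>2 \<le> 2 * a\<^sup>2 + 2 * b\<^sup>2" for a b :: real
      using zero_le_power2[of "a - b"] by (simp add: power2_sum power2_diff)
    from this[of "1 + \<gamma> * lam" "\<gamma> * (norm (X d))\<^sup>2"] show ?thesis
      by (simp add: power_mult_distrib flip: power_mult)
  qed
  finally show ?thesis
    by (simp add: mult_right_mono mult.commute)
qed

lemma step_le:
  "(norm (contraction d u + \<gamma> *\<^sub>R g d))\<^sup>2 \<le> (1 + (norm u)\<^sup>2) * step_bound g d"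
  "(norm (contraction d u))\<^sup>2 \<le> (1 + (norm u)\<^sup>2) * step_bound g d"
  "\<bar>2 * \<gamma> * (contraction d u \<bullet> g d)\<bar> \<le> (1 + (norm u)\<^sup>2) * step_bound g d"
proof -
  let ?c = "norm (contraction d u)" and ?g = "norm (\<gamma> *\<^sub>R g d)"
  have "2 * ?c\<^sup>2 + 2 * ?g\<^sup>2 \<le> (norm u)\<^sup>2 * (4 * (1 + \<gamma> * lam)\<^sup>2 + 4 * \<gamma>\<^sup>2 * (norm (X d))^4) + 2 * \<gamma>\<^sup>2 * (norm (g d))\<^sup>2"
    using norm_contraction_sq_le[of d u] by (simp add: power_mult_distrib algebra_simps)
  also have "\<dots> \<le> (1 + (norm u)\<^sup>2) * step_bound g d"
    by (simp add: step_bound_def algebra_simps)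
  finally have *: "2 * ?c\<^sup>2 + 2 * ?g\<^sup>2 \<le> (1 + (norm u)\<^sup>2) * step_bound g d" .
  have "(norm (contraction d u + \<gamma> *\<^sub>R g d))\<^sup>2 \<le> (?c + ?g)\<^sup>2"
    by (intro power_mono norm_triangle_ineq) auto
  also have "\<dots> \<le> 2 * ?c\<^sup>2 + 2 * ?g\<^sup>2"
    using zero_le_power2[of "?c - ?g"] by (simp add: power2_sum power2_diff del: norm_scaleR)
  finally show "(norm (contraction d u + \<gamma> *\<^sub>R g d))\<^sup>2 \<le> (1 + (norm u)\<^sup>2) * step_bound g d"
    using * by simp
  show "?c\<^sup>2 \<le> (1 + (norm u)\<^sup>2) * step_bound g d"
    using * zero_le_power2[of ?c] zero_le_power2[of ?g] by linarith
  have "\<bar>2 * \<gamma> * (contraction d u \<bullet> g d)\<bar> = 2 * \<bar>contraction d u \<bullet> (\<gamma> *\<^sub>R g d)\<bar>"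
    by (simp add: abs_mult)
  also have "\<dots> \<le> 2 * (?c * ?g)"
    using Cauchy_Schwarz_ineq2[of "contraction d u" "\<gamma> *\<^sub>R g d"] by simp
  also have "\<dots> \<le> 2 * ?c\<^sup>2 + 2 * ?g\<^sup>2"
    using zero_le_power2[of "?c - ?g"] zero_le_power2[of ?c] zero_le_power2[of ?g]
    unfolding power2_diff by linarith
  finally show "\<bar>2 * \<gamma> * (contraction d u \<bullet> g d)\<bar> \<le> (1 + (norm u)\<^sup>2) * step_bound g d"
    using * by simp
qed

lemma square_integrable_past_process:
  assumes g: "noise g"
  shows "square_integrable_past k (process p g k)"
proof (induction k)
  case 0
  show ?case
    by (simp add: square_integrable_past_def)
next
  case (Suc k)
  have [measurable]: "g \<in> borel_measurable borel"
    using g by (simp add: noise_def)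
  have "integrable M (\<lambda>\<omega>. (norm (contraction (D (Suc k) \<omega>) (process p g k \<omega>) + \<gamma> *\<^sub>R g (D (Suc k) \<omega>)))\<^sup>2)"
    by (rule integrable_past_next[OF Suc _ step_bound[OF g], where h = "\<lambda>u d. (norm (contraction d u + \<gamma> *\<^sub>R g d))\<^sup>2"])
       (use step_le(1)[of _ _ g] in auto)
  moreover have "process p g (Suc k) \<in> borel_measurable (past (Suc k))"
  proof -
    have [measurable]: "process p g k \<in> borel_measurable (past (Suc k))"
      using measurable_past_mono[OF square_integrable_past_adapted[OF Suc]] by simp
    have [measurable]: "D (Suc k) \<in> borel_measurable (past (Suc k))"
      by (rule measurable_D_past) auto
    show ?thesis
      by (subst process.simps(2)[abs_def]) measurable
  qed
  ultimately show ?case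
    unfolding square_integrable_past_def by (intro conjI) (assumption, simp only: process.simps)
qed

section \<open>Second moments of the recursion\<close>

lemma process_Suc_inner:
  "process p g (Suc k) \<omega> \<bullet> v
     = process p g k \<omega> \<bullet> contraction (D (Suc k) \<omega>) v + \<gamma> * (g (D (Suc k) \<omega>) \<bullet> v)"
  by (simp add: inner_add_left contraction_selfadjoint)

lemma step_inner_sq_le:
  "(u \<bullet> contraction d v + \<gamma> * (g d \<bullet> v))\<^sup>2 \<le> (1 + (norm u)\<^sup>2) * (step_bound g d * (norm v)\<^sup>2)"
proof -
  have "(u \<bullet> contraction d v + \<gamma> * (g d \<bullet> v))\<^sup>2 = ((contraction d u + \<gamma> *\<^sub>R g d) \<bullet> v)\<^sup>2"
    by (simp add: inner_add_left contraction_selfadjoint)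
  also have "\<dots> \<le> (norm (contraction d u + \<gamma> *\<^sub>R g d))\<^sup>2 * (norm v)\<^sup>2"
    using Cauchy_Schwarz_ineq[of "contraction d u + \<gamma> *\<^sub>R g d" v] by (simp add: power2_norm_eq_inner)
  also have "\<dots> \<le> (1 + (norm u)\<^sup>2) * step_bound g d * (norm v)\<^sup>2"
    using step_le(1) by (intro mult_right_mono) auto
  finally show ?thesis
    by (simp add: mult.assoc)
qed

text \<open>A recursion for the function that sends \<open>v\<close> to the second moment of
  \<open>process p g k\<close> in direction \<open>v\<close>: the last observation is frozen and
  acts on the test vector, so an induction hypothesis for all \<open>v\<close> applies to the inner
  integral.\<close>

lemma
  assumes g: "noise g"
  shows process_Suc_sq_Fubini: "(\<integral>\<omega>. (process p g (Suc k) \<omega> \<bullet> v)\<^sup>2 \<partial>M)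
      = (\<integral>\<omega>'. (\<integral>\<omega>. (process p g k \<omega> \<bullet> contraction (Z \<omega>') v + \<gamma> * (g (Z \<omega>') \<bullet> v))\<^sup>2 \<partial>M) \<partial>M)"
    and process_Suc_sq_Fubini_integrable:
      "integrable M (\<lambda>\<omega>'. \<integral>\<omega>. (process p g k \<omega> \<bullet> contraction (Z \<omega>') v + \<gamma> * (g (Z \<omega>') \<bullet> v))\<^sup>2 \<partial>M)"
proof -
  have [measurable]: "g \<in> borel_measurable borel"
    using g by (simp add: noise_def)
  let ?h = "\<lambda>u d. (u \<bullet> contraction d v + \<gamma> * (g d \<bullet> v))\<^sup>2"
  note sip = square_integrable_past_process[OF g, of k p]
  have int: "integrable M (\<lambda>\<omega>. ?h (process p g k \<omega>) (D (Suc k) \<omega>))"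
  proof (rule integrable_past_next[OF sip, where h = ?h])
    show "(\<lambda>d. step_bound g d * (norm v)\<^sup>2) \<in> borel_measurable borel"
      using step_bound(1)[OF g] by simp
    show "integrable M (\<lambda>\<omega>. step_bound g (Z \<omega>) * (norm v)\<^sup>2)"
      using step_bound(2)[OF g] by (rule integrable_mult_left)
    show "\<bar>?h u d\<bar> \<le> (1 + (norm u)\<^sup>2) * (step_bound g d * (norm v)\<^sup>2)" for u d
      using step_inner_sq_le by simp
  qed measurable
  have h: "(\<lambda>(u, d). ?h u d) \<in> borel_measurable (borel \<Otimes>\<^sub>M borel)"
    by measurable
  show "(\<integral>\<omega>. (process p g (Suc k) \<omega> \<bullet> v)\<^sup>2 \<partial>M)
      = (\<integral>\<omega>'. (\<integral>\<omega>. ?h (process p g k \<omega>) (Z \<omega>') \<partial>M) \<partial>M)"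
    unfolding process_Suc_inner by (rule integral_past_snd[OF square_integrable_past_adapted[OF sip] h int])
  show "integrable M (\<lambda>\<omega>'. \<integral>\<omega>. ?h (process p g k \<omega>) (Z \<omega>') \<partial>M)"
    by (rule integrable_past_snd[OF square_integrable_past_adapted[OF sip] h int])
qed

text \<open>It makes the cross terms between the past and a new noise vanish whenever the past is
  averaged first.\<close>

lemma process_mean_zero:
  assumes g: "centred_noise g"
  shows "(\<integral>\<omega>. process 0 g k \<omega> \<bullet> v \<partial>M) = 0"
proof (induction k arbitrary: v)
  case (Suc k)
  have gn: "noise g" and g0: "\<And>v. (\<integral>\<omega>. g (Z \<omega>) \<bullet> v \<partial>M) = 0"
    using g by (auto simp: centred_noise_def)
  have [measurable]: "g \<in> borel_measurable borel"
    using gn by (simp add: noise_def)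
  note sip = square_integrable_past_process[OF gn, of k 0]
  let ?h = "\<lambda>u d. u \<bullet> contraction d v + \<gamma> * (g d \<bullet> v)"
  have "integrable M (\<lambda>\<omega>. process 0 g (Suc k) \<omega> \<bullet> v)"
    by (rule square_integrable_past_inner[OF square_integrable_past_process[OF gn]])
  then have int: "integrable M (\<lambda>\<omega>. ?h (process 0 g k \<omega>) (D (Suc k) \<omega>))"
    by (simp only: process_Suc_inner)
  have "(\<integral>\<omega>. process 0 g (Suc k) \<omega> \<bullet> v \<partial>M) = (\<integral>\<omega>'. (\<integral>\<omega>. ?h (process 0 g k \<omega>) (Z \<omega>') \<partial>M) \<partial>M)"
    unfolding process_Suc_inner by (rule integral_past_snd[OF square_integrable_past_adapted[OF sip] _ int]) measurable
  also have "\<dots> = (\<integral>\<omega>'. \<gamma> * (g (Z \<omega>') \<bullet> v) \<partial>M)"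
    using Suc square_integrable_past_inner[OF sip] by (simp add: prob_space)
  also have "\<dots> = 0"
    using g0 by simp
  finally show ?case .
qed simp

text \<open>
  The claim is an operator inequality \<open>\<Sum>\<^sub>k E[p\<^sub>k p\<^sub>k\<^sup>T] \<le> (c / \<gamma>) I\<close>; tested against all \<open>v\<close> at once it
  passes through the first step of the recursion.
\<close>

lemma sum_bias_process:
  assumes c: "c \<ge> 0" "\<And>v. (p \<bullet> v)\<^sup>2 \<le> c * (\<Sigma> v \<bullet> v + lam * (norm v)\<^sup>2)"
  shows "(\<Sum>k<N. \<integral>\<omega>. (process p (\<lambda>_. 0) k \<omega> \<bullet> v)\<^sup>2 \<partial>M) \<le> c / \<gamma> * (norm v)\<^sup>2"
proof (induction N arbitrary: v)
  case 0
  then show ?case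
    using c gamma_pos by simp
next
  case (Suc N)
  have g: "noise (\<lambda>_. 0)"
    by (simp add: noise_def)
  let ?q = "\<lambda>k w. \<integral>\<omega>. (process p (\<lambda>_. 0) k \<omega> \<bullet> w)\<^sup>2 \<partial>M"
  have int: "integrable M (\<lambda>\<omega>'. ?q k (contraction (Z \<omega>') v))" for k
    using process_Suc_sq_Fubini_integrable[OF g, of p k v] by simp
  have "(\<Sum>k<Suc N. ?q k v) = (p \<bullet> v)\<^sup>2 + (\<Sum>k<N. ?q (Suc k) v)"
    by (subst sum.lessThan_Suc_shift) (simp add: prob_space)
  \<comment> \<open>Each summand freezes a different observation, but all of them have the law of
    \<open>Z\<close>. A single integral therefore serves for the whole sum, and the induction
    hypothesis applies under it to \<open>contraction (Z \<omega>') v\<close>.\<close>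
  also have "(\<Sum>k<N. ?q (Suc k) v) = (\<integral>\<omega>'. (\<Sum>k<N. ?q k (contraction (Z \<omega>') v)) \<partial>M)"
    using process_Suc_sq_Fubini[OF g, of p _ v] int by (simp add: Bochner_Integration.integral_sum del: process.simps)
  also have "\<dots> \<le> (\<integral>\<omega>'. c / \<gamma> * (norm (contraction (Z \<omega>') v))\<^sup>2 \<partial>M)"
    using int int_norm_contraction Suc by (intro integral_mono) auto
  \<comment> \<open>The factor \<open>c / \<gamma>\<close> is chosen so that the decrease of the
    contraction pays exactly for the initial term \<open>(p \<bullet> v)\<^sup>2\<close>, bounded by
    \<open>c(2)\<close>.\<close>
  also have "\<dots> \<le> c / \<gamma> * ((norm v)\<^sup>2 - \<gamma> * (\<Sigma> v \<bullet> v + lam * (norm v)\<^sup>2))"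
    using norm_contraction c gamma_pos by (simp add: mult_left_mono divide_right_mono)
  also have "(p \<bullet> v)\<^sup>2 \<le> c * (\<Sigma> v \<bullet> v + lam * (norm v)\<^sup>2)"
    by (rule c(2))
  finally show ?case
    using gamma_pos by (simp add: field_simps)
qed

text \<open>The operator \<open>\<gamma> \<sigma>^2 I\<close> is a supersolution of the covariance
  recursion: one contraction lowers its form by at least
  \<open>\<gamma>^2 \<sigma>^2 (\<Sigma> v \<bullet> v)\<close>, and the fresh noise restores at
  most that amount.\<close>

lemma noise_process:
  assumes g: "centred_noise g"
    and \<sigma>: "\<And>v. (\<integral>\<omega>. (g (Z \<omega>) \<bullet> v)\<^sup>2 \<partial>M) \<le> \<sigma>\<^sup>2 * (\<Sigma> v \<bullet> v)"
  shows "(\<integral>\<omega>. (process 0 g k \<omega> \<bullet> v)\<^sup>2 \<partial>M) \<le> \<gamma> * \<sigma>\<^sup>2 * (norm v)\<^sup>2"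
proof (induction k arbitrary: v)
  case 0
  then show ?case
    using gamma_pos by simp
next
  case (Suc k)
  have gn: "noise g"
    using g by (simp add: centred_noise_def)
  note sip = square_integrable_past_process[OF gn, of k 0]
  let ?p = "process 0 g k"
  have inner: "(\<integral>\<omega>. (?p \<omega> \<bullet> contraction d v + \<gamma> * (g d \<bullet> v))\<^sup>2 \<partial>M)
      \<le> \<gamma> * \<sigma>\<^sup>2 * (norm (contraction d v))\<^sup>2 + \<gamma>\<^sup>2 * (g d \<bullet> v)\<^sup>2" for d
  proof -
    have "(\<integral>\<omega>. (?p \<omega> \<bullet> contraction d v + \<gamma> * (g d \<bullet> v))\<^sup>2 \<partial>M)
        = (\<integral>\<omega>. (?p \<omega> \<bullet> contraction d v)\<^sup>2 + (?p \<omega> \<bullet> contraction d v) * (2 * \<gamma> * (g d \<bullet> v)) + \<gamma>\<^sup>2 * (g d \<bullet> v)\<^sup>2 \<partial>M)"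
      by (intro Bochner_Integration.integral_cong refl) (simp add: power2_sum power_mult_distrib algebra_simps)
    also have "\<dots> = (\<integral>\<omega>. (?p \<omega> \<bullet> contraction d v)\<^sup>2 \<partial>M) + \<gamma>\<^sup>2 * (g d \<bullet> v)\<^sup>2"
      using square_integrable_past_inner[OF sip] square_integrable_past_inner_sq[OF sip] process_mean_zero[OF g]
      by (simp add: prob_space)
    finally show ?thesis
      using Suc by simp
  qed
  have "(\<integral>\<omega>. (process 0 g (Suc k) \<omega> \<bullet> v)\<^sup>2 \<partial>M)
      \<le> (\<integral>\<omega>'. \<gamma> * \<sigma>\<^sup>2 * (norm (contraction (Z \<omega>') v))\<^sup>2 + \<gamma>\<^sup>2 * (g (Z \<omega>') \<bullet> v)\<^sup>2 \<partial>M)"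
    unfolding process_Suc_sq_Fubini[OF gn]
    using inner process_Suc_sq_Fubini_integrable[OF gn] int_norm_contraction noise_inner[OF gn]
    by (intro integral_mono) auto
  also have "\<dots> = \<gamma> * \<sigma>\<^sup>2 * (\<integral>\<omega>'. (norm (contraction (Z \<omega>') v))\<^sup>2 \<partial>M) + \<gamma>\<^sup>2 * (\<integral>\<omega>'. (g (Z \<omega>') \<bullet> v)\<^sup>2 \<partial>M)"
    using int_norm_contraction noise_inner[OF gn] by simp
  also have "\<dots> \<le> \<gamma> * \<sigma>\<^sup>2 * ((norm v)\<^sup>2 - \<gamma> * (\<Sigma> v \<bullet> v + lam * (norm v)\<^sup>2)) + \<gamma>\<^sup>2 * (\<sigma>\<^sup>2 * (\<Sigma> v \<bullet> v))"
    using norm_contraction \<sigma> gamma_pos by (intro add_mono mult_left_mono) auto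
  also have "\<dots> = \<gamma> * \<sigma>\<^sup>2 * (norm v)\<^sup>2 - \<gamma>\<^sup>2 * \<sigma>\<^sup>2 * lam * (norm v)\<^sup>2"
    by (simp add: power2_eq_square algebra_simps)
  also have "\<dots> \<le> \<gamma> * \<sigma>\<^sup>2 * (norm v)\<^sup>2"
    using lam_nonneg by simp
  finally show ?case .
qed

lemma integrable_Sigma_form:
  assumes "square_integrable_past k p"
  shows "integrable M (\<lambda>\<omega>. \<Sigma> (p \<omega>) \<bullet> p \<omega>)"
  unfolding Sigma_diag quadratic_form_diag_op using square_integrable_past_inner_sq[OF assms] by simp

text \<open>An energy balance: each step loses \<open>\<gamma>\<close> times the \<Sigma>-energy and
  gains at most \<open>\<gamma>\<^sup>2 * G\<close>. It asks only for the total variance of the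
  noise and in return controls the \<Sigma>-energies only in sum.\<close>

lemma energy_process:
  assumes g: "centred_noise g" and G: "(\<integral>\<omega>. (norm (g (Z \<omega>)))\<^sup>2 \<partial>M) \<le> G"
  shows "(\<integral>\<omega>. (norm (process 0 g N \<omega>))\<^sup>2 \<partial>M)
      + \<gamma> * (\<Sum>k<N. \<integral>\<omega>. \<Sigma> (process 0 g k \<omega>) \<bullet> process 0 g k \<omega> \<partial>M) \<le> real N * (\<gamma>\<^sup>2 * G)"
proof (induction N)
  case (Suc N)
  have gn: "noise g" and g0: "\<And>v. (\<integral>\<omega>. g (Z \<omega>) \<bullet> v \<partial>M) = 0"
    using g by (auto simp: centred_noise_def)
  have [measurable]: "g \<in> borel_measurable borel" and g2: "integrable M (\<lambda>\<omega>. (norm (g (Z \<omega>)))\<^sup>2)"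
    using gn by (auto simp: noise_def)
  let ?p = "process 0 g N" and ?d = "\<lambda>\<omega>. D (Suc N) \<omega>"
  note sip = square_integrable_past_process[OF gn, of N 0]
  note sb = step_bound[OF gn]
  have m1: "(\<lambda>(u, d). (norm (contraction d u))\<^sup>2) \<in> borel_measurable (borel \<Otimes>\<^sub>M borel)"
    by measurable
  have m2: "(\<lambda>(u, d). 2 * \<gamma> * (contraction d u \<bullet> g d)) \<in> borel_measurable (borel \<Otimes>\<^sub>M borel)"
    by measurable
  have i1: "integrable M (\<lambda>\<omega>. (norm (contraction (?d \<omega>) (?p \<omega>)))\<^sup>2)"
    by (rule integrable_past_next[OF sip m1 sb]) (use step_le(2)[of _ _ g] in simp)
  have i2: "integrable M (\<lambda>\<omega>. 2 * \<gamma> * (contraction (?d \<omega>) (?p \<omega>) \<bullet> g (?d \<omega>)))"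
    by (rule integrable_past_next[OF sip m2 sb]) (rule step_le(3))
  have i3: "integrable M (\<lambda>\<omega>. (norm (g (?d \<omega>)))\<^sup>2)"
    using integrable_D[of "Suc N" "\<lambda>d. (norm (g d))\<^sup>2"] g2 by simp
  have "(\<integral>\<omega>. (norm (process 0 g (Suc N) \<omega>))\<^sup>2 \<partial>M)
     = (\<integral>\<omega>. (norm (contraction (?d \<omega>) (?p \<omega>)))\<^sup>2 + 2 * \<gamma> * (contraction (?d \<omega>) (?p \<omega>) \<bullet> g (?d \<omega>))
          + \<gamma>\<^sup>2 * (norm (g (?d \<omega>)))\<^sup>2 \<partial>M)"
    unfolding process.simps power2_norm_eq_inner
    by (intro Bochner_Integration.integral_cong refl)
       (simp add: inner_add_left inner_add_right inner_commute power2_eq_square)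
  also have "\<dots> = (\<integral>\<omega>. (norm (contraction (?d \<omega>) (?p \<omega>)))\<^sup>2 \<partial>M)
      + (\<integral>\<omega>. 2 * \<gamma> * (contraction (?d \<omega>) (?p \<omega>) \<bullet> g (?d \<omega>)) \<partial>M) + \<gamma>\<^sup>2 * (\<integral>\<omega>. (norm (g (?d \<omega>)))\<^sup>2 \<partial>M)"
    using i1 i2 i3 by (simp del: integral_mult_right_zero integral_mult_left_zero)
  \<comment> \<open>Matrix and noise depend on the same observation, so centring of \<open>g\<close>
    is not what removes this term. With the observation frozen, the zero mean of the past process
    does.\<close>
  also have "(\<integral>\<omega>. 2 * \<gamma> * (contraction (?d \<omega>) (?p \<omega>) \<bullet> g (?d \<omega>)) \<partial>M) = 0"
    unfolding integral_past_snd[OF square_integrable_past_adapted[OF sip] m2 i2]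
    by (simp add: contraction_selfadjoint process_mean_zero[OF g])
  also have "(\<integral>\<omega>. (norm (g (?d \<omega>)))\<^sup>2 \<partial>M) = (\<integral>\<omega>. (norm (g (Z \<omega>)))\<^sup>2 \<partial>M)"
    by (rule integral_D) auto
  \<comment> \<open>Here the new observation is averaged first, since
    \<open>norm_contraction\<close> concerns a fixed vector.\<close>
  also have "(\<integral>\<omega>. (norm (contraction (?d \<omega>) (?p \<omega>)))\<^sup>2 \<partial>M)
      = (\<integral>\<omega>. (\<integral>\<omega>'. (norm (contraction (Z \<omega>') (?p \<omega>)))\<^sup>2 \<partial>M) \<partial>M)"
    by (rule integral_past_fst[OF square_integrable_past_adapted[OF sip] m1 i1])
  also have "\<dots> \<le> (\<integral>\<omega>. (norm (?p \<omega>))\<^sup>2 - \<gamma> * (\<Sigma> (?p \<omega>) \<bullet> ?p \<omega>) \<partial>M)"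
  proof (rule integral_mono)
    show "integrable M (\<lambda>\<omega>. \<integral>\<omega>'. (norm (contraction (Z \<omega>') (?p \<omega>)))\<^sup>2 \<partial>M)"
      by (rule integrable_past_fst[OF square_integrable_past_adapted[OF sip] m1 i1])
    show "integrable M (\<lambda>\<omega>. (norm (?p \<omega>))\<^sup>2 - \<gamma> * (\<Sigma> (?p \<omega>) \<bullet> ?p \<omega>))"
      using square_integrable_past_norm_sq[OF sip] integrable_Sigma_form[OF sip] by simp
    fix \<omega>
    have "0 \<le> \<gamma> * (lam * (norm (?p \<omega>))\<^sup>2)"
      using gamma_pos lam_nonneg by simp
    then show "(\<integral>\<omega>'. (norm (contraction (Z \<omega>') (?p \<omega>)))\<^sup>2 \<partial>M) \<le> (norm (?p \<omega>))\<^sup>2 - \<gamma> * (\<Sigma> (?p \<omega>) \<bullet> ?p \<omega>)"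
      using norm_contraction[of "?p \<omega>"] by (simp add: distrib_left)
  qed
  also have "\<dots> = (\<integral>\<omega>. (norm (?p \<omega>))\<^sup>2 \<partial>M) - \<gamma> * (\<integral>\<omega>. \<Sigma> (?p \<omega>) \<bullet> ?p \<omega> \<partial>M)"
    using square_integrable_past_norm_sq[OF sip] integrable_Sigma_form[OF sip] by simp
  also have "\<gamma>\<^sup>2 * (\<integral>\<omega>. (norm (g (Z \<omega>)))\<^sup>2 \<partial>M) \<le> \<gamma>\<^sup>2 * G"
    using G by (intro mult_left_mono) auto
  finally show ?case
    using Suc by (simp add: algebra_simps del: process.simps)
qed simp

end

section \<open>The averaged error\<close>

lemma sum_square_le_4: "(a + b + c + d)\<^sup>2 \<le> 4 * (a\<^sup>2 + b\<^sup>2 + c\<^sup>2 + d\<^sup>2)" for a b c d :: real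
proof -
  have "4 * (a\<^sup>2 + b\<^sup>2 + c\<^sup>2 + d\<^sup>2) - (a + b + c + d)\<^sup>2
      = (a - b)\<^sup>2 + (a - c)\<^sup>2 + (a - d)\<^sup>2 + (b - c)\<^sup>2 + (b - d)\<^sup>2 + (c - d)\<^sup>2"
    by (simp add: power2_eq_square algebra_simps)
  also have "\<dots> \<ge> 0"
    by simp
  finally show ?thesis
    by simp
qed

text \<open>Without further input, the value \<open>s k\<close> contributes
  \<open>\<rho> (n - k) * s k\<close> to the sum from \<open>k\<close> to \<open>n\<close>. The
  input of step \<open>Suc k\<close> is felt only from index \<open>Suc k\<close> on, which gives it
  the weight \<open>\<rho> (n - Suc k)\<close>.\<close>

lemma affine_recursion_sum:
  fixes s w :: "nat \<Rightarrow> real" and \<rho> :: "nat \<Rightarrow> real"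
  assumes s: "\<And>k. s (Suc k) = a * s k + c + g * w k"
    and \<rho>: "\<And>j. \<rho> j = (\<Sum>i\<le>j. a ^ i)"
  shows "(\<Sum>i\<le>n. s i) = (\<rho> n * s 0 + c * (\<Sum>k<n. \<rho> (n - Suc k))) + (\<Sum>k<n. g * \<rho> (n - Suc k) * w k)"
proof -
  have \<rho>_Suc: "\<rho> (Suc j) = 1 + a * \<rho> j" for j
    unfolding \<rho> by (subst sum.atMost_Suc_shift) (simp add: sum_distrib_left)
  \<comment> \<open>Invariant: the terms before \<open>k\<close> are summed explicitly and
    everything after them is extrapolated from \<open>s k\<close> and the inputs still to come. It
    is a triviality at \<open>k = 0\<close> and the claim at \<open>k = n\<close>.\<close>
  have "(\<Sum>i<k. s i) + \<rho> (n - k) * s k = \<rho> n * s 0 + (\<Sum>j<k. \<rho> (n - Suc j) * (c + g * w j))" if "k \<le> n" for k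
    using that
  proof (induction k)
    case (Suc k)
    have "\<rho> (n - k) = 1 + a * \<rho> (n - Suc k)"
      using Suc.prems \<rho>_Suc[of "n - Suc k"] by (simp add: Suc_diff_Suc)
    then show ?case
      using Suc by (simp add: s algebra_simps)
  qed simp
  from this[of n] show ?thesis
    using \<rho>[of 0] by (simp add: lessThan_Suc_atMost[symmetric] distrib_left sum.distrib sum_distrib_left mult_ac)
qed

lemma geometric_sum_bounds:
  fixes x :: real
  assumes "0 < x" "x \<le> 1"
  shows "0 \<le> (\<Sum>i\<le>j. (1 - x) ^ i)" "x * (\<Sum>i\<le>j. (1 - x) ^ i) \<le> 1"
proof -
  show "0 \<le> (\<Sum>i\<le>j. (1 - x) ^ i)"
    using assms by (intro sum_nonneg) auto
  have "x * (\<Sum>i\<le>j. (1 - x) ^ i) = 1 - (1 - x) ^ Suc j"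
    using assms one_diff_power_eq[of "1 - x" "Suc j"] by (simp add: lessThan_Suc_atMost)
  also have "\<dots> \<le> 1"
    using assms by simp
  finally show "x * (\<Sum>i\<le>j. (1 - x) ^ i) \<le> 1" .
qed

lemma integrable_mult_of_squares:
  fixes f g :: "'w \<Rightarrow> real"
  assumes "f \<in> borel_measurable M" "g \<in> borel_measurable M"
    "integrable M (\<lambda>\<omega>. (f \<omega>)\<^sup>2)" "integrable M (\<lambda>\<omega>. (g \<omega>)\<^sup>2)"
  shows "integrable M (\<lambda>\<omega>. f \<omega> * g \<omega>)"
proof (rule Bochner_Integration.integrable_bound)
  show "integrable M (\<lambda>\<omega>. (f \<omega>)\<^sup>2 + (g \<omega>)\<^sup>2)"
    using assms by simp
  have "\<bar>x * y\<bar> \<le> \<bar>x\<^sup>2 + y\<^sup>2\<bar>" for x y :: real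
    using zero_le_power2[of "\<bar>x\<bar> - \<bar>y\<bar>"] zero_le_power2[of x] zero_le_power2[of y]
    unfolding power2_diff abs_mult power2_abs by linarith
  then show "AE \<omega> in M. norm (f \<omega> * g \<omega>) \<le> norm ((f \<omega>)\<^sup>2 + (g \<omega>)\<^sup>2)"
    by simp
qed (use assms in measurable)

lemma (in prob_space) second_moment_orthogonal_sum:
  fixes f :: "nat \<Rightarrow> 'a \<Rightarrow> real"
  assumes f: "\<And>k. f k \<in> borel_measurable M" "\<And>k. integrable M (\<lambda>\<omega>. (f k \<omega>)\<^sup>2)"
    and mean: "\<And>k. (\<integral>\<omega>. f k \<omega> \<partial>M) = 0"
    and orth: "\<And>j k. j < k \<Longrightarrow> (\<integral>\<omega>. f j \<omega> * f k \<omega> \<partial>M) = 0"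
  shows "integrable M (\<lambda>\<omega>. (A + (\<Sum>k<n. f k \<omega>))\<^sup>2) \<and>
    (\<integral>\<omega>. (A + (\<Sum>k<n. f k \<omega>))\<^sup>2 \<partial>M) = A\<^sup>2 + (\<Sum>k<n. \<integral>\<omega>. (f k \<omega>)\<^sup>2 \<partial>M)"
proof (induction n)
  case (Suc n)
  let ?S = "\<lambda>\<omega>. A + (\<Sum>k<n. f k \<omega>)"
  have eq: "(A + (\<Sum>k<Suc n. f k \<omega>))\<^sup>2
      = (?S \<omega>)\<^sup>2 + (f n \<omega>)\<^sup>2 + 2 * (A * f n \<omega> + (\<Sum>k<n. f k \<omega> * f n \<omega>))" for \<omega>
    by (simp add: power2_eq_square algebra_simps sum_distrib_left sum_distrib_right)
  have int: "integrable M (\<lambda>\<omega>. f j \<omega> * f n \<omega>)" for j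
    by (rule integrable_mult_of_squares) (use f in auto)
  have int1: "integrable M (f n)"
    using integrable_mult_of_squares[of "\<lambda>_. 1" M "f n"] f by simp
  show ?case
    unfolding eq using Suc f(2)[of n] int int1 mean orth by (simp add: Bochner_Integration.integral_sum)
qed (simp add: prob_space)

context least_squares_sgd
begin

text \<open>On \<open>E\<close>, the eigenvalue \<open>\<kappa>\<^sub>e\<close> of
  \<open>\<Sigma> + lam I\<close>.\<close>

definition regularized_cov :: "'a \<Rightarrow> real" where
  "regularized_cov e = \<mu> e + lam"

lemma norm_E: "e \<in> E \<Longrightarrow> norm e = 1"
  using orthonormal[of e e] by (simp add: norm_eq_1)

lemma Sigma_basis: "e \<in> E \<Longrightarrow> \<Sigma> u \<bullet> e = \<mu> e * (u \<bullet> e)"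
  by (simp add: Sigma_diag diag_op_inner)

lemma regularized_cov_pos: "e \<in> E \<Longrightarrow> regularized_cov e > 0"
  using mu_pos lam_nonneg by (simp add: regularized_cov_def add_pos_nonneg)

text \<open>A by-product of \<open>norm_contraction\<close>: at the unit vector \<open>e\<close> its
  left side is non-negative and its right side is \<open>1 - \<gamma> * regularized_cov e\<close>.
  It makes the geometric sums non-negative and at most
  \<open>1 / (\<gamma> * regularized_cov e)\<close>.\<close>

lemma gamma_regularized_cov_le: "e \<in> E \<Longrightarrow> \<gamma> * regularized_cov e \<le> 1"
proof -
  assume e: "e \<in> E"
  have "0 \<le> (\<integral>\<omega>. (norm (contraction (Z \<omega>) e))\<^sup>2 \<partial>M)"
    by (intro integral_nonneg_AE) simp
  also have "\<dots> \<le> 1 - \<gamma> * regularized_cov e"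
    using norm_contraction[of e] e norm_E[OF e] by (simp add: Sigma_basis norm_eq_1 regularized_cov_def)
  finally show ?thesis
    by simp
qed

section \<open>The driving noises and the parts of the error\<close>

lemma centred_noise_eps: "centred_noise (\<lambda>d. \<epsilon> d *\<^sub>R X d)"
  unfolding centred_noise_def noise_def
  using int_eps_X_sq eps_uncorrelated by (simp add: power_mult_distrib)

text \<open>The vector \<open>(X d \<bullet> m) *\<^sub>R X d\<close> has mean
  \<open>\<Sigma> m\<close>, so the integral is its variance: the second moment, which
  \<open>fourth_moment\<close> bounds, minus the squared norm of the mean.\<close>

lemma
  shows centred_noise_mult: "centred_noise (\<lambda>d. \<Sigma> m - (X d \<bullet> m) *\<^sub>R X d)"
    and norm_noise_mult: "(\<integral>\<omega>. (norm (\<Sigma> m - (X (Z \<omega>) \<bullet> m) *\<^sub>R X (Z \<omega>)))\<^sup>2 \<partial>M) \<le> R\<^sup>2 * (\<Sigma> m \<bullet> m)"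
proof -
  have eq: "(norm (\<Sigma> m - (X d \<bullet> m) *\<^sub>R X d))\<^sup>2
      = (norm (\<Sigma> m))\<^sup>2 - 2 * ((X d \<bullet> m) * (X d \<bullet> \<Sigma> m)) + (norm (X d))\<^sup>2 * (X d \<bullet> m)\<^sup>2" for d
    unfolding power2_norm_eq_inner inner_diff_left inner_diff_right
    by (simp add: inner_commute power2_eq_square algebra_simps)
  note [simp] = int_X_X int_X2_X2
  have int: "integrable M (\<lambda>\<omega>. (norm (\<Sigma> m - (X (Z \<omega>) \<bullet> m) *\<^sub>R X (Z \<omega>)))\<^sup>2)"
    unfolding eq by simp
  have "(\<lambda>d. \<Sigma> m - (X d \<bullet> m) *\<^sub>R X d) \<in> borel_measurable borel"
    by measurable
  then show "centred_noise (\<lambda>d. \<Sigma> m - (X d \<bullet> m) *\<^sub>R X d)"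
    unfolding centred_noise_def noise_def
    using int by (simp add: inner_diff_left covariance prob_space)
  have "(\<integral>\<omega>. (norm (\<Sigma> m - (X (Z \<omega>) \<bullet> m) *\<^sub>R X (Z \<omega>)))\<^sup>2 \<partial>M)
      = - (norm (\<Sigma> m))\<^sup>2 + (\<integral>\<omega>. (norm (X (Z \<omega>)))\<^sup>2 * (X (Z \<omega>) \<bullet> m)\<^sup>2 \<partial>M)"
    unfolding eq by (simp add: covariance prob_space dot_square_norm)
  then show "(\<integral>\<omega>. (norm (\<Sigma> m - (X (Z \<omega>) \<bullet> m) *\<^sub>R X (Z \<omega>)))\<^sup>2 \<partial>M) \<le> R\<^sup>2 * (\<Sigma> m \<bullet> m)"
    using fourth_moment[of m] zero_le_power2[of "norm (\<Sigma> m)"] by linarith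
qed

lemma noise_drift: "noise (\<lambda>d. \<epsilon> d *\<^sub>R X d + lam *\<^sub>R h)"
proof -
  have "integrable M (\<lambda>\<omega>. (norm (\<epsilon> (Z \<omega>) *\<^sub>R X (Z \<omega>) + lam *\<^sub>R h))\<^sup>2)"
  proof (rule integrable_dominated)
    show "integrable M (\<lambda>\<omega>. 2 * ((\<epsilon> (Z \<omega>))\<^sup>2 * (norm (X (Z \<omega>)))\<^sup>2) + 2 * (norm (lam *\<^sub>R h))\<^sup>2)"
      using int_eps_X_sq by simp
    fix \<omega>
    let ?a = "norm (\<epsilon> (Z \<omega>) *\<^sub>R X (Z \<omega>))" and ?b = "norm (lam *\<^sub>R h)"
    have "(norm (\<epsilon> (Z \<omega>) *\<^sub>R X (Z \<omega>) + lam *\<^sub>R h))\<^sup>2 \<le> (?a + ?b)\<^sup>2"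
      by (intro power_mono norm_triangle_ineq) auto
    also have "\<dots> \<le> 2 * ?a\<^sup>2 + 2 * ?b\<^sup>2"
      using zero_le_power2[of "?a - ?b"] unfolding power2_diff power2_sum by linarith
    also have "?a\<^sup>2 = (\<epsilon> (Z \<omega>))\<^sup>2 * (norm (X (Z \<omega>)))\<^sup>2"
      by (simp add: power_mult_distrib)
    finally show "\<bar>(norm (\<epsilon> (Z \<omega>) *\<^sub>R X (Z \<omega>) + lam *\<^sub>R h))\<^sup>2\<bar>
        \<le> 2 * ((\<epsilon> (Z \<omega>))\<^sup>2 * (norm (X (Z \<omega>)))\<^sup>2) + 2 * ?b\<^sup>2"
      by simp
  qed measurable
  then show ?thesis
    by (simp add: noise_def)
qed

text \<open>The deviation of the iterates from \<open>\<theta>\<^sub>s\<close> when \<open>h\<close>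
  is the initial deviation. Regularization pulls towards the starting point, and recentring at
  \<open>\<theta>\<^sub>s\<close> leaves the drift \<open>\<gamma> lam h\<close>.\<close>

abbreviation sgd_error :: "'a \<Rightarrow> nat \<Rightarrow> 'w \<Rightarrow> 'a" where
  "sgd_error h \<equiv> process h (\<lambda>d. \<epsilon> d *\<^sub>R X d + lam *\<^sub>R h)"

abbreviation mult_noise :: "'a \<Rightarrow> 'd \<Rightarrow> 'a" where
  "mult_noise m \<equiv> \<lambda>d. \<Sigma> m - (X d \<bullet> m) *\<^sub>R X d"

text \<open>
  \<open>lam *\<^sub>R m\<close> is the fixed point of the averaged recursion; subtracting it turns the drift into the
  multiplicative noise \<open>mult_noise m\<close>, which is centred.
\<close>

lemma sgd_error_decomposition:
  assumes m: "\<Sigma> m + lam *\<^sub>R m = h"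
  shows "sgd_error h k \<omega> = lam *\<^sub>R m + process (h - lam *\<^sub>R m) (\<lambda>_. 0) k \<omega>
      + process 0 (\<lambda>d. \<epsilon> d *\<^sub>R X d) k \<omega> + lam *\<^sub>R process 0 (mult_noise m) k \<omega>"
proof (induction k)
  case (Suc k)
  let ?d = "D (Suc k) \<omega>"
  have add: "contraction d (u + v) = contraction d u + contraction d v"
    and scale: "contraction d (c *\<^sub>R u) = c *\<^sub>R contraction d u" for d u v c
    by (simp_all add: contraction_def inner_add_right algebra_simps)
  have "contraction ?d (lam *\<^sub>R m) + \<gamma> *\<^sub>R lam *\<^sub>R h = lam *\<^sub>R m + lam *\<^sub>R \<gamma> *\<^sub>R mult_noise m ?d"
    unfolding m[symmetric] by (simp add: contraction_def algebra_simps)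
  then show ?case
    unfolding process.simps Suc add scale by (simp add: algebra_simps)
qed simp

section \<open>Martingale increments along an eigendirection\<close>

definition increment :: "'a \<Rightarrow> 'a \<Rightarrow> 'd \<Rightarrow> real" where
  "increment e u d = \<mu> e * (u \<bullet> e) - (X d \<bullet> u) * (X d \<bullet> e) + \<epsilon> d * (X d \<bullet> e)"

lemma measurable_increment [measurable]:
  assumes "f \<in> borel_measurable N" "g \<in> borel_measurable N"
  shows "(\<lambda>z. increment e (f z) (g z)) \<in> borel_measurable N"
  unfolding increment_def using assms by measurable

text \<open>\<open>increment e\<close> is the coordinate of the overview's \<open>w\<^sub>k\<close>
  along \<open>e\<close>: at an eigenvector, \<open>\<Sigma> u \<bullet> e\<close> is
  \<open>\<mu> e * (u \<bullet> e)\<close>, so the mean of the random matrix acts as a scalar and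
  only centred terms remain.\<close>

lemma sgd_error_Suc_inner:
  assumes e: "e \<in> E"
  shows "sgd_error h (Suc k) \<omega> \<bullet> e = (1 - \<gamma> * regularized_cov e) * (sgd_error h k \<omega> \<bullet> e)
     + \<gamma> * lam * (h \<bullet> e) + \<gamma> * increment e (sgd_error h k \<omega>) (D (Suc k) \<omega>)"
  by (simp add: contraction_def increment_def regularized_cov_def inner_add_left inner_diff_left algebra_simps)

lemma increment_mean: "e \<in> E \<Longrightarrow> (\<integral>\<omega>. increment e u (Z \<omega>) \<partial>M) = 0"
  unfolding increment_def using int_X_X int_eps_X
  by (simp add: covariance eps_uncorrelated prob_space Sigma_basis)

lemma increment_sq_le:
  assumes e: "e \<in> E"
  shows "(increment e u d)\<^sup>2
    \<le> (1 + (norm u)\<^sup>2) * (4 * (\<mu> e)\<^sup>2 + 4 * (norm (X d))^4 + 2 * ((\<epsilon> d)\<^sup>2 * (norm (X d))\<^sup>2))"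
proof -
  have sq: "(a + b)\<^sup>2 \<le> 2 * a\<^sup>2 + 2 * b\<^sup>2" "(a - b)\<^sup>2 \<le> 2 * a\<^sup>2 + 2 * b\<^sup>2" for a b :: real
    using zero_le_power2[of "a - b"] zero_le_power2[of "a + b"] unfolding power2_diff power2_sum by linarith+
  have CS: "(p \<bullet> q)\<^sup>2 \<le> (norm p)\<^sup>2 * (norm q)\<^sup>2" for p q :: 'a
    using Cauchy_Schwarz_ineq[of p q] by (simp add: power2_norm_eq_inner)
  have 1: "(u \<bullet> e)\<^sup>2 \<le> (norm u)\<^sup>2" "(X d \<bullet> e)\<^sup>2 \<le> (norm (X d))\<^sup>2"
    using CS[of u e] CS[of "X d" e] norm_E[OF e] by auto
  have 2: "(X d \<bullet> u)\<^sup>2 * (X d \<bullet> e)\<^sup>2 \<le> ((norm (X d))\<^sup>2 * (norm u)\<^sup>2) * (norm (X d))\<^sup>2"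
    by (intro mult_mono CS 1) auto
  have "(increment e u d)\<^sup>2 \<le> 2 * (\<mu> e * (u \<bullet> e) - (X d \<bullet> u) * (X d \<bullet> e))\<^sup>2 + 2 * (\<epsilon> d * (X d \<bullet> e))\<^sup>2"
    unfolding increment_def by (rule sq)
  also have "\<dots> \<le> 2 * (2 * (\<mu> e * (u \<bullet> e))\<^sup>2 + 2 * ((X d \<bullet> u) * (X d \<bullet> e))\<^sup>2) + 2 * (\<epsilon> d * (X d \<bullet> e))\<^sup>2"
    by (intro add_right_mono mult_left_mono sq) simp
  also have "\<dots> = 4 * ((\<mu> e)\<^sup>2 * (u \<bullet> e)\<^sup>2) + 4 * ((X d \<bullet> u)\<^sup>2 * (X d \<bullet> e)\<^sup>2) + 2 * ((\<epsilon> d)\<^sup>2 * (X d \<bullet> e)\<^sup>2)"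
    by (simp add: power_mult_distrib)
  also have "\<dots> \<le> 4 * ((\<mu> e)\<^sup>2 * (norm u)\<^sup>2) + 4 * (((norm (X d))\<^sup>2 * (norm u)\<^sup>2) * (norm (X d))\<^sup>2)
      + 2 * ((\<epsilon> d)\<^sup>2 * (norm (X d))\<^sup>2)"
    using 1 2 by (intro add_mono mult_left_mono) auto
  also have "\<dots> \<le> (1 + (norm u)\<^sup>2) * (4 * (\<mu> e)\<^sup>2 + 4 * (norm (X d))^4 + 2 * ((\<epsilon> d)\<^sup>2 * (norm (X d))\<^sup>2))"
  proof -
    have "(norm (X d))^4 = (norm (X d))\<^sup>2 * (norm (X d))\<^sup>2"
      by (simp flip: power_add)
    moreover have "0 \<le> (\<mu> e)\<^sup>2" "0 \<le> (norm (X d))\<^sup>2 * (norm (X d))\<^sup>2"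
        "0 \<le> (norm u)\<^sup>2 * ((\<epsilon> d)\<^sup>2 * (norm (X d))\<^sup>2)"
      by simp_all
    ultimately show ?thesis
      by (simp add: algebra_simps)
  qed
  finally show ?thesis .
qed

lemma integrable_increment_sq:
  assumes e: "e \<in> E" and p: "square_integrable_past k p"
  shows "integrable M (\<lambda>\<omega>. (increment e (p \<omega>) (D (Suc k) \<omega>))\<^sup>2)"
proof (rule integrable_past_next[OF p, where h = "\<lambda>u d. (increment e u d)\<^sup>2"])
  let ?G = "\<lambda>d. 4 * (\<mu> e)\<^sup>2 + 4 * (norm (X d))^4 + 2 * ((\<epsilon> d)\<^sup>2 * (norm (X d))\<^sup>2)"
  show "?G \<in> borel_measurable borel"
    by measurable
  show "integrable M (\<lambda>\<omega>. ?G (Z \<omega>))"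
    using int_norm_X4 int_eps_X_sq by simp
  show "\<bar>(increment e u d)\<^sup>2\<bar> \<le> (1 + (norm u)\<^sup>2) * ?G d" for u d
    using increment_sq_le[OF e] by simp
qed measurable

lemma measurable_increment_past:
  assumes p: "p \<in> borel_measurable (past k)" and "k < l"
  shows "(\<lambda>\<omega>. increment e (p \<omega>) (D (Suc k) \<omega>)) \<in> borel_measurable (past l)"
proof -
  have [measurable]: "p \<in> borel_measurable (past l)" "D (Suc k) \<in> borel_measurable (past l)"
    using measurable_past_mono[OF p] measurable_D_past[of "Suc k" l] assms(2) by auto
  show ?thesis
    by measurable
qed

lemma measurable_increment_M:
  assumes p: "p \<in> borel_measurable (past k)"
  shows "(\<lambda>\<omega>. increment e (p \<omega>) (D (Suc k) \<omega>)) \<in> borel_measurable M"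
  by (rule measurable_past_imp[OF measurable_increment_past[OF p lessI]])

text \<open>The martingale property in L2. Taking the pair \<open>(f, p)\<close> as the past
  variable, the average over the new observation is \<open>f\<close> times the vanishing mean of the
  increment.\<close>

lemma increment_orthogonal_past:
  assumes e: "e \<in> E" and p: "square_integrable_past k p"
    and f: "f \<in> borel_measurable (past k)" "integrable M (\<lambda>\<omega>. (f \<omega>)\<^sup>2)"
  shows "(\<integral>\<omega>. f \<omega> * increment e (p \<omega>) (D (Suc k) \<omega>) \<partial>M) = 0"
proof -
  have [measurable]: "f \<in> borel_measurable (past k)" "p \<in> borel_measurable (past k)"
    using f square_integrable_past_adapted[OF p] by auto
  let ?h = "\<lambda>u d. fst u * increment e (snd u) d"
  let ?f = "\<lambda>\<omega>. (f \<omega>, p \<omega>)"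
  have fm: "?f \<in> measurable (past k) (borel \<Otimes>\<^sub>M borel)"
    by measurable
  have hm: "(\<lambda>(u, d). ?h u d) \<in> borel_measurable ((borel \<Otimes>\<^sub>M borel) \<Otimes>\<^sub>M borel)"
    by measurable
  have int: "integrable M (\<lambda>\<omega>. ?h (?f \<omega>) (D (Suc k) \<omega>))"
    using integrable_mult_of_squares[OF measurable_past_imp[OF f(1)] measurable_increment_M[OF square_integrable_past_adapted[OF p]]
        f(2) integrable_increment_sq[OF e p]] by simp
  show ?thesis
    using integral_past_fst[OF fm hm int] increment_mean[OF e] by simp
qed

text \<open>Given the past, \<open>?a\<close> is the conditional mean of \<open>?b\<close>, so the
  second moment of \<open>?a - ?b\<close> is that of \<open>?b\<close> minus that of
  \<open>?a\<close>. The factors 2 separate off the additive noise, whose correlation with the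
  multiplicative noise need not vanish.\<close>

lemma increment_sq:
  assumes e: "e \<in> E" and p: "square_integrable_past k p"
  shows "integrable M (\<lambda>\<omega>. (X (D (Suc k) \<omega>) \<bullet> p \<omega>)\<^sup>2 * (X (D (Suc k) \<omega>) \<bullet> e)\<^sup>2) \<and>
    (\<integral>\<omega>. (increment e (p \<omega>) (D (Suc k) \<omega>))\<^sup>2 \<partial>M)
     \<le> 2 * (\<integral>\<omega>. (X (D (Suc k) \<omega>) \<bullet> p \<omega>)\<^sup>2 * (X (D (Suc k) \<omega>) \<bullet> e)\<^sup>2 \<partial>M) + 2 * \<sigma>\<^sup>2 * \<mu> e"
proof -
  have [measurable]: "p \<in> borel_measurable M" "D (Suc k) \<in> borel_measurable M"
    using square_integrable_past_measurable[OF p] measurable_D[of "Suc k"] by auto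
  let ?x = "\<lambda>\<omega>. X (D (Suc k) \<omega>)"
  let ?a = "\<lambda>\<omega>. \<mu> e * (p \<omega> \<bullet> e)" and ?b = "\<lambda>\<omega>. (?x \<omega> \<bullet> p \<omega>) * (?x \<omega> \<bullet> e)"
    and ?c = "\<lambda>\<omega>. (\<epsilon> (D (Suc k) \<omega>))\<^sup>2 * (?x \<omega> \<bullet> e)\<^sup>2"
  have b2: "integrable M (\<lambda>\<omega>. (?b \<omega>)\<^sup>2)"
  proof (rule integrable_past_next[OF p, where h = "\<lambda>u d. ((X d \<bullet> u) * (X d \<bullet> e))\<^sup>2"])
    show "integrable M (\<lambda>\<omega>. (norm (X (Z \<omega>)))^4)"
      by (rule int_norm_X4)
    fix u d
    have CS: "(p \<bullet> q)\<^sup>2 \<le> (norm p)\<^sup>2 * (norm q)\<^sup>2" for p q :: 'a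
      using Cauchy_Schwarz_ineq[of p q] by (simp add: power2_norm_eq_inner)
    have "((X d \<bullet> u) * (X d \<bullet> e))\<^sup>2 \<le> ((norm (X d))\<^sup>2 * (norm u)\<^sup>2) * ((norm (X d))\<^sup>2 * (norm e)\<^sup>2)"
      unfolding power_mult_distrib by (intro mult_mono CS) auto
    also have "\<dots> = (norm u)\<^sup>2 * (norm (X d))^4"
      using norm_E[OF e] by (simp add: power2_eq_square power4_eq_xxxx)
    also have "\<dots> \<le> (1 + (norm u)\<^sup>2) * (norm (X d))^4"
      by (intro mult_right_mono) auto
    finally show "\<bar>((X d \<bullet> u) * (X d \<bullet> e))\<^sup>2\<bar> \<le> (1 + (norm u)\<^sup>2) * (norm (X d))^4"
      by simp
  qed measurable
  have a2: "integrable M (\<lambda>\<omega>. (?a \<omega>)\<^sup>2)"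
    using square_integrable_past_inner_sq[OF p, of e] by (simp add: power_mult_distrib)
  have c: "integrable M ?c"
    using integrable_D[of "Suc k" "\<lambda>d. (\<epsilon> d)\<^sup>2 * (X d \<bullet> e)\<^sup>2"] int_eps2_X2[of e] by simp
  have ab: "integrable M (\<lambda>\<omega>. ?a \<omega> * ?b \<omega>)"
    by (rule integrable_mult_of_squares[OF _ _ a2 b2]) measurable
  have "(\<integral>\<omega>. ?a \<omega> * ?b \<omega> \<partial>M)
      = (\<integral>\<omega>. (\<integral>\<omega>'. (\<mu> e * (p \<omega> \<bullet> e)) * ((X (Z \<omega>') \<bullet> p \<omega>) * (X (Z \<omega>') \<bullet> e)) \<partial>M) \<partial>M)"
    by (rule integral_past_fst[where h = "\<lambda>u d. (\<mu> e * (u \<bullet> e)) * ((X d \<bullet> u) * (X d \<bullet> e))", OF square_integrable_past_adapted[OF p] _ ab])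
       measurable
  also have "\<dots> = (\<integral>\<omega>. (?a \<omega>)\<^sup>2 \<partial>M)"
    using int_X_X by (simp add: covariance Sigma_basis[OF e] power2_eq_square)
  finally have ab_eq: "(\<integral>\<omega>. ?a \<omega> * ?b \<omega> \<partial>M) = (\<integral>\<omega>. (?a \<omega>)\<^sup>2 \<partial>M)" .
  have "(\<integral>\<omega>. (increment e (p \<omega>) (D (Suc k) \<omega>))\<^sup>2 \<partial>M)
      \<le> (\<integral>\<omega>. 2 * (?a \<omega>)\<^sup>2 - 4 * (?a \<omega> * ?b \<omega>) + 2 * (?b \<omega>)\<^sup>2 + 2 * ?c \<omega> \<partial>M)"
  proof (rule integral_mono[OF integrable_increment_sq[OF e p]])
    show "integrable M (\<lambda>\<omega>. 2 * (?a \<omega>)\<^sup>2 - 4 * (?a \<omega> * ?b \<omega>) + 2 * (?b \<omega>)\<^sup>2 + 2 * ?c \<omega>)"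
      by (intro Bochner_Integration.integrable_add Bochner_Integration.integrable_diff
          integrable_mult_right a2 ab b2 c)
    fix \<omega>
    have "(x - y + z)\<^sup>2 \<le> 2 * x\<^sup>2 - 4 * (x * y) + 2 * y\<^sup>2 + 2 * z\<^sup>2" for x y z :: real
      using zero_le_power2[of "x - y - z"] by (simp add: power2_eq_square algebra_simps)
    from this[of "?a \<omega>" "?b \<omega>" "\<epsilon> (D (Suc k) \<omega>) * (?x \<omega> \<bullet> e)"]
    show "(increment e (p \<omega>) (D (Suc k) \<omega>))\<^sup>2 \<le> 2 * (?a \<omega>)\<^sup>2 - 4 * (?a \<omega> * ?b \<omega>) + 2 * (?b \<omega>)\<^sup>2 + 2 * ?c \<omega>"
      unfolding increment_def by (simp only: power_mult_distrib[of "\<epsilon> (D (Suc k) \<omega>)"])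
  qed
  also have "\<dots> = 2 * (\<integral>\<omega>. (?a \<omega>)\<^sup>2 \<partial>M) - 4 * (\<integral>\<omega>. ?a \<omega> * ?b \<omega> \<partial>M) + 2 * (\<integral>\<omega>. (?b \<omega>)\<^sup>2 \<partial>M) + 2 * (\<integral>\<omega>. ?c \<omega> \<partial>M)"
    using a2 ab b2 c by (simp del: integral_mult_right_zero integral_mult_left_zero add: integral_mult_right)
  also have "\<dots> \<le> 2 * (\<integral>\<omega>. (?b \<omega>)\<^sup>2 \<partial>M) + 2 * (\<integral>\<omega>. ?c \<omega> \<partial>M)"
  proof -
    have "0 \<le> (\<integral>\<omega>. (?a \<omega>)\<^sup>2 \<partial>M)"
      by (intro integral_nonneg_AE) simp
    then show ?thesis
      unfolding ab_eq by linarith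
  qed
  also have "(\<integral>\<omega>. ?c \<omega> \<partial>M) = (\<integral>\<omega>. (\<epsilon> (Z \<omega>))\<^sup>2 * (X (Z \<omega>) \<bullet> e)\<^sup>2 \<partial>M)"
    by (rule integral_D) auto
  also have "\<dots> \<le> \<sigma>\<^sup>2 * \<mu> e"
    using eps_moment[of e] e by (simp add: Sigma_basis orthonormal)
  finally show ?thesis
    using b2 by (simp add: power_mult_distrib)
qed

text \<open>\<open>w\<close> will be \<open>weighted_sq\<close> or the squared norm of the input.
  Being at most quadratic in \<open>X d\<close>, it keeps the integrand within fourth moments. The
  \<open>fst\<close> order serves the energy estimate, the \<open>snd\<close> order the operator
  bounds.\<close>

lemma
  assumes p: "square_integrable_past k p"
    and w [measurable]: "w \<in> borel_measurable borel" and w_le: "\<And>d. 0 \<le> w d" "\<And>d. w d \<le> C * (norm (X d))\<^sup>2"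
  shows integrable_weighted_next: "integrable M (\<lambda>\<omega>. (X (D (Suc k) \<omega>) \<bullet> p \<omega>)\<^sup>2 * w (D (Suc k) \<omega>))"
    and integral_weighted_next_fst: "(\<integral>\<omega>. (X (D (Suc k) \<omega>) \<bullet> p \<omega>)\<^sup>2 * w (D (Suc k) \<omega>) \<partial>M)
      = (\<integral>\<omega>. (\<integral>\<omega>'. (X (Z \<omega>') \<bullet> p \<omega>)\<^sup>2 * w (Z \<omega>') \<partial>M) \<partial>M)"
    and integrable_weighted_next_fst: "integrable M (\<lambda>\<omega>. \<integral>\<omega>'. (X (Z \<omega>') \<bullet> p \<omega>)\<^sup>2 * w (Z \<omega>') \<partial>M)"
    and integral_weighted_next_snd: "(\<integral>\<omega>. (X (D (Suc k) \<omega>) \<bullet> p \<omega>)\<^sup>2 * w (D (Suc k) \<omega>) \<partial>M)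
      = (\<integral>\<omega>'. (\<integral>\<omega>. (p \<omega> \<bullet> X (Z \<omega>'))\<^sup>2 \<partial>M) * w (Z \<omega>') \<partial>M)"
    and integrable_weighted_next_snd: "integrable M (\<lambda>\<omega>'. (\<integral>\<omega>. (p \<omega> \<bullet> X (Z \<omega>'))\<^sup>2 \<partial>M) * w (Z \<omega>'))"
proof -
  let ?h = "\<lambda>u d. (X d \<bullet> u)\<^sup>2 * w d"
  have hm: "(\<lambda>(u, d). ?h u d) \<in> borel_measurable (borel \<Otimes>\<^sub>M borel)"
    by measurable
  show int: "integrable M (\<lambda>\<omega>. ?h (p \<omega>) (D (Suc k) \<omega>))"
  proof (rule integrable_past_next[OF p hm])
    show "integrable M (\<lambda>\<omega>. C * (norm (X (Z \<omega>)))^4)"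
      using int_norm_X4 by simp
    fix u d
    have "(X d \<bullet> u)\<^sup>2 \<le> (norm (X d))\<^sup>2 * (norm u)\<^sup>2"
      using Cauchy_Schwarz_ineq[of "X d" u] by (simp add: power2_norm_eq_inner)
    then have "(X d \<bullet> u)\<^sup>2 * w d \<le> ((norm (X d))\<^sup>2 * (norm u)\<^sup>2) * (C * (norm (X d))\<^sup>2)"
      using w_le by (intro mult_mono) auto
    also have "\<dots> = (norm u)\<^sup>2 * (C * (norm (X d))^4)"
      by (simp add: power2_eq_square power4_eq_xxxx)
    also have "\<dots> \<le> (1 + (norm u)\<^sup>2) * (C * (norm (X d))^4)"
    proof -
      have "0 \<le> C * (norm (X d))\<^sup>2 * (norm (X d))\<^sup>2"
        by (rule mult_nonneg_nonneg[OF order_trans[OF w_le] zero_le_power2])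
      then have "0 \<le> C * (norm (X d))^4"
        by (simp add: power2_eq_square power4_eq_xxxx mult_ac)
      then show ?thesis
        by (intro mult_right_mono) auto
    qed
    finally show "\<bar>(X d \<bullet> u)\<^sup>2 * w d\<bar> \<le> (1 + (norm u)\<^sup>2) * (C * (norm (X d))^4)"
      using w_le by simp
  qed measurable
  show "(\<integral>\<omega>. ?h (p \<omega>) (D (Suc k) \<omega>) \<partial>M) = (\<integral>\<omega>. (\<integral>\<omega>'. ?h (p \<omega>) (Z \<omega>') \<partial>M) \<partial>M)"
    by (rule integral_past_fst[OF square_integrable_past_adapted[OF p] hm int])
  show "integrable M (\<lambda>\<omega>. \<integral>\<omega>'. ?h (p \<omega>) (Z \<omega>') \<partial>M)"
    by (rule integrable_past_fst[OF square_integrable_past_adapted[OF p] hm int])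
  show "(\<integral>\<omega>. ?h (p \<omega>) (D (Suc k) \<omega>) \<partial>M) = (\<integral>\<omega>'. (\<integral>\<omega>. (p \<omega> \<bullet> X (Z \<omega>'))\<^sup>2 \<partial>M) * w (Z \<omega>') \<partial>M)"
    using integral_past_snd[OF square_integrable_past_adapted[OF p] hm int] by (simp add: inner_commute)
  show "integrable M (\<lambda>\<omega>'. (\<integral>\<omega>. (p \<omega> \<bullet> X (Z \<omega>'))\<^sup>2 \<partial>M) * w (Z \<omega>'))"
    using integrable_past_snd[OF square_integrable_past_adapted[OF p] hm int] by (simp add: inner_commute)
qed

lemma norm_weighted_next:
  assumes p: "square_integrable_past k p"
  shows "(\<integral>\<omega>. (X (D (Suc k) \<omega>) \<bullet> p \<omega>)\<^sup>2 * (norm (X (D (Suc k) \<omega>)))\<^sup>2 \<partial>M)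
    \<le> R\<^sup>2 * (\<integral>\<omega>. \<Sigma> (p \<omega>) \<bullet> p \<omega> \<partial>M)"
proof -
  have m: "(\<lambda>d. (norm (X d))\<^sup>2) \<in> borel_measurable borel"
    by measurable
  note wn = integral_weighted_next_fst[OF p m, of 1] integrable_weighted_next_fst[OF p m, of 1]
  have "(\<integral>\<omega>. (\<integral>\<omega>'. (X (Z \<omega>') \<bullet> p \<omega>)\<^sup>2 * (norm (X (Z \<omega>')))\<^sup>2 \<partial>M) \<partial>M) \<le> (\<integral>\<omega>. R\<^sup>2 * (\<Sigma> (p \<omega>) \<bullet> p \<omega>) \<partial>M)"
  proof (rule integral_mono[OF wn(2)])
    show "integrable M (\<lambda>\<omega>. R\<^sup>2 * (\<Sigma> (p \<omega>) \<bullet> p \<omega>))"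
      using integrable_Sigma_form[OF p] by simp
    show "(\<integral>\<omega>'. (X (Z \<omega>') \<bullet> p \<omega>)\<^sup>2 * (norm (X (Z \<omega>')))\<^sup>2 \<partial>M) \<le> R\<^sup>2 * (\<Sigma> (p \<omega>) \<bullet> p \<omega>)" for \<omega>
      using fourth_moment[of "p \<omega>"] by (simp add: mult.commute)
  qed auto
  then show ?thesis
    using wn(1) by simp
qed

lemma square_integrable_past_sgd_error: "square_integrable_past k (sgd_error h k)"
  by (rule square_integrable_past_process[OF noise_drift])

text \<open>Every increment carries a weight \<open>\<gamma> * \<rho> (n - Suc k)\<close>, at most
  \<open>1 / regularized_cov e\<close> for all \<open>k\<close>. Orthogonality then leaves a plain
  sum of second moments, and dependence of the increments on the error is not touched at this
  point.\<close>

lemma sum_sgd_error_coordinate: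
  assumes e: "e \<in> E"
  shows "integrable M (\<lambda>\<omega>. ((\<Sum>i\<le>n. sgd_error h i \<omega>) \<bullet> e)\<^sup>2) \<and>
    (\<integral>\<omega>. ((\<Sum>i\<le>n. sgd_error h i \<omega>) \<bullet> e)\<^sup>2 \<partial>M)
      \<le> ((1 / \<gamma> + lam * real n) / regularized_cov e)\<^sup>2 * (h \<bullet> e)\<^sup>2
        + (\<Sum>k<n. \<integral>\<omega>. (increment e (sgd_error h k \<omega>) (D (Suc k) \<omega>))\<^sup>2 \<partial>M) / (regularized_cov e)\<^sup>2"
proof -
  let ?W = "\<lambda>k \<omega>. increment e (sgd_error h k \<omega>) (D (Suc k) \<omega>)"
  define \<kappa> where "\<kappa> = regularized_cov e"
  define \<rho> where "\<rho> j = (\<Sum>i\<le>j. (1 - \<gamma> * \<kappa>) ^ i)" for j :: nat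
  \<comment> \<open>The total weight of \<open>h \<bullet> e\<close>, which enters once as the
    starting value and \<open>n\<close> times as the drift
    \<open>\<gamma> * lam * (h \<bullet> e)\<close>.\<close>
  define B where "B = \<rho> n + \<gamma> * lam * (\<Sum>k<n. \<rho> (n - Suc k))"
  define f where "f k \<omega> = \<gamma> * \<rho> (n - Suc k) * ?W k \<omega>" for k \<omega>
  note sip = square_integrable_past_sgd_error[of _ h]
  have \<kappa>: "\<kappa> > 0" "\<gamma> * \<kappa> \<le> 1"
    using regularized_cov_pos[OF e] gamma_regularized_cov_le[OF e] by (auto simp: \<kappa>_def)
  then have \<rho>_nonneg: "0 \<le> \<rho> j" and \<rho>_le': "\<gamma> * \<kappa> * \<rho> j \<le> 1" for j
    using geometric_sum_bounds[of "\<gamma> * \<kappa>" j] gamma_pos by (auto simp: \<rho>_def)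
  have \<rho>_le: "\<gamma> * \<rho> j \<le> 1 / \<kappa>" for j
    using \<rho>_le'[of j] \<kappa> by (simp add: field_simps)
  have sum_eq: "(\<Sum>i\<le>n. sgd_error h i \<omega>) \<bullet> e = B * (h \<bullet> e) + (\<Sum>k<n. f k \<omega>)" for \<omega>
  proof -
    have "(\<Sum>i\<le>n. sgd_error h i \<omega> \<bullet> e) = (\<rho> n * (sgd_error h 0 \<omega> \<bullet> e)
        + \<gamma> * lam * (h \<bullet> e) * (\<Sum>k<n. \<rho> (n - Suc k))) + (\<Sum>k<n. \<gamma> * \<rho> (n - Suc k) * ?W k \<omega>)"
      by (rule affine_recursion_sum[where a = "1 - \<gamma> * \<kappa>" and s = "\<lambda>i. sgd_error h i \<omega> \<bullet> e" and w = "\<lambda>k. ?W k \<omega>",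
            OF sgd_error_Suc_inner[OF e, folded \<kappa>_def]]) (simp add: \<rho>_def)
    then show ?thesis
      by (simp add: inner_sum_left B_def f_def algebra_simps)
  qed
  have B: "0 \<le> B" "B \<le> (1 / \<gamma> + lam * real n) / \<kappa>"
  proof -
    show "0 \<le> B"
      unfolding B_def using \<rho>_nonneg gamma_pos lam_nonneg
      by (intro add_nonneg_nonneg mult_nonneg_nonneg sum_nonneg) auto
    have "(\<Sum>k<n. \<gamma> * \<rho> (n - Suc k)) \<le> real (card {..<n}) * (1 / \<kappa>)"
      using \<rho>_le by (intro sum_bounded_above) auto
    then have "lam * (\<Sum>k<n. \<gamma> * \<rho> (n - Suc k)) \<le> lam * (real n * (1 / \<kappa>))"
      using lam_nonneg by (intro mult_left_mono) auto
    moreover have "\<rho> n \<le> 1 / \<gamma> / \<kappa>"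
      using \<rho>_le'[of n] gamma_pos \<kappa> by (simp add: field_simps)
    moreover have "B = \<rho> n + lam * (\<Sum>k<n. \<gamma> * \<rho> (n - Suc k))"
      by (simp add: B_def sum_distrib_left mult_ac)
    ultimately show "B \<le> (1 / \<gamma> + lam * real n) / \<kappa>"
      by (simp add: add_divide_distrib)
  qed
  have W2: "integrable M (\<lambda>\<omega>. (?W k \<omega>)\<^sup>2)" for k
    by (rule integrable_increment_sq[OF e sip])
  have fm: "f k \<in> borel_measurable (past l)" if "k < l" for k l
  proof -
    have [measurable]: "(\<lambda>\<omega>. ?W k \<omega>) \<in> borel_measurable (past l)"
      by (rule measurable_increment_past[OF square_integrable_past_adapted[OF sip] that])
    show ?thesis
      unfolding f_def[abs_def] by measurable
  qed
  have f2: "integrable M (\<lambda>\<omega>. (f k \<omega>)\<^sup>2)" for k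
    unfolding f_def power_mult_distrib using W2 by simp
  have W_orth: "(\<integral>\<omega>. g \<omega> * f k \<omega> \<partial>M) = 0"
    if "g \<in> borel_measurable (past k)" "integrable M (\<lambda>\<omega>. (g \<omega>)\<^sup>2)" for g k
  proof -
    have "(\<integral>\<omega>. g \<omega> * f k \<omega> \<partial>M) = \<gamma> * \<rho> (n - Suc k) * (\<integral>\<omega>. g \<omega> * ?W k \<omega> \<partial>M)"
      by (subst integral_mult_right_zero[symmetric]) (simp add: f_def mult_ac)
    then show ?thesis
      using increment_orthogonal_past[OF e sip that] by simp
  qed
  have "integrable M (\<lambda>\<omega>. (B * (h \<bullet> e) + (\<Sum>k<n. f k \<omega>))\<^sup>2) \<and>
    (\<integral>\<omega>. (B * (h \<bullet> e) + (\<Sum>k<n. f k \<omega>))\<^sup>2 \<partial>M) = (B * (h \<bullet> e))\<^sup>2 + (\<Sum>k<n. \<integral>\<omega>. (f k \<omega>)\<^sup>2 \<partial>M)"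
  proof (rule second_moment_orthogonal_sum)
    show "f k \<in> borel_measurable M" for k
      using measurable_past_imp[OF fm[OF lessI]] .
    show "integrable M (\<lambda>\<omega>. (f k \<omega>)\<^sup>2)" for k
      by (rule f2)
    show "(\<integral>\<omega>. f k \<omega> \<partial>M) = 0" for k
      using W_orth[of "\<lambda>_. 1" k] by simp
    show "(\<integral>\<omega>. f j \<omega> * f k \<omega> \<partial>M) = 0" if "j < k" for j k
      by (rule W_orth[OF fm[OF that] f2])
  qed
  moreover have "(B * (h \<bullet> e))\<^sup>2 \<le> ((1 / \<gamma> + lam * real n) / \<kappa>)\<^sup>2 * (h \<bullet> e)\<^sup>2"
    unfolding power_mult_distrib using B by (intro mult_right_mono power_mono) auto
  moreover have "(\<Sum>k<n. \<integral>\<omega>. (f k \<omega>)\<^sup>2 \<partial>M) \<le> (\<Sum>k<n. \<integral>\<omega>. (?W k \<omega>)\<^sup>2 \<partial>M) / \<kappa>\<^sup>2"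
    unfolding sum_divide_distrib
  proof (rule sum_mono)
    fix k
    have "(\<integral>\<omega>. (f k \<omega>)\<^sup>2 \<partial>M) = (\<gamma> * \<rho> (n - Suc k))\<^sup>2 * (\<integral>\<omega>. (?W k \<omega>)\<^sup>2 \<partial>M)"
      unfolding f_def power_mult_distrib[of _ "?W k _"] by simp
    also have "\<dots> \<le> (1 / \<kappa>)\<^sup>2 * (\<integral>\<omega>. (?W k \<omega>)\<^sup>2 \<partial>M)"
      using \<rho>_le \<rho>_nonneg gamma_pos by (intro mult_right_mono power_mono integral_nonneg_AE) auto
    finally show "(\<integral>\<omega>. (f k \<omega>)\<^sup>2 \<partial>M) \<le> (\<integral>\<omega>. (?W k \<omega>)\<^sup>2 \<partial>M) / \<kappa>\<^sup>2"
      by (simp add: power_divide)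
  qed
  ultimately show ?thesis
    unfolding sum_eq \<kappa>_def by linarith
qed

section \<open>The operator Q that weights the increments\<close>

definition weight :: "'a \<Rightarrow> real" where
  "weight e = \<mu> e / (regularized_cov e)\<^sup>2"

text \<open>The form \<open>x \<bullet> Q x\<close> at \<open>x = X d\<close>. The eigenvalue
  \<open>weight e\<close> of Q has its numerator from measuring the error by \<Sigma>, and its
  denominator from the squared bound on the weights of the increments.\<close>

definition weighted_sq :: "'d \<Rightarrow> real" where
  "weighted_sq d = (\<Sum>e\<in>E. weight e * (X d \<bullet> e)\<^sup>2)"

lemma weight_nonneg: "e \<in> E \<Longrightarrow> 0 \<le> weight e"
  using mu_pos[of e] by (simp add: weight_def)

lemma lam_weight_le: "e \<in> E \<Longrightarrow> lam * weight e \<le> 1"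
proof -
  assume e: "e \<in> E"
  have "lam * \<mu> e \<le> regularized_cov e * regularized_cov e"
    unfolding regularized_cov_def using mu_pos[OF e] lam_nonneg by (intro mult_mono) auto
  then show ?thesis
    using regularized_cov_pos[OF e] by (simp add: weight_def power2_eq_square field_simps)
qed

lemma measurable_weighted_sq [measurable]: "weighted_sq \<in> borel_measurable borel"
  unfolding weighted_sq_def[abs_def] by measurable

lemma weighted_sq_nonneg: "0 \<le> weighted_sq d"
  unfolding weighted_sq_def using weight_nonneg by (intro sum_nonneg) auto

lemma weighted_sq_le: "weighted_sq d \<le> sum weight E * (norm (X d))\<^sup>2"
  unfolding weighted_sq_def sum_distrib_right
proof (intro sum_mono mult_left_mono weight_nonneg)
  fix e assume "e \<in> E"
  then show "(X d \<bullet> e)\<^sup>2 \<le> (norm (X d))\<^sup>2"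
    using Cauchy_Schwarz_ineq[of "X d" e] by (simp add: power2_norm_eq_inner orthonormal)
qed

lemma lam_weighted_sq_le: "lam * weighted_sq d \<le> (norm (X d))\<^sup>2"
proof -
  have "lam * weighted_sq d = (\<Sum>e\<in>E. lam * weight e * (X d \<bullet> e)\<^sup>2)"
    by (simp add: weighted_sq_def sum_distrib_left mult.assoc)
  also have "\<dots> \<le> (\<Sum>e\<in>E. 1 * (X d \<bullet> e)\<^sup>2)"
    using lam_weight_le by (intro sum_mono mult_right_mono) auto
  finally show ?thesis
    by (simp add: norm_sq_expansion)
qed

text \<open>The point where operator bounds become traces: a second-moment bound \<open>c I\<close>
  on a part of the error yields \<open>c\<close> times the left side here, and the sum on the right
  is the trace of \<open>\<Sigma>^2 (\<Sigma> + lam I)^-2\<close>.\<close>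

lemma
  shows int_weighted_sq_norm: "integrable M (\<lambda>\<omega>. (norm (X (Z \<omega>)))\<^sup>2 * weighted_sq (Z \<omega>))"
    and weighted_sq_norm: "(\<integral>\<omega>. (norm (X (Z \<omega>)))\<^sup>2 * weighted_sq (Z \<omega>) \<partial>M) \<le> R\<^sup>2 * (\<Sum>e\<in>E. weight e * \<mu> e)"
proof -
  have eq: "(norm (X d))\<^sup>2 * weighted_sq d = (\<Sum>e\<in>E. weight e * ((norm (X d))\<^sup>2 * (X d \<bullet> e)\<^sup>2))" for d
    by (simp add: weighted_sq_def sum_distrib_left mult_ac)
  show "integrable M (\<lambda>\<omega>. (norm (X (Z \<omega>)))\<^sup>2 * weighted_sq (Z \<omega>))"
    unfolding eq using int_X2_X2 by simp
  have "(\<integral>\<omega>. (norm (X (Z \<omega>)))\<^sup>2 * weighted_sq (Z \<omega>) \<partial>M)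
      = (\<Sum>e\<in>E. weight e * (\<integral>\<omega>. (norm (X (Z \<omega>)))\<^sup>2 * (X (Z \<omega>) \<bullet> e)\<^sup>2 \<partial>M))"
    unfolding eq using int_X2_X2 by (simp add: Bochner_Integration.integral_sum)
  also have "\<dots> \<le> (\<Sum>e\<in>E. weight e * (R\<^sup>2 * \<mu> e))"
  proof (intro sum_mono mult_left_mono weight_nonneg)
    fix e assume "e \<in> E"
    then show "(\<integral>\<omega>. (norm (X (Z \<omega>)))\<^sup>2 * (X (Z \<omega>) \<bullet> e)\<^sup>2 \<partial>M) \<le> R\<^sup>2 * \<mu> e"
      using fourth_moment[of e] by (simp add: Sigma_basis orthonormal)
  qed
  finally show "(\<integral>\<omega>. (norm (X (Z \<omega>)))\<^sup>2 * weighted_sq (Z \<omega>) \<partial>M) \<le> R\<^sup>2 * (\<Sum>e\<in>E. weight e * \<mu> e)"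
    by (simp add: sum_distrib_left mult_ac)
qed

lemma weighted_increment_sq:
  assumes p: "square_integrable_past k p"
  shows "(\<Sum>e\<in>E. weight e * (\<integral>\<omega>. (increment e (p \<omega>) (D (Suc k) \<omega>))\<^sup>2 \<partial>M))
    \<le> 2 * (\<integral>\<omega>. (X (D (Suc k) \<omega>) \<bullet> p \<omega>)\<^sup>2 * weighted_sq (D (Suc k) \<omega>) \<partial>M) + 2 * \<sigma>\<^sup>2 * (\<Sum>e\<in>E. weight e * \<mu> e)"
proof -
  let ?I = "\<lambda>e. \<integral>\<omega>. (X (D (Suc k) \<omega>) \<bullet> p \<omega>)\<^sup>2 * (X (D (Suc k) \<omega>) \<bullet> e)\<^sup>2 \<partial>M"
  have "(\<Sum>e\<in>E. weight e * (\<integral>\<omega>. (increment e (p \<omega>) (D (Suc k) \<omega>))\<^sup>2 \<partial>M))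
      \<le> (\<Sum>e\<in>E. weight e * (2 * ?I e + 2 * \<sigma>\<^sup>2 * \<mu> e))"
    using increment_sq[OF _ p] weight_nonneg by (intro sum_mono mult_left_mono) auto
  also have "\<dots> = 2 * (\<Sum>e\<in>E. weight e * ?I e) + 2 * \<sigma>\<^sup>2 * (\<Sum>e\<in>E. weight e * \<mu> e)"
    by (simp add: distrib_left sum.distrib sum_distrib_left mult_ac)
  also have "(\<Sum>e\<in>E. weight e * ?I e)
      = (\<integral>\<omega>. (\<Sum>e\<in>E. weight e * ((X (D (Suc k) \<omega>) \<bullet> p \<omega>)\<^sup>2 * (X (D (Suc k) \<omega>) \<bullet> e)\<^sup>2)) \<partial>M)"
    using increment_sq[OF _ p] by (subst Bochner_Integration.integral_sum) auto
  also have "\<dots> = (\<integral>\<omega>. (X (D (Suc k) \<omega>) \<bullet> p \<omega>)\<^sup>2 * weighted_sq (D (Suc k) \<omega>) \<partial>M)"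
    by (simp add: weighted_sq_def sum_distrib_left mult_ac)
  finally show ?thesis .
qed

text \<open>Each of the four parts of the error is bounded by its own method, and the square of
  their sum costs the factor 4. The 6 is 4 from the constant part plus 2 from the multiplicative
  part, whose energy estimate gains \<open>\<gamma> * R\<^sup>2 \<le> 1 / 2\<close>.\<close>

lemma sum_weighted_sgd_error:
  fixes h :: 'a
  defines "S \<equiv> (\<Sum>e\<in>E. weight e * (h \<bullet> e)\<^sup>2)"
    and "T \<equiv> (\<Sum>e\<in>E. weight e * \<mu> e)"
    and "c \<equiv> (\<Sum>e\<in>E. (h \<bullet> e)\<^sup>2 / regularized_cov e)"
  shows "(\<Sum>k<n. \<integral>\<omega>. (X (D (Suc k) \<omega>) \<bullet> sgd_error h k \<omega>)\<^sup>2 * weighted_sq (D (Suc k) \<omega>) \<partial>M)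
    \<le> 6 * lam * real n * R\<^sup>2 * S + 4 * (c / \<gamma>) * R\<^sup>2 * T + 4 * real n * (\<gamma> * \<sigma>\<^sup>2) * R\<^sup>2 * T"
proof -
  define m where "m = diag_op E (\<lambda>e. 1 / regularized_cov e) h"
  define bias where "bias = process (h - lam *\<^sub>R m) (\<lambda>_. 0)"
  define additive where "additive = process 0 (\<lambda>d. \<epsilon> d *\<^sub>R X d)"
  define mult where "mult = process 0 (mult_noise m)"
  have m_e: "m \<bullet> e = (h \<bullet> e) / regularized_cov e" if "e \<in> E" for e
    using that by (simp add: m_def diag_op_inner)
  have fixed: "\<Sigma> m + lam *\<^sub>R m = h"
  proof (rule eq_by_coordinates)
    fix e assume e: "e \<in> E"
    have "(\<Sigma> m + lam *\<^sub>R m) \<bullet> e = regularized_cov e * (m \<bullet> e)"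
      by (simp add: inner_add_left Sigma_basis[OF e] regularized_cov_def distrib_right)
    then show "(\<Sigma> m + lam *\<^sub>R m) \<bullet> e = h \<bullet> e"
      using regularized_cov_pos[OF e] m_e[OF e] by simp
  qed
  have S: "\<Sigma> m \<bullet> m = S"
    unfolding Sigma_diag quadratic_form_diag_op S_def
    by (intro sum.cong) (auto simp: m_e weight_def power_divide)
  have c_nonneg: "c \<ge> 0"
    unfolding c_def using regularized_cov_pos by (intro sum_nonneg) (auto intro!: divide_nonneg_pos)
  have T_nonneg: "T \<ge> 0"
    unfolding T_def using weight_nonneg mu_pos by (intro sum_nonneg mult_nonneg_nonneg) (auto simp: less_imp_le)
  have sip_m: "square_integrable_past k (\<lambda>_. m)" for k
    by (simp add: square_integrable_past_def)
  have sip_b: "square_integrable_past k (bias k)" for k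
    unfolding bias_def by (rule square_integrable_past_process) (simp add: noise_def)
  have sip_a: "square_integrable_past k (additive k)" for k
    unfolding additive_def using centred_noise_eps
    by (intro square_integrable_past_process) (simp add: centred_noise_def)
  have sip_z: "square_integrable_past k (mult k)" for k
    unfolding mult_def using centred_noise_mult
    by (intro square_integrable_past_process) (simp add: centred_noise_def)
  have sip_\<eta>: "square_integrable_past k (sgd_error h k)" for k
    by (rule square_integrable_past_sgd_error)
  have mn: "(\<lambda>d. (norm (X d))\<^sup>2) \<in> borel_measurable borel"
    by measurable
  note intQ = integrable_weighted_next[OF _ measurable_weighted_sq weighted_sq_nonneg weighted_sq_le]
  note sndQ = integral_weighted_next_snd[OF _ measurable_weighted_sq weighted_sq_nonneg weighted_sq_le]
  note int_sndQ = integrable_weighted_next_snd[OF _ measurable_weighted_sq weighted_sq_nonneg weighted_sq_le]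
  have intN: "integrable M (\<lambda>\<omega>. (X (D (Suc k) \<omega>) \<bullet> p \<omega>)\<^sup>2 * (norm (X (D (Suc k) \<omega>)))\<^sup>2)"
    if "square_integrable_past k p" for k p
    by (rule integrable_weighted_next[OF that mn, of 1]) auto
  let ?Q = "\<lambda>k p. \<integral>\<omega>. (X (D (Suc k) \<omega>) \<bullet> p \<omega>)\<^sup>2 * weighted_sq (D (Suc k) \<omega>) \<partial>M"
  let ?N = "\<lambda>k p. \<integral>\<omega>. (X (D (Suc k) \<omega>) \<bullet> p \<omega>)\<^sup>2 * (norm (X (D (Suc k) \<omega>)))\<^sup>2 \<partial>M"
  \<comment> \<open>In the two parts with a factor \<open>lam\<close>, one \<open>lam\<close> of its
    square is used up to replace \<open>weighted_sq\<close> by the squared norm; the other remains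
    in front.\<close>
  have split: "?Q k (sgd_error h k) \<le> 4 * lam * ?N k (\<lambda>_. m) + 4 * ?Q k (bias k) + 4 * ?Q k (additive k)
      + 4 * lam * ?N k (mult k)" for k
  proof -
    let ?d = "\<lambda>\<omega>. D (Suc k) \<omega>"
    have "?Q k (sgd_error h k) \<le> (\<integral>\<omega>. 4 * lam * ((X (?d \<omega>) \<bullet> m)\<^sup>2 * (norm (X (?d \<omega>)))\<^sup>2)
        + 4 * ((X (?d \<omega>) \<bullet> bias k \<omega>)\<^sup>2 * weighted_sq (?d \<omega>))
        + 4 * ((X (?d \<omega>) \<bullet> additive k \<omega>)\<^sup>2 * weighted_sq (?d \<omega>))
        + 4 * lam * ((X (?d \<omega>) \<bullet> mult k \<omega>)\<^sup>2 * (norm (X (?d \<omega>)))\<^sup>2) \<partial>M)"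
    proof (rule integral_mono[OF intQ[OF sip_\<eta>]])
      show "integrable M (\<lambda>\<omega>. 4 * lam * ((X (?d \<omega>) \<bullet> m)\<^sup>2 * (norm (X (?d \<omega>)))\<^sup>2)
        + 4 * ((X (?d \<omega>) \<bullet> bias k \<omega>)\<^sup>2 * weighted_sq (?d \<omega>))
        + 4 * ((X (?d \<omega>) \<bullet> additive k \<omega>)\<^sup>2 * weighted_sq (?d \<omega>))
        + 4 * lam * ((X (?d \<omega>) \<bullet> mult k \<omega>)\<^sup>2 * (norm (X (?d \<omega>)))\<^sup>2))"
        by (intro Bochner_Integration.integrable_add integrable_mult_right intQ intN sip_m sip_b sip_a sip_z)
      fix \<omega>
      define x where "x = X (?d \<omega>)"
      define q where "q = weighted_sq (?d \<omega>)"
      have q: "0 \<le> q" "lam * q \<le> (norm x)\<^sup>2"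
        unfolding q_def x_def by (rule weighted_sq_nonneg, rule lam_weighted_sq_le)
      have lq: "(lam * t)\<^sup>2 * q \<le> lam * (t\<^sup>2 * (norm x)\<^sup>2)" for t
      proof -
        have "lam * t\<^sup>2 * (lam * q) \<le> lam * t\<^sup>2 * (norm x)\<^sup>2"
          using q lam_nonneg by (intro mult_left_mono) auto
        then show ?thesis
          by (simp add: power_mult_distrib power2_eq_square mult_ac)
      qed
      have "(x \<bullet> sgd_error h k \<omega>)\<^sup>2
          = (lam * (x \<bullet> m) + x \<bullet> bias k \<omega> + x \<bullet> additive k \<omega> + lam * (x \<bullet> mult k \<omega>))\<^sup>2"
        unfolding sgd_error_decomposition[OF fixed] bias_def additive_def mult_def by (simp add: inner_add_right)
      also have "\<dots> \<le> 4 * ((lam * (x \<bullet> m))\<^sup>2 + (x \<bullet> bias k \<omega>)\<^sup>2 + (x \<bullet> additive k \<omega>)\<^sup>2 + (lam * (x \<bullet> mult k \<omega>))\<^sup>2)"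
        by (rule sum_square_le_4)
      finally have "(x \<bullet> sgd_error h k \<omega>)\<^sup>2 * q
          \<le> 4 * ((lam * (x \<bullet> m))\<^sup>2 + (x \<bullet> bias k \<omega>)\<^sup>2 + (x \<bullet> additive k \<omega>)\<^sup>2 + (lam * (x \<bullet> mult k \<omega>))\<^sup>2) * q"
        using q(1) by (rule mult_right_mono)
      also have "\<dots> = 4 * ((lam * (x \<bullet> m))\<^sup>2 * q) + 4 * ((x \<bullet> bias k \<omega>)\<^sup>2 * q)
          + 4 * ((x \<bullet> additive k \<omega>)\<^sup>2 * q) + 4 * ((lam * (x \<bullet> mult k \<omega>))\<^sup>2 * q)"
        by (simp add: algebra_simps)
      also have "\<dots> \<le> 4 * lam * ((x \<bullet> m)\<^sup>2 * (norm x)\<^sup>2) + 4 * ((x \<bullet> bias k \<omega>)\<^sup>2 * q)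
          + 4 * ((x \<bullet> additive k \<omega>)\<^sup>2 * q) + 4 * lam * ((x \<bullet> mult k \<omega>)\<^sup>2 * (norm x)\<^sup>2)"
        using lq[of "x \<bullet> m"] lq[of "x \<bullet> mult k \<omega>"] by linarith
      finally show "(X (?d \<omega>) \<bullet> sgd_error h k \<omega>)\<^sup>2 * weighted_sq (?d \<omega>)
        \<le> 4 * lam * ((X (?d \<omega>) \<bullet> m)\<^sup>2 * (norm (X (?d \<omega>)))\<^sup>2)
        + 4 * ((X (?d \<omega>) \<bullet> bias k \<omega>)\<^sup>2 * weighted_sq (?d \<omega>))
        + 4 * ((X (?d \<omega>) \<bullet> additive k \<omega>)\<^sup>2 * weighted_sq (?d \<omega>))
        + 4 * lam * ((X (?d \<omega>) \<bullet> mult k \<omega>)\<^sup>2 * (norm (X (?d \<omega>)))\<^sup>2)"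
        unfolding x_def q_def .
    qed
    also have "\<dots> = 4 * lam * ?N k (\<lambda>_. m) + 4 * ?Q k (bias k) + 4 * ?Q k (additive k) + 4 * lam * ?N k (mult k)"
      using intN[OF sip_m, of k] intQ[OF sip_b, of k] intQ[OF sip_a, of k] intN[OF sip_z, of k] by simp
    finally show ?thesis .
  qed
  have N_m: "?N k (\<lambda>_. m) \<le> R\<^sup>2 * S" for k
    using norm_weighted_next[OF sip_m, of k] by (simp add: S prob_space)
  \<comment> \<open>The final energy is dropped, and \<open>norm_weighted_next\<close> converts the
    summed \<Sigma>-energies into the weighted moments at the price of
    \<open>R\<^sup>2\<close>.\<close>
  have N_z: "(\<Sum>k<n. ?N k (mult k)) \<le> real n / 2 * (R\<^sup>2 * S)"
  proof -
    have "0 \<le> (\<integral>\<omega>. (norm (mult n \<omega>))\<^sup>2 \<partial>M)"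
      by (intro integral_nonneg_AE) simp
    then have "\<gamma> * (\<Sum>k<n. \<integral>\<omega>. \<Sigma> (mult k \<omega>) \<bullet> mult k \<omega> \<partial>M) \<le> real n * (\<gamma>\<^sup>2 * (R\<^sup>2 * S))"
      using energy_process[OF centred_noise_mult norm_noise_mult, of m n]
      unfolding mult_def[symmetric] S by linarith
    then have *: "(\<Sum>k<n. \<integral>\<omega>. \<Sigma> (mult k \<omega>) \<bullet> mult k \<omega> \<partial>M) \<le> real n * (\<gamma> * R\<^sup>2 * S)"
      using gamma_pos by (simp add: power2_eq_square mult_ac)
    have "(\<Sum>k<n. ?N k (mult k)) \<le> (\<Sum>k<n. R\<^sup>2 * (\<integral>\<omega>. \<Sigma> (mult k \<omega>) \<bullet> mult k \<omega> \<partial>M))"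
      by (intro sum_mono norm_weighted_next sip_z)
    also have "\<dots> \<le> R\<^sup>2 * (real n * (\<gamma> * R\<^sup>2 * S))"
      using * by (simp add: sum_distrib_left[symmetric] mult_left_mono)
    also have "\<dots> \<le> R\<^sup>2 * (real n * (1 / 2 * S))"
      using gamma_R Sigma_nonneg[of m] unfolding S by (intro mult_left_mono mult_right_mono) auto
    finally show ?thesis
      by (simp add: mult_ac)
  qed
  have Q_b: "(\<Sum>k<n. ?Q k (bias k)) \<le> c / \<gamma> * (R\<^sup>2 * T)"
  proof -
    \<comment> \<open>The starting point is \<open>\<Sigma> (\<Sigma> + lam I)^-1 h\<close>.
      Cauchy-Schwarz with weights \<open>regularized_cov e\<close> gives the form of
      \<open>\<Sigma> + lam I\<close> at \<open>v\<close> as one factor; the other is at most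
      \<open>c\<close> because \<open>\<mu> e / regularized_cov e \<le> 1\<close>.\<close>
    have p: "((h - lam *\<^sub>R m) \<bullet> v)\<^sup>2 \<le> c * (\<Sigma> v \<bullet> v + lam * (norm v)\<^sup>2)" for v
    proof -
      have "(h - lam *\<^sub>R m) \<bullet> v = (\<Sum>e\<in>E. ((h - lam *\<^sub>R m) \<bullet> e) * (v \<bullet> e))"
        by (rule inner_expansion)
      also have "\<dots> = (\<Sum>e\<in>E. (\<mu> e / regularized_cov e * (h \<bullet> e) / sqrt (regularized_cov e)) * (sqrt (regularized_cov e) * (v \<bullet> e)))"
      proof (intro sum.cong refl)
        fix e assume e: "e \<in> E"
        have "(h - lam *\<^sub>R m) \<bullet> e = \<mu> e / regularized_cov e * (h \<bullet> e)"
          using regularized_cov_pos[OF e] m_e[OF e]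
          by (simp add: inner_diff_left field_simps) (simp add: regularized_cov_def algebra_simps)
        then show "((h - lam *\<^sub>R m) \<bullet> e) * (v \<bullet> e)
            = (\<mu> e / regularized_cov e * (h \<bullet> e) / sqrt (regularized_cov e)) * (sqrt (regularized_cov e) * (v \<bullet> e))"
          using regularized_cov_pos[OF e] by simp
      qed
      finally have "((h - lam *\<^sub>R m) \<bullet> v)\<^sup>2 \<le> (\<Sum>e\<in>E. (\<mu> e / regularized_cov e * (h \<bullet> e) / sqrt (regularized_cov e))\<^sup>2)
          * (\<Sum>e\<in>E. (sqrt (regularized_cov e) * (v \<bullet> e))\<^sup>2)"
        using Cauchy_Schwarz_ineq_sum by metis
      also have "\<dots> \<le> c * (\<Sum>e\<in>E. (sqrt (regularized_cov e) * (v \<bullet> e))\<^sup>2)"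
        unfolding c_def
      proof (intro mult_right_mono sum_mono sum_nonneg)
        fix e assume e: "e \<in> E"
        have "(\<mu> e / regularized_cov e)\<^sup>2 \<le> 1"
          using regularized_cov_pos[OF e] mu_pos[OF e] lam_nonneg
          by (intro power_le_one) (auto simp: regularized_cov_def)
        then have "(\<mu> e / regularized_cov e)\<^sup>2 * ((h \<bullet> e)\<^sup>2 / regularized_cov e) \<le> 1 * ((h \<bullet> e)\<^sup>2 / regularized_cov e)"
          using regularized_cov_pos[OF e] by (intro mult_right_mono) auto
        then show "(\<mu> e / regularized_cov e * (h \<bullet> e) / sqrt (regularized_cov e))\<^sup>2 \<le> (h \<bullet> e)\<^sup>2 / regularized_cov e"
          using regularized_cov_pos[OF e] by (simp add: power_mult_distrib power_divide)
      qed auto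
      also have "(\<Sum>e\<in>E. (sqrt (regularized_cov e) * (v \<bullet> e))\<^sup>2) = \<Sigma> v \<bullet> v + lam * (norm v)\<^sup>2"
      proof -
        have "(\<Sum>e\<in>E. (sqrt (regularized_cov e) * (v \<bullet> e))\<^sup>2) = (\<Sum>e\<in>E. \<mu> e * (v \<bullet> e)\<^sup>2 + lam * (v \<bullet> e)\<^sup>2)"
          using regularized_cov_pos
          by (intro sum.cong) (auto simp: power_mult_distrib less_imp_le regularized_cov_def algebra_simps)
        then show ?thesis
          by (simp add: Sigma_diag quadratic_form_diag_op norm_sq_expansion sum.distrib sum_distrib_left)
      qed
      finally show ?thesis .
    qed
    \<comment> \<open>The common law lets all times share one frozen observation; the sum over time
      then meets \<open>sum_bias_process\<close> at the test vector
      \<open>X (Z \<omega>')\<close>.\<close>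
    have "(\<Sum>k<n. ?Q k (bias k))
        = (\<integral>\<omega>'. (\<Sum>k<n. \<integral>\<omega>. (bias k \<omega> \<bullet> X (Z \<omega>'))\<^sup>2 \<partial>M) * weighted_sq (Z \<omega>') \<partial>M)"
      unfolding sum_distrib_right using int_sndQ[OF sip_b] sndQ[OF sip_b]
      by (subst Bochner_Integration.integral_sum) auto
    also have "\<dots> \<le> (\<integral>\<omega>'. c / \<gamma> * ((norm (X (Z \<omega>')))\<^sup>2 * weighted_sq (Z \<omega>')) \<partial>M)"
    proof (rule integral_mono)
      show "integrable M (\<lambda>\<omega>'. (\<Sum>k<n. \<integral>\<omega>. (bias k \<omega> \<bullet> X (Z \<omega>'))\<^sup>2 \<partial>M) * weighted_sq (Z \<omega>'))"
        unfolding sum_distrib_right using int_sndQ[OF sip_b] by auto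
      show "integrable M (\<lambda>\<omega>'. c / \<gamma> * ((norm (X (Z \<omega>')))\<^sup>2 * weighted_sq (Z \<omega>')))"
        using int_weighted_sq_norm by simp
      show "(\<Sum>k<n. \<integral>\<omega>. (bias k \<omega> \<bullet> X (Z \<omega>'))\<^sup>2 \<partial>M) * weighted_sq (Z \<omega>')
          \<le> c / \<gamma> * ((norm (X (Z \<omega>')))\<^sup>2 * weighted_sq (Z \<omega>'))" for \<omega>'
        using mult_right_mono[OF sum_bias_process[OF c_nonneg p, where v = "X (Z \<omega>')"] weighted_sq_nonneg]
        unfolding bias_def mult.assoc .
    qed
    also have "\<dots> \<le> c / \<gamma> * (R\<^sup>2 * T)"
      using weighted_sq_norm c_nonneg gamma_pos unfolding T_def integral_mult_right_zero
      by (intro mult_left_mono) auto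
    finally show ?thesis .
  qed
  have Q_a: "?Q k (additive k) \<le> \<gamma> * \<sigma>\<^sup>2 * (R\<^sup>2 * T)" for k
  proof -
    have eps: "(\<integral>\<omega>. ((\<epsilon> (Z \<omega>) *\<^sub>R X (Z \<omega>)) \<bullet> v)\<^sup>2 \<partial>M) \<le> \<sigma>\<^sup>2 * (\<Sigma> v \<bullet> v)" for v
      using eps_moment[of v] by (simp add: power_mult_distrib)
    have "?Q k (additive k) \<le> (\<integral>\<omega>'. \<gamma> * \<sigma>\<^sup>2 * ((norm (X (Z \<omega>')))\<^sup>2 * weighted_sq (Z \<omega>')) \<partial>M)"
      unfolding sndQ[OF sip_a]
    proof (rule integral_mono[OF int_sndQ[OF sip_a]])
      show "integrable M (\<lambda>\<omega>'. \<gamma> * \<sigma>\<^sup>2 * ((norm (X (Z \<omega>')))\<^sup>2 * weighted_sq (Z \<omega>')))"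
        using int_weighted_sq_norm by simp
      show "(\<integral>\<omega>. (additive k \<omega> \<bullet> X (Z \<omega>'))\<^sup>2 \<partial>M) * weighted_sq (Z \<omega>')
          \<le> \<gamma> * \<sigma>\<^sup>2 * ((norm (X (Z \<omega>')))\<^sup>2 * weighted_sq (Z \<omega>'))" for \<omega>'
        using mult_right_mono[OF noise_process[OF centred_noise_eps eps, where v = "X (Z \<omega>')"] weighted_sq_nonneg]
        unfolding additive_def mult.assoc .
    qed
    also have "\<dots> \<le> \<gamma> * \<sigma>\<^sup>2 * (R\<^sup>2 * T)"
      using weighted_sq_norm gamma_pos unfolding T_def integral_mult_right_zero
      by (intro mult_left_mono) auto
    finally show ?thesis .
  qed
  have "(\<Sum>k<n. ?Q k (sgd_error h k)) \<le> (\<Sum>k<n. 4 * lam * (R\<^sup>2 * S) + 4 * ?Q k (bias k) + 4 * (\<gamma> * \<sigma>\<^sup>2 * (R\<^sup>2 * T)) + 4 * lam * ?N k (mult k))"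
    using split Q_a N_m lam_nonneg by (intro sum_mono order_trans[OF split] add_mono mult_left_mono order_refl) auto
  also have "\<dots> = real n * (4 * lam * (R\<^sup>2 * S)) + 4 * (\<Sum>k<n. ?Q k (bias k)) + real n * (4 * (\<gamma> * \<sigma>\<^sup>2 * (R\<^sup>2 * T)))
      + 4 * lam * (\<Sum>k<n. ?N k (mult k))"
    by (simp add: sum.distrib sum_distrib_left)
  also have "\<dots> \<le> real n * (4 * lam * (R\<^sup>2 * S)) + 4 * (c / \<gamma> * (R\<^sup>2 * T)) + real n * (4 * (\<gamma> * \<sigma>\<^sup>2 * (R\<^sup>2 * T)))
      + 4 * lam * (real n / 2 * (R\<^sup>2 * S))"
    using Q_b N_z lam_nonneg by (intro add_mono mult_left_mono order_refl) auto
  finally show ?thesis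
    by (simp add: mult_ac algebra_simps)
qed

text \<open>The \<Sigma>-form is the sum of the coordinate bounds with factors
  \<open>\<mu> e\<close>. Doubling in \<open>increment_sq\<close> turns 6 and 4 into 12 and 8; the
  last term is the additive noise entering the increments directly.\<close>

lemma sum_sgd_error_bound:
  fixes h :: 'a
  defines "S \<equiv> (\<Sum>e\<in>E. weight e * (h \<bullet> e)\<^sup>2)"
    and "T \<equiv> (\<Sum>e\<in>E. weight e * \<mu> e)"
    and "c \<equiv> (\<Sum>e\<in>E. (h \<bullet> e)\<^sup>2 / regularized_cov e)"
  shows "integrable M (\<lambda>\<omega>. \<Sigma> (\<Sum>i\<le>n. sgd_error h i \<omega>) \<bullet> (\<Sum>i\<le>n. sgd_error h i \<omega>)) \<and>
    (\<integral>\<omega>. \<Sigma> (\<Sum>i\<le>n. sgd_error h i \<omega>) \<bullet> (\<Sum>i\<le>n. sgd_error h i \<omega>) \<partial>M)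
      \<le> ((1 / \<gamma> + lam * real n)\<^sup>2 + 12 * lam * real n * R\<^sup>2) * S
        + (8 * (c / \<gamma>) * R\<^sup>2 + 8 * real n * (\<gamma> * \<sigma>\<^sup>2) * R\<^sup>2 + 2 * real n * \<sigma>\<^sup>2) * T"
proof
  let ?F = "\<lambda>\<omega>. \<Sum>i\<le>n. sgd_error h i \<omega>"
  let ?W = "\<lambda>e k. \<integral>\<omega>. (increment e (sgd_error h k \<omega>) (D (Suc k) \<omega>))\<^sup>2 \<partial>M"
  note coord = sum_sgd_error_coordinate[of _ h n]
  show "integrable M (\<lambda>\<omega>. \<Sigma> (?F \<omega>) \<bullet> ?F \<omega>)"
    unfolding Sigma_diag quadratic_form_diag_op using coord by auto
  have "(\<integral>\<omega>. \<Sigma> (?F \<omega>) \<bullet> ?F \<omega> \<partial>M) = (\<Sum>e\<in>E. \<mu> e * (\<integral>\<omega>. (?F \<omega> \<bullet> e)\<^sup>2 \<partial>M))"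
    unfolding Sigma_diag quadratic_form_diag_op using coord by (subst Bochner_Integration.integral_sum) auto
  also have "\<dots> \<le> (\<Sum>e\<in>E. \<mu> e * (((1 / \<gamma> + lam * real n) / regularized_cov e)\<^sup>2 * (h \<bullet> e)\<^sup>2
      + (\<Sum>k<n. ?W e k) / (regularized_cov e)\<^sup>2))"
    using coord mu_pos by (intro sum_mono mult_left_mono) (auto simp: less_imp_le)
  also have "\<dots> = (\<Sum>e\<in>E. (1 / \<gamma> + lam * real n)\<^sup>2 * (weight e * (h \<bullet> e)\<^sup>2) + (\<Sum>k<n. weight e * ?W e k))"
    by (intro sum.cong refl) (simp add: weight_def power_divide distrib_left sum_distrib_left sum_divide_distrib mult_ac)
  also have "\<dots> = (1 / \<gamma> + lam * real n)\<^sup>2 * S + (\<Sum>k<n. \<Sum>e\<in>E. weight e * ?W e k)"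
    by (simp add: sum.distrib sum_distrib_left S_def sum.swap[of _ E])
  also have "(\<Sum>k<n. \<Sum>e\<in>E. weight e * ?W e k)
      \<le> (\<Sum>k<n. 2 * (\<integral>\<omega>. (X (D (Suc k) \<omega>) \<bullet> sgd_error h k \<omega>)\<^sup>2 * weighted_sq (D (Suc k) \<omega>) \<partial>M) + 2 * \<sigma>\<^sup>2 * T)"
    unfolding T_def by (intro sum_mono weighted_increment_sq square_integrable_past_sgd_error)
  also have "\<dots> = 2 * (\<Sum>k<n. \<integral>\<omega>. (X (D (Suc k) \<omega>) \<bullet> sgd_error h k \<omega>)\<^sup>2 * weighted_sq (D (Suc k) \<omega>) \<partial>M)
      + real n * (2 * \<sigma>\<^sup>2 * T)"
    by (simp add: sum.distrib sum_distrib_left)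
  also have "\<dots> \<le> 2 * (6 * lam * real n * R\<^sup>2 * S + 4 * (c / \<gamma>) * R\<^sup>2 * T + 4 * real n * (\<gamma> * \<sigma>\<^sup>2) * R\<^sup>2 * T)
      + real n * (2 * \<sigma>\<^sup>2 * T)"
    using sum_weighted_sgd_error[of h n] unfolding S_def T_def c_def by (intro add_mono mult_left_mono) auto
  finally show "(\<integral>\<omega>. \<Sigma> (?F \<omega>) \<bullet> ?F \<omega> \<partial>M)
      \<le> ((1 / \<gamma> + lam * real n)\<^sup>2 + 12 * lam * real n * R\<^sup>2) * S
        + (8 * (c / \<gamma>) * R\<^sup>2 + 8 * real n * (\<gamma> * \<sigma>\<^sup>2) * R\<^sup>2 + 2 * real n * \<sigma>\<^sup>2) * T"
    by (simp add: algebra_simps)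
qed

end

section \<open>The excess risk\<close>

text \<open>With \<open>g = 1 / \<gamma>\<close> the step-size condition reads
  \<open>R\<^sup>2 \<le> g / 2\<close>, which eliminates \<open>R\<close>. Averaging divides
  \<open>I\<close> by \<open>(n + 1)^2\<close> and the risk halves it, so the constants 6, 12 and 6
  below are twice those of the claim.\<close>

lemma excess_risk_arithmetic:
  fixes \<gamma> lam R \<sigma> S T c tr :: real and n :: nat
  assumes \<gamma>: "\<gamma> > 0" "\<gamma> * R\<^sup>2 \<le> 1 / 2" and lam: "lam \<ge> 0" and n: "n \<ge> 1"
    and S: "S \<ge> 0" and T: "0 \<le> T" "T \<le> tr" and c: "c \<ge> 0"
    and I: "I \<le> ((1 / \<gamma> + lam * real n)\<^sup>2 + 12 * lam * real n * R\<^sup>2) * S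
        + (8 * (c / \<gamma>) * R\<^sup>2 + 8 * real n * (\<gamma> * \<sigma>\<^sup>2) * R\<^sup>2 + 2 * real n * \<sigma>\<^sup>2) * T"
  shows "1 / 2 * (I / (real n + 1)\<^sup>2) \<le> 3 * (2 * lam + 1 / (\<gamma> * real n))\<^sup>2 * S
     + 6 * \<sigma>\<^sup>2 / (real n + 1) * T + 3 * (c * tr) / (\<gamma>\<^sup>2 * (real n + 1)\<^sup>2)"
proof -
  define g where "g = 1 / \<gamma>"
  define N where "N = real n + 1"
  have g: "g > 0" and N: "N > 0" "real n > 0" "real n \<le> N"
    using \<gamma> n by (auto simp: g_def N_def)
  have R: "R\<^sup>2 \<le> g / 2"
    using \<gamma> by (simp add: g_def field_simps)
  have "(g + lam * real n)\<^sup>2 + 12 * lam * real n * R\<^sup>2 \<le> (g + lam * real n)\<^sup>2 + 12 * lam * real n * (g / 2)"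
    using R lam by (intro add_left_mono mult_left_mono) auto
  also have "\<dots> = g\<^sup>2 + 8 * (g * (lam * real n)) + (lam * real n)\<^sup>2"
    by (simp add: power2_eq_square algebra_simps)
  \<comment> \<open>Relaxed to the expansion of \<open>6 (g + 2 lam n)^2\<close>, a multiple of the
    square in the claim.\<close>
  also have "\<dots> \<le> 6 * g\<^sup>2 + 24 * (g * (lam * real n)) + 24 * (lam * real n)\<^sup>2"
    using g lam by (intro add_mono) auto
  also have "\<dots> = 6 * (real n * (2 * lam + g / real n))\<^sup>2"
    using N by (simp add: power2_eq_square field_simps)
  \<comment> \<open>The deterministic weight grows with \<open>n\<close>, the average divides by
    \<open>n + 1\<close>: factoring out \<open>n\<close> first leaves
    \<open>1 / (\<gamma> n)\<close> in the claim.\<close>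
  also have "\<dots> \<le> 6 * (N * (2 * lam + g / real n))\<^sup>2"
    using N lam g by (intro mult_left_mono power_mono mult_right_mono) auto
  finally have 1: "((g + lam * real n)\<^sup>2 + 12 * lam * real n * R\<^sup>2) * S \<le> 6 * (N * (2 * lam + g / real n))\<^sup>2 * S"
    using S by (rule mult_right_mono)
  have "8 * (c * g) * R\<^sup>2 \<le> 8 * (c * g) * (g / 2)"
    using c g R by (intro mult_left_mono) auto
  moreover have "8 * real n * \<sigma>\<^sup>2 * (\<gamma> * R\<^sup>2) \<le> 8 * real n * \<sigma>\<^sup>2 * (1 / 2)"
    using \<gamma> by (intro mult_left_mono) auto
  moreover have "real n * \<sigma>\<^sup>2 \<le> N * \<sigma>\<^sup>2"
    using N by (intro mult_right_mono) auto
  moreover have "8 * real n * (\<gamma> * \<sigma>\<^sup>2) * R\<^sup>2 = 8 * real n * \<sigma>\<^sup>2 * (\<gamma> * R\<^sup>2)"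
    and "8 * (c * g) * (g / 2) = 4 * (c * g\<^sup>2)"
    by (simp_all add: power2_eq_square)
  ultimately have "8 * (c * g) * R\<^sup>2 + 8 * real n * (\<gamma> * \<sigma>\<^sup>2) * R\<^sup>2 + 2 * real n * \<sigma>\<^sup>2 \<le> 4 * (c * g\<^sup>2) + 6 * (N * \<sigma>\<^sup>2)"
    by linarith
  then have "(8 * (c * g) * R\<^sup>2 + 8 * real n * (\<gamma> * \<sigma>\<^sup>2) * R\<^sup>2 + 2 * real n * \<sigma>\<^sup>2) * T
      \<le> (4 * (c * g\<^sup>2) + 6 * (N * \<sigma>\<^sup>2)) * T"
    using T(1) by (rule mult_right_mono)
  \<comment> \<open>The constants 4 and 6 are relaxed to 6 and 12, and in the bias term
    \<open>T\<close> to the larger trace \<open>tr\<close>.\<close>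
  also have "\<dots> \<le> 6 * (c * g\<^sup>2 * tr) + 12 * (N * \<sigma>\<^sup>2 * T)"
  proof -
    have "c * g\<^sup>2 * T \<le> c * g\<^sup>2 * tr" "0 \<le> c * g\<^sup>2 * T" "0 \<le> N * \<sigma>\<^sup>2 * T"
      using c T N by (auto intro!: mult_left_mono)
    then show ?thesis
      by (simp add: algebra_simps)
  qed
  finally have 2: "(8 * (c * g) * R\<^sup>2 + 8 * real n * (\<gamma> * \<sigma>\<^sup>2) * R\<^sup>2 + 2 * real n * \<sigma>\<^sup>2) * T
      \<le> 6 * (c * g\<^sup>2 * tr) + 12 * (N * \<sigma>\<^sup>2 * T)" .
  have "I \<le> 6 * (N * (2 * lam + g / real n))\<^sup>2 * S + (6 * (c * g\<^sup>2 * tr) + 12 * (N * \<sigma>\<^sup>2 * T))"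
    using I 1 2 by (simp add: g_def)
  then have "I / N\<^sup>2 \<le> (6 * (N * (2 * lam + g / real n))\<^sup>2 * S + (6 * (c * g\<^sup>2 * tr) + 12 * (N * \<sigma>\<^sup>2 * T))) / N\<^sup>2"
    using N by (intro divide_right_mono) auto
  also have "\<dots> = 6 * (2 * lam + g / real n)\<^sup>2 * S + 6 * (c * tr) * g\<^sup>2 / N\<^sup>2 + 12 * \<sigma>\<^sup>2 / N * T"
    using N by (simp add: add_divide_distrib power_mult_distrib) (simp add: power2_eq_square mult_ac)
  finally show ?thesis
    by (simp add: g_def N_def[symmetric] power_divide)
qed

lemma loewner_leD: "A \<preceq>\<^sub>L B \<Longrightarrow> blinfun_apply A v \<bullet> v \<le> blinfun_apply B v \<bullet> v"
  by (simp add: loewner_le_def pos_semidef_def blinfun.diff_left inner_diff_left)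

theorem theorem1:
  fixes M :: "'w measure"
    and x :: "nat \<Rightarrow> 'w \<Rightarrow> 'a::euclidean_space"
    and y :: "nat \<Rightarrow> 'w \<Rightarrow> real"
    and \<Sigma> \<Sigma>_lam :: "'a \<Rightarrow>\<^sub>L 'a"
    and \<theta>\<^sub>s \<theta>\<^sub>0 :: 'a
    and R \<sigma> lam \<gamma> :: real
    and n :: nat
  assumes prob: "prob_space M"
    and indep: "prob_space.indep_vars M (\<lambda>_. borel) (\<lambda>k \<omega>. (x k \<omega>, y k \<omega>)) {1..}"
    and ident: "\<And>k. k \<ge> 1 \<Longrightarrow>
          distr M borel (\<lambda>\<omega>. (x k \<omega>, y k \<omega>)) = distr M borel (\<lambda>\<omega>. (x 1 \<omega>, y 1 \<omega>))"
    and x_moment: "integrable M (\<lambda>\<omega>. (norm (x 1 \<omega>))\<^sup>2)"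
    and y_moment: "integrable M (\<lambda>\<omega>. (y 1 \<omega>)\<^sup>2)"
    and Sigma: "\<Sigma> = (\<integral>\<omega>. tensor_sq (x 1 \<omega>) \<partial>M)"
    and Sigma_inv: "op_invertible \<Sigma>"
    and theta_star: "\<theta>\<^sub>s = blinfun_apply (op_inv \<Sigma>) (\<integral>\<omega>. y 1 \<omega> *\<^sub>R x 1 \<omega> \<partial>M)"
    and R_pos: "R > 0"
    and R_int: "integrable M (\<lambda>\<omega>. (norm (x 1 \<omega>))\<^sup>2 *\<^sub>R tensor_sq (x 1 \<omega>))"
    and R_bound: "(\<integral>\<omega>. (norm (x 1 \<omega>))\<^sup>2 *\<^sub>R tensor_sq (x 1 \<omega>) \<partial>M) \<preceq>\<^sub>L R\<^sup>2 *\<^sub>R \<Sigma>"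
    and sigma_pos: "\<sigma> > 0"
    and sigma_int: "integrable M (\<lambda>\<omega>. (y 1 \<omega> - \<theta>\<^sub>s \<bullet> x 1 \<omega>)\<^sup>2 *\<^sub>R tensor_sq (x 1 \<omega>))"
    and sigma_bound:
      "(\<integral>\<omega>. (y 1 \<omega> - \<theta>\<^sub>s \<bullet> x 1 \<omega>)\<^sup>2 *\<^sub>R tensor_sq (x 1 \<omega>) \<partial>M) \<preceq>\<^sub>L \<sigma>\<^sup>2 *\<^sub>R \<Sigma>"
    and lam_bounds: "0 \<le> lam" "lam \<le> R\<^sup>2 / 2"
    and gamma_bounds: "0 < \<gamma>" "\<gamma> \<le> 1 / (2 * R\<^sup>2)"
    and n_pos: "n \<ge> 1"
    and Sigma_lambda: "\<Sigma>_lam = \<Sigma> + lam *\<^sub>R id_blinfun"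
  shows "integrable M (\<lambda>\<omega>. ls_risk M (x 1) (y 1)
           (avg_reg_sgd \<gamma> lam \<theta>\<^sub>0 (\<lambda>k. x k \<omega>) (\<lambda>k. y k \<omega>) n))
       \<and> (\<integral>\<omega>. ls_risk M (x 1) (y 1)
           (avg_reg_sgd \<gamma> lam \<theta>\<^sub>0 (\<lambda>k. x k \<omega>) (\<lambda>k. y k \<omega>) n) \<partial>M) - ls_risk M (x 1) (y 1) \<theta>\<^sub>s
         \<le> 3 * (2 * lam + 1 / (\<gamma> * real n))\<^sup>2
               * (norm (blinfun_apply (op_sqrt \<Sigma> o\<^sub>L op_inv \<Sigma>_lam) (\<theta>\<^sub>0 - \<theta>\<^sub>s)))\<^sup>2
           + 6 * \<sigma>\<^sup>2 / (real n + 1)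
               * op_trace (\<Sigma> o\<^sub>L \<Sigma> o\<^sub>L op_inv \<Sigma>_lam o\<^sub>L op_inv \<Sigma>_lam)
           + 3 * ((norm (blinfun_apply (op_inv (op_sqrt \<Sigma>_lam)) (\<theta>\<^sub>0 - \<theta>\<^sub>s)))\<^sup>2
                   * op_trace (\<Sigma> o\<^sub>L op_inv \<Sigma>_lam))
               / (\<gamma>\<^sup>2 * (real n + 1)\<^sup>2)"
proof -
  interpret prob_space M by (rule prob)
  define x1 y1 where "x1 = x 1" and "y1 = y 1"
  define D where "D k \<omega> = (x k \<omega>, y k \<omega>)" for k \<omega>
  \<comment> \<open>The first observation itself can be the generic copy, since only the law of
    \<open>Z\<close> is ever used.\<close>
  define Z where "Z \<omega> = (x1 \<omega>, y1 \<omega>)" for \<omega>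
  define \<epsilon> where "\<epsilon> d = snd d - \<theta>\<^sub>s \<bullet> fst d" for d :: "'a \<times> real"
  have \<epsilon>_Z: "\<epsilon> (Z \<omega>) = y1 \<omega> - \<theta>\<^sub>s \<bullet> x1 \<omega>" for \<omega>
    by (simp add: \<epsilon>_def Z_def)
  have Z_meas: "Z \<in> borel_measurable M"
    using indep unfolding indep_vars_def Z_def[abs_def] x1_def y1_def by auto
  have fst_meas: "(fst :: 'a \<times> real \<Rightarrow> 'a) \<in> borel_measurable borel"
    by (intro borel_measurable_continuous_onI continuous_on_fst continuous_on_id)
  have snd_meas: "(snd :: 'a \<times> real \<Rightarrow> real) \<in> borel_measurable borel"
    by (intro borel_measurable_continuous_onI continuous_on_snd continuous_on_id)
  have \<epsilon>_meas: "\<epsilon> \<in> borel_measurable borel"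
    unfolding \<epsilon>_def[abs_def] by (intro borel_measurable_continuous_onI continuous_intros)
  have x1_meas [measurable]: "x1 \<in> borel_measurable M"
    using measurable_compose[OF Z_meas fst_meas] by (simp add: Z_def)
  have y1_meas [measurable]: "y1 \<in> borel_measurable M"
    using measurable_compose[OF Z_meas snd_meas] by (simp add: Z_def)
  note moments = x_moment[folded x1_def] y_moment[folded y1_def]
  have iid: "iid_sequence M D Z"
  proof (intro iid_sequence.intro prob iid_sequence_axioms.intro)
    show "indep_vars (\<lambda>_. borel) D {1..}"
      using indep unfolding D_def[abs_def] .
    show "distr M borel (D k) = distr M borel Z" if "k \<ge> 1" for k
      using ident[OF that] unfolding D_def[abs_def] Z_def[abs_def] x1_def y1_def .
  qed (rule Z_meas)

  \<comment> \<open>Bounded linear functionals commute with the Bochner integral; these turn the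
    operator-valued moments into scalar integrals.\<close>
  have form: "bounded_linear (\<lambda>A :: 'a \<Rightarrow>\<^sub>L 'a. blinfun_apply A u \<bullet> v)" for u v
    by (intro bounded_linear_compose[OF bounded_linear_inner_left] blinfun.bounded_linear_left)
  have tensor_int: "integrable M (\<lambda>\<omega>. tensor_sq (x1 \<omega>))"
  proof (rule Bochner_Integration.integrable_bound[OF moments(1)])
    have "continuous_on UNIV (tensor_sq :: 'a \<Rightarrow> 'a \<Rightarrow>\<^sub>L 'a)"
      unfolding tensor_sq_def[abs_def]
      by (intro bounded_bilinear.continuous_on[OF bounded_bilinear_blinfun_compose]
          bounded_linear.continuous_on[OF bounded_linear_blinfun_scaleR_left]
          bounded_linear.continuous_on[OF bounded_linear_blinfun_inner_left] continuous_on_id)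
    then show "(\<lambda>\<omega>. tensor_sq (x1 \<omega>)) \<in> borel_measurable M"
      using borel_measurable_continuous_onI measurable_compose[OF x1_meas] by blast
    have "norm (tensor_sq u) \<le> (norm u)\<^sup>2" for u :: 'a
      using mult_right_mono[OF Cauchy_Schwarz_ineq2[of u], of "norm u"]
      by (intro norm_blinfun_bound) (auto simp: tensor_sq_apply power2_eq_square mult_ac)
    then show "AE \<omega> in M. norm (tensor_sq (x1 \<omega>)) \<le> norm ((norm (x1 \<omega>))\<^sup>2)"
      by simp
  qed
  have weighted_form:
    "integrable M (\<lambda>\<omega>. w \<omega> * ((x1 \<omega> \<bullet> u) * (x1 \<omega> \<bullet> v)))"
    "(\<integral>\<omega>. w \<omega> *\<^sub>R tensor_sq (x1 \<omega>) \<partial>M) u \<bullet> v = (\<integral>\<omega>. w \<omega> * ((x1 \<omega> \<bullet> u) * (x1 \<omega> \<bullet> v)) \<partial>M)"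
    if "integrable M (\<lambda>\<omega>. w \<omega> *\<^sub>R tensor_sq (x1 \<omega>))" for w u v
    using integrable_bounded_linear[OF form that, of u v] integral_bounded_linear[OF form that, of u v]
    by (simp_all add: blinfun.scaleR_left tensor_sq_apply mult.assoc)
  \<comment> \<open>The trace of the operator-valued integrand. For the weight
    \<open>(norm (x1 \<omega>))\<^sup>2\<close> this is the finite fourth moment of the
    input.\<close>
  have weighted_norm: "integrable M (\<lambda>\<omega>. w \<omega> * (norm (x1 \<omega>))\<^sup>2)"
    if "integrable M (\<lambda>\<omega>. w \<omega> *\<^sub>R tensor_sq (x1 \<omega>))" for w
  proof -
    have "w \<omega> * (norm (x1 \<omega>))\<^sup>2 = (\<Sum>b\<in>Basis. w \<omega> * ((x1 \<omega> \<bullet> b) * (x1 \<omega> \<bullet> b)))" for \<omega>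
      by (simp add: power2_norm_eq_inner euclidean_inner[of "x1 \<omega>" "x1 \<omega>"] sum_distrib_left)
    then show ?thesis
      using weighted_form(1)[OF that] by simp
  qed
  note Rw = weighted_form[OF R_int[folded x1_def]] weighted_norm[OF R_int[folded x1_def]]
  note sw = weighted_form[OF sigma_int[folded x1_def y1_def]] weighted_norm[OF sigma_int[folded x1_def y1_def]]
  have cov: "\<Sigma> u \<bullet> v = (\<integral>\<omega>. (x1 \<omega> \<bullet> u) * (x1 \<omega> \<bullet> v) \<partial>M)"
    and int_cov: "integrable M (\<lambda>\<omega>. (x1 \<omega> \<bullet> u) * (x1 \<omega> \<bullet> v))" for u v
    using weighted_form[of "\<lambda>_. 1"] tensor_int unfolding Sigma x1_def by simp_all
  have selfadjoint: "\<Sigma> u \<bullet> v = u \<bullet> \<Sigma> v" for u v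
    unfolding inner_commute[of u] cov by (simp add: mult.commute)
  obtain E where E: "orthonormal_basis E" and eig: "\<And>e. e \<in> E \<Longrightarrow> \<Sigma> e = (\<Sigma> e \<bullet> e) *\<^sub>R e"
    using selfadjoint_eigenbasis[OF selfadjoint] by blast
  interpret orthonormal_basis E by (rule E)
  define \<mu> where "\<mu> e = \<Sigma> e \<bullet> e" for e
  have diag: "\<Sigma> = diag_op E \<mu>"
    by (rule blinfun_eq_diag_op) (use eig \<mu>_def in auto)
  have \<mu>_pos: "\<mu> e > 0" if e: "e \<in> E" for e
  proof -
    have "\<mu> e \<ge> 0"
      unfolding \<mu>_def cov by (intro integral_nonneg_AE) simp
    moreover have "\<mu> e \<noteq> 0"
    proof
      assume "\<mu> e = 0"
      then have "\<Sigma> e = 0"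
        using eig[OF e] by (simp add: \<mu>_def)
      moreover obtain B where "B o\<^sub>L \<Sigma> = id_blinfun"
        using Sigma_inv by (auto simp: op_invertible_def)
      ultimately have "e = 0"
        by (metis blinfun.zero_right blinfun_apply_blinfun_compose id_blinfun.rep_eq)
      then show False
        using orthonormal[OF e e] by simp
    qed
    ultimately show ?thesis
      by simp
  qed
  have int_yx: "integrable M (\<lambda>\<omega>. y1 \<omega> *\<^sub>R x1 \<omega>)"
  proof (rule Bochner_Integration.integrable_bound)
    show "integrable M (\<lambda>\<omega>. (y1 \<omega>)\<^sup>2 + (norm (x1 \<omega>))\<^sup>2)"
      using moments by simp
    have "\<bar>s\<bar> * norm u \<le> s\<^sup>2 + (norm u)\<^sup>2" for s and u :: 'a
      using zero_le_power2[of "\<bar>s\<bar> - norm u"] zero_le_power2[of s] zero_le_power2[of "norm u"]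
      unfolding power2_diff power2_abs by linarith
    then show "AE \<omega> in M. norm (y1 \<omega> *\<^sub>R x1 \<omega>) \<le> norm ((y1 \<omega>)\<^sup>2 + (norm (x1 \<omega>))\<^sup>2)"
      by simp
  qed measurable
  have "op_inv \<Sigma> = diag_op E (\<lambda>e. 1 / \<mu> e)"
    unfolding diag using \<mu>_pos by (intro op_inv_diag_op) force
  moreover have "\<mu> e \<noteq> 0" if "e \<in> E" for e
    using \<mu>_pos[OF that] by simp
  ultimately have "\<Sigma> o\<^sub>L op_inv \<Sigma> = id_blinfun"
    unfolding diag by (simp add: diag_op_compose diag_op_one)
  then have normal_eq: "\<Sigma> \<theta>\<^sub>s = (\<integral>\<omega>. y1 \<omega> *\<^sub>R x1 \<omega> \<partial>M)"
    unfolding theta_star x1_def y1_def by (metis blinfun_apply_blinfun_compose id_blinfun.rep_eq)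
  have int_yxv: "integrable M (\<lambda>\<omega>. y1 \<omega> * (x1 \<omega> \<bullet> v))"
    and yxv: "(\<integral>\<omega>. y1 \<omega> * (x1 \<omega> \<bullet> v) \<partial>M) = \<Sigma> \<theta>\<^sub>s \<bullet> v" for v
    using integrable_bounded_linear[OF bounded_linear_inner_left int_yx, of v]
      integral_bounded_linear[OF bounded_linear_inner_left int_yx, of v]
    unfolding normal_eq by simp_all
  have eps_eq: "(y1 \<omega> - \<theta>\<^sub>s \<bullet> x1 \<omega>) * (x1 \<omega> \<bullet> v) = y1 \<omega> * (x1 \<omega> \<bullet> v) - (x1 \<omega> \<bullet> \<theta>\<^sub>s) * (x1 \<omega> \<bullet> v)" for \<omega> v
    by (simp add: inner_commute left_diff_distrib)
  \<comment> \<open>The normal equation: the residual at \<open>\<theta>\<^sub>s\<close> is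
    uncorrelated with the input, though it need not be independent of it.\<close>
  have eps0: "(\<integral>\<omega>. (y1 \<omega> - \<theta>\<^sub>s \<bullet> x1 \<omega>) * (x1 \<omega> \<bullet> v) \<partial>M) = 0"
    and int_eps: "integrable M (\<lambda>\<omega>. (y1 \<omega> - \<theta>\<^sub>s \<bullet> x1 \<omega>) * (x1 \<omega> \<bullet> v))" for v
    unfolding eps_eq using int_yxv int_cov by (simp_all add: yxv cov[symmetric])
  have gR: "\<gamma> * R\<^sup>2 \<le> 1 / 2"
    using gamma_bounds R_pos by (simp add: field_simps)
  have gl: "\<gamma> * lam \<le> 1 / 4"
  proof -
    have "\<gamma> * lam \<le> \<gamma> * (R\<^sup>2 / 2)"
      using lam_bounds(2) gamma_bounds(1) by (intro mult_left_mono) auto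
    then show ?thesis
      using gR by simp
  qed
  interpret least_squares_sgd M D Z E fst \<epsilon> \<mu> \<Sigma> R \<sigma> lam \<gamma>
  proof (intro least_squares_sgd.intro least_squares_sgd_axioms.intro iid E)
    show "integrable M (\<lambda>\<omega>. (norm (fst (Z \<omega>)))^4)"
      using Rw(3) by (simp add: Z_def flip: power_add)
    show "integrable M (\<lambda>\<omega>. (\<epsilon> (Z \<omega>))\<^sup>2 * (norm (fst (Z \<omega>)))\<^sup>2)"
      using sw(3) unfolding \<epsilon>_Z by (simp add: Z_def)
    show "(\<integral>\<omega>. (fst (Z \<omega>) \<bullet> u) * (fst (Z \<omega>) \<bullet> v) \<partial>M) = \<Sigma> u \<bullet> v" for u v
      unfolding cov by (simp add: Z_def)
    show "(\<integral>\<omega>. \<epsilon> (Z \<omega>) * (fst (Z \<omega>) \<bullet> v) \<partial>M) = 0" for v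
      using eps0 unfolding \<epsilon>_Z by (simp add: Z_def)
    show "(\<integral>\<omega>. (norm (fst (Z \<omega>)))\<^sup>2 * (fst (Z \<omega>) \<bullet> v)\<^sup>2 \<partial>M) \<le> R\<^sup>2 * (\<Sigma> v \<bullet> v)" for v
      using loewner_leD[OF R_bound[folded x1_def], of v] unfolding Rw(2)
      by (simp add: blinfun.scaleR_left Z_def power2_eq_square)
    show "(\<integral>\<omega>. (\<epsilon> (Z \<omega>))\<^sup>2 * (fst (Z \<omega>) \<bullet> v)\<^sup>2 \<partial>M) \<le> \<sigma>\<^sup>2 * (\<Sigma> v \<bullet> v)" for v
      using loewner_leD[OF sigma_bound[folded x1_def y1_def], of v] unfolding sw(2) \<epsilon>_Z
      by (simp add: blinfun.scaleR_left Z_def power2_eq_square)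
  qed (use fst_meas \<epsilon>_meas diag \<mu>_pos lam_bounds gamma_bounds gR gl in auto)

  define h where "h = \<theta>\<^sub>0 - \<theta>\<^sub>s"
  have error: "reg_sgd \<gamma> lam \<theta>\<^sub>0 (\<lambda>k. x k \<omega>) (\<lambda>k. y k \<omega>) i - \<theta>\<^sub>s = sgd_error h i \<omega>" for i \<omega>
  proof (induction i)
    case (Suc i)
    have *: "reg_sgd \<gamma> lam \<theta>\<^sub>0 (\<lambda>k. x k \<omega>) (\<lambda>k. y k \<omega>) i = sgd_error h i \<omega> + \<theta>\<^sub>s"
      using Suc by (simp add: algebra_simps)
    show ?case
      unfolding reg_sgd.simps process.simps * blinfun.diff_left blinfun.scaleR_left tensor_sq_apply
      by (simp add: contraction_def D_def \<epsilon>_def h_def inner_add_right inner_commute algebra_simps)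
  qed (simp add: h_def)
  let ?F = "\<lambda>\<omega>. \<Sum>i\<le>n. sgd_error h i \<omega>"
  let ?avg = "\<lambda>\<omega>. avg_reg_sgd \<gamma> lam \<theta>\<^sub>0 (\<lambda>k. x k \<omega>) (\<lambda>k. y k \<omega>) n"
  have avg: "?avg \<omega> - \<theta>\<^sub>s = (1 / (real n + 1)) *\<^sub>R ?F \<omega>" for \<omega>
  proof -
    have "?F \<omega> = (\<Sum>i\<le>n. reg_sgd \<gamma> lam \<theta>\<^sub>0 (\<lambda>k. x k \<omega>) (\<lambda>k. y k \<omega>) i) - (real n + 1) *\<^sub>R \<theta>\<^sub>s"
      unfolding error[symmetric] by (simp add: sum_subtractf sum_constant_scaleR add.commute)
    then show ?thesis
      by (simp add: avg_reg_sgd_def atLeast0AtMost scaleR_diff_right)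
  qed
  define \<sigma>\<^sub>0 where "\<sigma>\<^sub>0 = (\<integral>\<omega>. (y1 \<omega> - \<theta>\<^sub>s \<bullet> x1 \<omega>)\<^sup>2 \<partial>M)"
  \<comment> \<open>The square is completed at \<open>\<theta>\<^sub>s\<close>; \<open>eps0\<close>
    removes the linear term, so the excess risk is half the \<Sigma>-form of the deviation.\<close>
  have risk: "ls_risk M (x 1) (y 1) \<theta> = 1 / 2 * (\<Sigma> (\<theta> - \<theta>\<^sub>s) \<bullet> (\<theta> - \<theta>\<^sub>s)) + 1 / 2 * \<sigma>\<^sub>0" for \<theta>
  proof -
    let ?\<delta> = "\<theta> - \<theta>\<^sub>s"
    have eq: "(x1 \<omega> \<bullet> \<theta> - y1 \<omega>)\<^sup>2 = (x1 \<omega> \<bullet> ?\<delta>) * (x1 \<omega> \<bullet> ?\<delta>)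
        - 2 * ((y1 \<omega> - \<theta>\<^sub>s \<bullet> x1 \<omega>) * (x1 \<omega> \<bullet> ?\<delta>)) + (y1 \<omega> - \<theta>\<^sub>s \<bullet> x1 \<omega>)\<^sup>2" for \<omega>
      by (simp add: inner_diff_right inner_commute power2_eq_square algebra_simps)
    have eps2: "(y1 \<omega> - \<theta>\<^sub>s \<bullet> x1 \<omega>)\<^sup>2 = (y1 \<omega>)\<^sup>2 - 2 * (y1 \<omega> * (x1 \<omega> \<bullet> \<theta>\<^sub>s)) + (x1 \<omega> \<bullet> \<theta>\<^sub>s) * (x1 \<omega> \<bullet> \<theta>\<^sub>s)" for \<omega>
      by (simp add: inner_commute power2_eq_square algebra_simps)
    have "integrable M (\<lambda>\<omega>. (y1 \<omega> - \<theta>\<^sub>s \<bullet> x1 \<omega>)\<^sup>2)"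
      unfolding eps2 using moments int_yxv int_cov by simp
    then have "(\<integral>\<omega>. (x1 \<omega> \<bullet> \<theta> - y1 \<omega>)\<^sup>2 \<partial>M) = \<Sigma> ?\<delta> \<bullet> ?\<delta> + \<sigma>\<^sub>0"
      unfolding eq using int_cov int_eps by (simp add: cov[symmetric] eps0 \<sigma>\<^sub>0_def)
    then show ?thesis
      by (simp add: ls_risk_def x1_def y1_def)
  qed
  have risk_avg: "ls_risk M (x 1) (y 1) (?avg \<omega>)
      = 1 / 2 * ((\<Sigma> (?F \<omega>) \<bullet> ?F \<omega>) / (real n + 1)\<^sup>2) + 1 / 2 * \<sigma>\<^sub>0" for \<omega>
    unfolding risk avg by (simp add: blinfun.scaleR_right power2_eq_square)
  have risk_opt: "ls_risk M (x 1) (y 1) \<theta>\<^sub>s = 1 / 2 * \<sigma>\<^sub>0"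
    unfolding risk by simp

  have \<kappa>_pos: "regularized_cov e > 0" if "e \<in> E" for e
    by (rule regularized_cov_pos[OF that])
  \<comment> \<open>From here on the definite descriptions in the statement are evaluated in the
    eigenbasis, where its norms and traces become the sums of
    \<open>sum_sgd_error_bound\<close>.\<close>
  have lam_diag: "\<Sigma>_lam = diag_op E regularized_cov"
    unfolding Sigma_lambda diag diag_op_add_scaleR_id by (rule diag_op_cong) (simp add: regularized_cov_def)
  have inv_lam: "op_inv \<Sigma>_lam = diag_op E (\<lambda>e. 1 / regularized_cov e)"
    unfolding lam_diag using \<kappa>_pos by (intro op_inv_diag_op) force
  have norm_diag: "(norm (diag_op E a v))\<^sup>2 = (\<Sum>e\<in>E. (a e)\<^sup>2 * (v \<bullet> e)\<^sup>2)" for a v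
    unfolding norm_sq_expansion by (intro sum.cong) (auto simp: diag_op_inner power_mult_distrib)
  have sqrt_eq: "op_sqrt \<Sigma> = diag_op E (\<lambda>e. sqrt (\<mu> e))"
    unfolding diag by (rule op_sqrt_diag_op) (rule \<mu>_pos)
  have sqrt_lam_eq: "op_sqrt \<Sigma>_lam = diag_op E (\<lambda>e. sqrt (regularized_cov e))"
    unfolding lam_diag by (rule op_sqrt_diag_op) (rule \<kappa>_pos)
  have S_eq: "(norm (blinfun_apply (op_sqrt \<Sigma> o\<^sub>L op_inv \<Sigma>_lam) h))\<^sup>2 = (\<Sum>e\<in>E. weight e * (h \<bullet> e)\<^sup>2)"
    unfolding sqrt_eq inv_lam diag_op_compose norm_diag
    using \<mu>_pos by (intro sum.cong) (auto simp: weight_def power_divide less_imp_le)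
  have "op_inv (op_sqrt \<Sigma>_lam) = diag_op E (\<lambda>e. 1 / sqrt (regularized_cov e))"
    unfolding sqrt_lam_eq using \<kappa>_pos by (intro op_inv_diag_op) force
  then have c_eq: "(norm (blinfun_apply (op_inv (op_sqrt \<Sigma>_lam)) h))\<^sup>2 = (\<Sum>e\<in>E. (h \<bullet> e)\<^sup>2 / regularized_cov e)"
    using \<kappa>_pos by (auto simp: norm_diag power_divide less_imp_le intro!: sum.cong)
  have T_eq: "op_trace (\<Sigma> o\<^sub>L \<Sigma> o\<^sub>L op_inv \<Sigma>_lam o\<^sub>L op_inv \<Sigma>_lam) = (\<Sum>e\<in>E. weight e * \<mu> e)"
    unfolding diag inv_lam diag_op_compose op_trace_diag_op
    by (intro sum.cong) (auto simp: weight_def power2_eq_square)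
  have tr_eq: "op_trace (\<Sigma> o\<^sub>L op_inv \<Sigma>_lam) = (\<Sum>e\<in>E. \<mu> e / regularized_cov e)"
    unfolding diag inv_lam diag_op_compose op_trace_diag_op by simp
  \<comment> \<open>The bias estimate produces the trace with squared ratios, which is smaller than
    the one in the third term of the claim because the ratios are at most 1.\<close>
  have T_le: "(\<Sum>e\<in>E. weight e * \<mu> e) \<le> (\<Sum>e\<in>E. \<mu> e / regularized_cov e)"
  proof (rule sum_mono)
    fix e assume e: "e \<in> E"
    have "\<mu> e / regularized_cov e * (\<mu> e / regularized_cov e) \<le> \<mu> e / regularized_cov e * 1"
      using \<mu>_pos[OF e] \<kappa>_pos[OF e] lam_bounds by (intro mult_left_mono) (auto simp: regularized_cov_def)
    then show "weight e * \<mu> e \<le> \<mu> e / regularized_cov e"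
      by (simp add: weight_def power2_eq_square)
  qed
  note bound = sum_sgd_error_bound[of h n]
  have "1 / 2 * ((\<integral>\<omega>. \<Sigma> (?F \<omega>) \<bullet> ?F \<omega> \<partial>M) / (real n + 1)\<^sup>2)
      \<le> 3 * (2 * lam + 1 / (\<gamma> * real n))\<^sup>2 * (\<Sum>e\<in>E. weight e * (h \<bullet> e)\<^sup>2)
        + 6 * \<sigma>\<^sup>2 / (real n + 1) * (\<Sum>e\<in>E. weight e * \<mu> e)
        + 3 * ((\<Sum>e\<in>E. (h \<bullet> e)\<^sup>2 / regularized_cov e) * (\<Sum>e\<in>E. \<mu> e / regularized_cov e))
            / (\<gamma>\<^sup>2 * (real n + 1)\<^sup>2)"
  proof (rule excess_risk_arithmetic[OF gamma_bounds(1) gR lam_bounds(1) n_pos _ _ T_le _ conjunct2[OF bound]])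
    show "0 \<le> (\<Sum>e\<in>E. weight e * (h \<bullet> e)\<^sup>2)"
      using weight_nonneg by (intro sum_nonneg) auto
    show "0 \<le> (\<Sum>e\<in>E. weight e * \<mu> e)"
      using weight_nonneg \<mu>_pos by (intro sum_nonneg mult_nonneg_nonneg) (auto simp: less_imp_le)
    show "0 \<le> (\<Sum>e\<in>E. (h \<bullet> e)\<^sup>2 / regularized_cov e)"
      using \<kappa>_pos by (intro sum_nonneg) (auto intro!: divide_nonneg_pos)
  qed
  then show ?thesis
    unfolding h_def[symmetric] S_eq c_eq T_eq tr_eq risk_avg risk_opt
    using conjunct1[OF bound] by (simp add: prob_space)
qed

end
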